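(* Let $A$ be a finite abelian group and let $\mathcal E\in A\otimes_{\mathbb Z}\mathrm{Div}^0\,\mathbb P^1$ be an $A$-divisor of degree zero on $\mathbb P^1=\mathbb P^1_{\mathbb C}$. Let $\mathcal A=\bigoplus_{a\in A^*}\mathcal O_{\mathbb P^1}(\widetilde E_a)$ be the sheaf of $\mathcal O_{\mathbb P^1}$-algebras constructed from $\mathcal E$ as in the context. Then the curve $C:=\operatorname{Spec}_{\mathbb P^1}\mathcal A$ is smooth.
   Context: $\mathrm{Div}^0\,\mathbb P^1$ is the group of divisors of degree zero on $\mathbb P^1$ over $\mathbb C$. Let $A^*=\mathrm{Hom}_{\mathbb Z}(A,\mathbb Q/\mathbb Z)$. An $A$-divisor $\mathcal E\in A\otimes\mathrm{Div}^0\,\mathbb P^1$ is the same as a group homomorphism $A^*\to\mathrm{Div}^0_{\mathbb Q/\mathbb Z}\,\mathbb P^1=\mathbb Q/\mathbb Z\otimes\mathrm{Div}^0\,\mathbb P^1$, $a\mapsto E_a:=\langle\mathcal E,a\rangle$. For each $a\in A^*$ let $\widetilde E_a$ be an arbitrary lift of the $\mathbb Q/\mathbb Z$-divisor $E_a$ to a $\mathbb Q$-divisor of degree zero on $\mathbb P^1$. For $a,b\in A^*$ there are rational functions $f_{a,b}\in K(\mathbb P^1)^*$, unique up to constants, with $$\widetilde E_a+\widetilde E_b+\operatorname{div}(f_{a,b})=\widetilde E_{a+b},$$ and they are chosen (which is possible) such that $$f_{a,b}\,f_{a+b,c}=f_{a,b+c}\,f_{b,c}\qquad\text{for all }a,b,c\in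 A^*.$$ For a $\mathbb Q$-divisor $D$ put $\mathcal O_{\mathbb P^1}(D)=\mathcal O_{\mathbb P^1}(\lfloor D\rfloor)\subseteq K(\mathbb P^1)$. The maps $$\mathcal O_{\mathbb P^1}(\widetilde E_a)\otimes\mathcal O_{\mathbb P^1}(\widetilde E_b)\to\mathcal O_{\mathbb P^1}(\widetilde E_{a+b}),\qquad f\otimes g\mapsto f\,g\,f_{a,b}^{-1}$$ induce an associative multiplication on $\mathcal A=\bigoplus_{a\in A^*}\mathcal O_{\mathbb P^1}(\widetilde E_a)$, and $C:=\operatorname{Spec}_{\mathbb P^1}\mathcal A$ is the resulting $(\#A)$-fold covering of $\mathbb P^1$.
   Formalization: The functions are also required to satisfy f_{a,b} = f_{b,a}; the cocycle identity alone allows a noncommutative algebra (for E = 0, A = (Z/2)^2, constant f giving M_2(C)), for which Spec is undefined. *)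

theory Defs
  imports
    "HOL-Algebra.QuotRing"
    "HOL-Algebra.Ring_Divisibility"
    "HOL-Algebra.Generated_Rings"
    "HOL-Computational_Algebra.Fundamental_Theorem_Algebra"
    "HOL-Computational_Algebra.Field_as_Ring"
    "HOL-Computational_Algebra.Polynomial_Factorial"
    "HOL-Computational_Algebra.Normalized_Fraction"
    "HOL-Analysis.Abstract_Topology"
    "HOL-Library.Poly_Mapping"
    "HOL-Library.Cardinality"
begin

section \<open>Regular local rings and finitely generated algebras\<close>

definition complex_ring :: "complex ring" where
  "complex_ring = \<lparr>carrier = UNIV, mult = (*), one = 1, zero = 0, add = (+)\<rparr>"

abbreviation complex_algebra :: "(complex, 'k) module \<Rightarrow> bool" where
  "complex_algebra R \<equiv> algebra complex_ring R"

definition alg_hom :: "('c, 'k) module \<Rightarrow> ('c, 'l) module \<Rightarrow> ('k \<Rightarrow> 'l) set" where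
  "alg_hom R S = {h \<in> ring_hom R S. \<forall>c. \<forall>x\<in>carrier R. h (c \<odot>\<^bsub>R\<^esub> x) = c \<odot>\<^bsub>S\<^esub> h x}"

definition alg_iso :: "('c, 'k) module \<Rightarrow> ('c, 'l) module \<Rightarrow> ('k \<Rightarrow> 'l) set" where
  "alg_iso R S = alg_hom R S \<inter> ring_iso R S"

definition fin_gen_algebra :: "('c, 'k) module \<Rightarrow> bool" where
  "fin_gen_algebra R \<longleftrightarrow> (\<exists>S \<subseteq> carrier R. finite S \<and>
     generate_ring R (S \<union> {c \<odot>\<^bsub>R\<^esub> \<one>\<^bsub>R\<^esub> |c. True}) = carrier R)"

text \<open>There is a chain $P_0 \subset \dots \subset P_n$ of prime ideals.\<close>

definition prime_chain :: "('k, 'm) ring_scheme \<Rightarrow> nat \<Rightarrow> bool" where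
  "prime_chain R n \<longleftrightarrow>
     (\<exists>P. (\<forall>i\<le>n. primeideal (P i) R) \<and> (\<forall>i<n. P i \<subset> P (Suc i)))"

definition has_krull_dim :: "('k, 'm) ring_scheme \<Rightarrow> nat \<Rightarrow> bool" where
  "has_krull_dim R d \<longleftrightarrow> prime_chain R d \<and> (\<forall>n>d. \<not> prime_chain R n)"

definition regular_local_ring :: "('k, 'm) ring_scheme \<Rightarrow> bool" where
  "regular_local_ring R \<longleftrightarrow> cring R \<and> noetherian_ring R \<and>
     (\<exists>M. (\<forall>I. maximalideal I R \<longleftrightarrow> I = M) \<and>
        (\<exists>d S. has_krull_dim R d \<and> S \<subseteq> carrier R \<and> finite S \<and> card S = d \<and> M = Idl\<^bsub>R\<^esub> S))"


section \<open>Localization at a prime ideal\<close>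

text \<open>The fraction $a/h$ in $R_p$, as an equivalence class of pairs.\<close>

definition fraction_at :: "('c, 'k) module \<Rightarrow> 'k set \<Rightarrow> 'k \<Rightarrow> 'k \<Rightarrow> ('k \<times> 'k) set" where
  "fraction_at R p a h = {(b, k). b \<in> carrier R \<and> k \<in> carrier R - p \<and>
     (\<exists>u \<in> carrier R - p. u \<otimes>\<^bsub>R\<^esub> (a \<otimes>\<^bsub>R\<^esub> k) = u \<otimes>\<^bsub>R\<^esub> (b \<otimes>\<^bsub>R\<^esub> h))}"

text \<open>In each of the unions below all members coincide, because the operations on fractions
  do not depend on representatives.\<close>

definition localization :: "('c, 'k) module \<Rightarrow> 'k set \<Rightarrow> ('c, ('k \<times> 'k) set) module" where
  "localization R p =
    \<lparr>carrier = {fraction_at R p a h |a h. a \<in> carrier R \<and> h \<in> carrier R - p},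
     mult = (\<lambda>X Y. \<Union>(a, h)\<in>X. \<Union>(b, k)\<in>Y. fraction_at R p (a \<otimes>\<^bsub>R\<^esub> b) (h \<otimes>\<^bsub>R\<^esub> k)),
     one = fraction_at R p \<one>\<^bsub>R\<^esub> \<one>\<^bsub>R\<^esub>,
     zero = fraction_at R p \<zero>\<^bsub>R\<^esub> \<one>\<^bsub>R\<^esub>,
     add = (\<lambda>X Y. \<Union>(a, h)\<in>X. \<Union>(b, k)\<in>Y.
        fraction_at R p (a \<otimes>\<^bsub>R\<^esub> k \<oplus>\<^bsub>R\<^esub> b \<otimes>\<^bsub>R\<^esub> h) (h \<otimes>\<^bsub>R\<^esub> k)),
     module.smult = (\<lambda>c X. \<Union>(a, h)\<in>X. fraction_at R p (c \<odot>\<^bsub>R\<^esub> a) h)\<rparr>"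

definition regular_ring :: "('c, 'k) module \<Rightarrow> bool" where
  "regular_ring R \<longleftrightarrow> cring R \<and> noetherian_ring R \<and>
     (\<forall>p. primeideal p R \<longrightarrow> regular_local_ring (localization R p))"


section \<open>Ringed spaces over the complex numbers\<close>

text \<open>A topological space together with a sheaf of complex algebras; \<^term>\<open>res X U V\<close> is the
  restriction from \<open>U\<close> to \<open>V\<close>. Only the values on open sets matter.\<close>

record ('p, 's) ringed_space =
  spc :: "'p topology"
  sec :: "'p set \<Rightarrow> (complex, 's) module"
  res :: "'p set \<Rightarrow> 'p set \<Rightarrow> 's \<Rightarrow> 's"

locale complex_ringed_space =
  fixes X :: "('p, 's) ringed_space"
  assumes sec_algebra: "openin (spc X) U \<Longrightarrow> complex_algebra (sec X U)"
    and res_hom: "\<lbrakk>openin (spc X) U; openin (spc X) V; V \<subseteq> U\<rbrakk>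
      \<Longrightarrow> res X U V \<in> alg_hom (sec X U) (sec X V)"
    and res_id: "\<lbrakk>openin (spc X) U; s \<in> carrier (sec X U)\<rbrakk> \<Longrightarrow> res X U U s = s"
    and res_comp: "\<lbrakk>openin (spc X) U; openin (spc X) V; openin (spc X) W; W \<subseteq> V; V \<subseteq> U;
        s \<in> carrier (sec X U)\<rbrakk> \<Longrightarrow> res X V W (res X U V s) = res X U W s"
    and sheaf_local: "\<lbrakk>\<And>V. V \<in> \<V> \<Longrightarrow> openin (spc X) V;
        s \<in> carrier (sec X (\<Union>\<V>)); t \<in> carrier (sec X (\<Union>\<V>));
        \<And>V. V \<in> \<V> \<Longrightarrow> res X (\<Union>\<V>) V s = res X (\<Union>\<V>) V t\<rbrakk> \<Longrightarrow> s = t"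
    and sheaf_glue: "\<lbrakk>\<And>V. V \<in> \<V> \<Longrightarrow> openin (spc X) V;
        \<And>V. V \<in> \<V> \<Longrightarrow> \<sigma> V \<in> carrier (sec X V);
        \<And>V W. \<lbrakk>V \<in> \<V>; W \<in> \<V>\<rbrakk> \<Longrightarrow> res X V (V \<inter> W) (\<sigma> V) = res X W (V \<inter> W) (\<sigma> W)\<rbrakk>
      \<Longrightarrow> \<exists>s \<in> carrier (sec X (\<Union>\<V>)). \<forall>V\<in>\<V>. res X (\<Union>\<V>) V s = \<sigma> V"

definition open_subspace :: "('p, 's) ringed_space \<Rightarrow> 'p set \<Rightarrow> ('p, 's) ringed_space" where
  "open_subspace X W = \<lparr>spc = subtopology (spc X) W, sec = sec X, res = res X\<rparr>"

definition preimage :: "('p, 's) ringed_space \<Rightarrow> ('p \<Rightarrow> 'q) \<Rightarrow> 'q set \<Rightarrow> 'p set" where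
  "preimage X \<phi> V = {x \<in> topspace (spc X). \<phi> x \<in> V}"

text \<open>The germ at \<open>x\<close> of the section \<open>s\<close> over \<open>U\<close> is invertible in the stalk.\<close>

definition unit_at :: "('p, 's) ringed_space \<Rightarrow> 'p \<Rightarrow> 'p set \<Rightarrow> 's \<Rightarrow> bool" where
  "unit_at X x U s \<longleftrightarrow>
     (\<exists>W. openin (spc X) W \<and> x \<in> W \<and> W \<subseteq> U \<and> res X U W s \<in> Units (sec X W))"

definition natural_sheaf_map ::
  "('p, 's) ringed_space \<Rightarrow> ('q, 't) ringed_space \<Rightarrow> ('p \<Rightarrow> 'q) \<Rightarrow> ('q set \<Rightarrow> 't \<Rightarrow> 's) \<Rightarrow> bool" where
  "natural_sheaf_map X Y \<phi> \<Phi> \<longleftrightarrow>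
     (\<forall>V. openin (spc Y) V \<longrightarrow> \<Phi> V \<in> alg_hom (sec Y V) (sec X (preimage X \<phi> V))) \<and>
     (\<forall>U V. openin (spc Y) U \<and> openin (spc Y) V \<and> V \<subseteq> U \<longrightarrow>
        (\<forall>s \<in> carrier (sec Y U).
           \<Phi> V (res Y U V s) = res X (preimage X \<phi> U) (preimage X \<phi> V) (\<Phi> U s)))"

text \<open>Morphisms of locally ringed spaces: the last clause says that the maps on stalks are
  local homomorphisms.\<close>

definition lrs_morphism ::
  "('p, 's) ringed_space \<Rightarrow> ('q, 't) ringed_space \<Rightarrow> ('p \<Rightarrow> 'q) \<Rightarrow> ('q set \<Rightarrow> 't \<Rightarrow> 's) \<Rightarrow> bool" where
  "lrs_morphism X Y \<phi> \<Phi> \<longleftrightarrow>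
     continuous_map (spc X) (spc Y) \<phi> \<and> natural_sheaf_map X Y \<phi> \<Phi> \<and>
     (\<forall>x V s. x \<in> topspace (spc X) \<and> openin (spc Y) V \<and> \<phi> x \<in> V \<and> s \<in> carrier (sec Y V) \<and>
        unit_at X x (preimage X \<phi> V) (\<Phi> V s) \<longrightarrow> unit_at Y (\<phi> x) V s)"

definition rs_iso ::
  "('p, 's) ringed_space \<Rightarrow> ('q, 't) ringed_space \<Rightarrow> ('p \<Rightarrow> 'q) \<Rightarrow> ('q set \<Rightarrow> 't \<Rightarrow> 's) \<Rightarrow> bool" where
  "rs_iso X Y \<phi> \<Phi> \<longleftrightarrow>
     homeomorphic_map (spc X) (spc Y) \<phi> \<and> natural_sheaf_map X Y \<phi> \<Phi> \<and>
     (\<forall>V. openin (spc Y) V \<longrightarrow> \<Phi> V \<in> alg_iso (sec Y V) (sec X (preimage X \<phi> V)))"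


section \<open>Affine schemes and smoothness\<close>

definition prime_spectrum :: "('k, 'm) ring_scheme \<Rightarrow> 'k set set" where
  "prime_spectrum R = {p. primeideal p R}"

definition zariski_open :: "('k, 'm) ring_scheme \<Rightarrow> 'k set set \<Rightarrow> bool" where
  "zariski_open R V \<longleftrightarrow> (\<exists>S \<subseteq> carrier R. V = {p \<in> prime_spectrum R. \<not> S \<subseteq> p})"

lemma istopology_zariski_open: "istopology (zariski_open R)"
  unfolding istopology_def
proof (intro conjI allI impI)
  fix V W assume "zariski_open R V" "zariski_open R W"
  then obtain S T where S: "S \<subseteq> carrier R" "V = {p \<in> prime_spectrum R. \<not> S \<subseteq> p}"
    and T: "T \<subseteq> carrier R" "W = {p \<in> prime_spectrum R. \<not> T \<subseteq> p}"
    unfolding zariski_open_def by blast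
  let ?U = "{s \<otimes>\<^bsub>R\<^esub> t |s t. s \<in> S \<and> t \<in> T}"
  show "zariski_open R (V \<inter> W)"
  proof (cases "prime_spectrum R = {}")
    case True
    then show ?thesis using S unfolding zariski_open_def by blast
  next
    case False
    then obtain q where "primeideal q R" unfolding prime_spectrum_def by blast
    then interpret cring R by (rule primeideal.axioms)
    have "V \<inter> W = {p \<in> prime_spectrum R. \<not> ?U \<subseteq> p}"
    proof (intro Set.set_eqI iffI)
      fix p assume p: "p \<in> V \<inter> W"
      then interpret primeideal p R using S by (simp add: prime_spectrum_def)
      obtain s t where "s \<in> S" "s \<notin> p" "t \<in> T" "t \<notin> p" using p S T by auto
      moreover from this have "s \<otimes>\<^bsub>R\<^esub> t \<notin> p" using I_prime S T by blast
      ultimately show "p \<in> {p \<in> prime_spectrum R. \<not> ?U \<subseteq> p}" using p S by auto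
    next
      fix p assume p: "p \<in> {p \<in> prime_spectrum R. \<not> ?U \<subseteq> p}"
      then interpret primeideal p R by (simp add: prime_spectrum_def)
      obtain s t where "s \<in> S" "t \<in> T" "s \<otimes>\<^bsub>R\<^esub> t \<notin> p" using p by auto
      moreover from this have "s \<notin> p" "t \<notin> p" using I_l_closed I_r_closed S T by blast+
      ultimately show "p \<in> V \<inter> W" using p S T by auto
    qed
    moreover have "?U \<subseteq> carrier R" using S T by auto
    ultimately show ?thesis unfolding zariski_open_def by blast
  qed
next
  fix \<V> assume "\<forall>V\<in>\<V>. zariski_open R V"
  then obtain S where S: "\<And>V. V \<in> \<V> \<Longrightarrow> S V \<subseteq> carrier R"
    "\<And>V. V \<in> \<V> \<Longrightarrow> V = {p \<in> prime_spectrum R. \<not> S V \<subseteq> p}"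
    unfolding zariski_open_def by metis
  have "\<Union>\<V> = {p \<in> prime_spectrum R. \<not> \<Union>(S ` \<V>) \<subseteq> p}"
  proof (intro Set.set_eqI iffI)
    fix p assume "p \<in> \<Union>\<V>"
    then obtain V where "V \<in> \<V>" "p \<in> V" by blast
    moreover from this have "p \<in> prime_spectrum R" "\<not> S V \<subseteq> p" using S(2) by auto
    ultimately show "p \<in> {p \<in> prime_spectrum R. \<not> \<Union>(S ` \<V>) \<subseteq> p}" by blast
  next
    fix p assume "p \<in> {p \<in> prime_spectrum R. \<not> \<Union>(S ` \<V>) \<subseteq> p}"
    then obtain V where "V \<in> \<V>" "\<not> S V \<subseteq> p" "p \<in> prime_spectrum R" by blast
    moreover from this have "p \<in> V" using S(2)[of V] by blast
    ultimately show "p \<in> \<Union>\<V>" by blast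
  qed
  moreover have "\<Union>(S ` \<V>) \<subseteq> carrier R" using S(1) by blast
  ultimately show "zariski_open R (\<Union>\<V>)" unfolding zariski_open_def by (intro exI conjI)
qed

definition Spec :: "('c, 'k) module \<Rightarrow> 'k set topology" where
  "Spec R = topology (zariski_open R)"

text \<open>A section over \<open>V\<close> assigns to each \<open>p\<close> in \<open>V\<close> an element of $R_p$ and is locally
  a quotient of elements of \<open>R\<close>.\<close>

definition Spec_sections :: "('c, 'k) module \<Rightarrow> 'k set set \<Rightarrow> ('k set \<Rightarrow> ('k \<times> 'k) set) set" where
  "Spec_sections R V =
     {s \<in> (\<Pi>\<^sub>E p\<in>V. carrier (localization R p)).
        \<forall>p\<in>V. \<exists>W a h. zariski_open R W \<and> p \<in> W \<and> W \<subseteq> V \<and> a \<in> carrier R \<and> h \<in> carrier R \<and>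
           (\<forall>q\<in>W. h \<notin> q \<and> s q = fraction_at R q a h)}"

definition affine_scheme ::
  "(complex, 'k) module \<Rightarrow> ('k set, 'k set \<Rightarrow> ('k \<times> 'k) set) ringed_space" where
  "affine_scheme R =
    \<lparr>spc = Spec R,
     sec = (\<lambda>V. \<lparr>carrier = Spec_sections R V,
        mult = (\<lambda>s t. \<lambda>p\<in>V. s p \<otimes>\<^bsub>localization R p\<^esub> t p),
        one = (\<lambda>p\<in>V. \<one>\<^bsub>localization R p\<^esub>),
        zero = (\<lambda>p\<in>V. \<zero>\<^bsub>localization R p\<^esub>),
        add = (\<lambda>s t. \<lambda>p\<in>V. s p \<oplus>\<^bsub>localization R p\<^esub> t p),
        module.smult = (\<lambda>c s. \<lambda>p\<in>V. c \<odot>\<^bsub>localization R p\<^esub> s p)\<rparr>),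
     res = (\<lambda>U V s. restrict s V)\<rparr>"

definition global_fraction :: "(complex, 'k) module \<Rightarrow> 'k \<Rightarrow> 'k set \<Rightarrow> ('k \<times> 'k) set" where
  "global_fraction R a = (\<lambda>p\<in>prime_spectrum R. fraction_at R p a \<one>\<^bsub>R\<^esub>)"

text \<open>A scheme over the algebraically closed field of complex numbers is smooth iff it is locally
  of finite type and regular, i.e. iff each point has an affine open neighbourhood
  $\mathrm{Spec}\,R$ with \<open>R\<close> a finitely generated complex algebra all of whose local rings
  $R_p$ are regular. The type argument only names a type on which the algebras \<open>R\<close> live, since a
  definition in HOL cannot quantify over types.\<close>

definition smooth_over_complex :: "'k itself \<Rightarrow> ('p, 's) ringed_space \<Rightarrow> bool" where
  "smooth_over_complex T X \<longleftrightarrow> complex_ringed_space X \<and>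
     (\<forall>x \<in> topspace (spc X). \<exists>W (R :: (complex, 'k) module) \<phi> \<Phi>.
        openin (spc X) W \<and> x \<in> W \<and> complex_algebra R \<and> fin_gen_algebra R \<and> regular_ring R \<and>
        rs_iso (open_subspace X W) (affine_scheme R) \<phi> \<Phi>)"


section \<open>The projective line\<close>

datatype closed_point = Pt complex | Infinity

datatype p1_point = Closed closed_point | Generic

type_synonym ratfun = "complex poly fract"

fun ord_at :: "closed_point \<Rightarrow> ratfun \<Rightarrow> int" where
  "ord_at (Pt z) g =
     int (Polynomial.order z (fst (quot_of_fract g))) -
     int (Polynomial.order z (snd (quot_of_fract g)))"
| "ord_at Infinity g =
     int (Polynomial.degree (snd (quot_of_fract g))) -
     int (Polynomial.degree (fst (quot_of_fract g)))"

text \<open>Divisors with coefficients in \<open>'b\<close> are finitely supported functions on the closed points.\<close>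

type_synonym 'b divisor = "closed_point \<Rightarrow>\<^sub>0 'b"

definition div_degree :: "'b::comm_monoid_add divisor \<Rightarrow> 'b" where
  "div_degree D = (\<Sum>P\<in>Poly_Mapping.keys D. Poly_Mapping.lookup D P)"

lift_definition principal_divisor :: "ratfun \<Rightarrow> int divisor"
  is "\<lambda>g P. if g = 0 then 0 else ord_at P g"
proof -
  fix g :: ratfun
  let ?n = "fst (quot_of_fract g)" and ?d = "snd (quot_of_fract g)"
  show "finite {P. (if g = 0 then 0 else ord_at P g) \<noteq> 0}"
  proof (cases "g = 0")
    case False
    have nz: "?d \<noteq> 0" by simp
    from False have nn: "?n \<noteq> 0" by simp
    have "{P. ord_at P g \<noteq> 0} \<subseteq>
        insert Infinity (Pt ` ({z. poly ?n z = 0} \<union> {z. poly ?d z = 0}))"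
    proof
      fix P assume P: "P \<in> {P. ord_at P g \<noteq> 0}"
      show "P \<in> insert Infinity (Pt ` ({z. poly ?n z = 0} \<union> {z. poly ?d z = 0}))"
      proof (cases P)
        case (Pt z)
        then have "poly ?n z = 0 \<or> poly ?d z = 0"
          using P order_0I[of ?n z] order_0I[of ?d z] by (cases "poly ?n z = 0") auto
        then show ?thesis using Pt by blast
      qed simp
    qed
    moreover have "finite (insert Infinity (Pt ` ({z. poly ?n z = 0} \<union> {z. poly ?d z = 0})))"
      using nz nn by (simp add: poly_roots_finite)
    ultimately show ?thesis using False by (simp add: finite_subset)
  qed simp
qed

definition p1_open :: "p1_point set \<Rightarrow> bool" where
  "p1_open U \<longleftrightarrow> U = {} \<or> (Generic \<in> U \<and> finite (- U))"

lemma istopology_p1_open: "istopology p1_open"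
  unfolding istopology_def
proof (intro conjI allI impI)
  fix \<V> assume *: "\<forall>V\<in>\<V>. p1_open V"
  show "p1_open (\<Union>\<V>)"
  proof (cases "\<exists>V\<in>\<V>. V \<noteq> {}")
    case True
    then obtain V where "V \<in> \<V>" "V \<noteq> {}" by blast
    moreover from this have "Generic \<in> V" "finite (- V)" using * unfolding p1_open_def by auto
    moreover have "- \<Union>\<V> \<subseteq> - V" using \<open>V \<in> \<V>\<close> by blast
    ultimately show ?thesis unfolding p1_open_def by (meson UnionI finite_subset)
  qed (auto simp: p1_open_def)
qed (auto simp: p1_open_def Compl_Int)

text \<open>$\mathcal O(D)(U)$ as a subset of the function field; the sections over the empty set are
  trivial.\<close>

definition O_sections :: "int divisor \<Rightarrow> p1_point set \<Rightarrow> ratfun set" where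
  "O_sections D U = (if U = {} then {0}
     else {g. g = 0 \<or> (\<forall>P. Closed P \<in> U \<longrightarrow> ord_at P g + Poly_Mapping.lookup D P \<ge> 0)})"

definition O_sections_rat :: "rat divisor \<Rightarrow> p1_point set \<Rightarrow> ratfun set" where
  "O_sections_rat D = O_sections (Poly_Mapping.map floor D)"

definition const_fun :: "complex \<Rightarrow> ratfun" where
  "const_fun c = Fract [:c:] 1"

definition P1 :: "(p1_point, ratfun) ringed_space" where
  "P1 = \<lparr>spc = topology p1_open,
     sec = (\<lambda>U. \<lparr>carrier = O_sections 0 U, mult = (*), one = (if U = {} then 0 else 1),
        zero = 0, add = (+), module.smult = (\<lambda>c g. const_fun c * g)\<rparr>),
     res = (\<lambda>U V g. if V = {} then 0 else g)\<rparr>"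


section \<open>Relative spectrum over the projective line\<close>

text \<open>A sheaf of algebras on $\mathbb P^1$ is given by a ringed space \<open>\<A>\<close> with the topology of
  $\mathbb P^1$ and structure maps \<open>\<eta> U\<close> from $\mathcal O(U)$ to $\mathcal A(U)$. The relative
  spectrum \<open>(C, \<pi>)\<close> comes with an identification \<open>\<alpha>\<close> of \<open>\<A>\<close> with $\pi_*\mathcal O_C$ such that for
  each affine open \<open>U\<close> the preimage of \<open>U\<close> is identified with $\mathrm{Spec}\,\mathcal A(U)$,
  inducing \<open>\<alpha> U\<close> on global sections. This determines \<open>(C, \<pi>)\<close> up to unique isomorphism.
  The affine open subsets of $\mathbb P^1$ are exactly the proper open subsets.\<close>

definition relative_spectrum ::
  "(p1_point, 'k) ringed_space \<Rightarrow> (p1_point set \<Rightarrow> ratfun \<Rightarrow> 'k) \<Rightarrow>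
   ('p, 's) ringed_space \<Rightarrow> ('p \<Rightarrow> p1_point) \<Rightarrow> (p1_point set \<Rightarrow> ratfun \<Rightarrow> 's) \<Rightarrow>
   (p1_point set \<Rightarrow> 'k \<Rightarrow> 's) \<Rightarrow> bool" where
  "relative_spectrum \<A> \<eta> C \<pi> \<Psi> \<alpha> \<longleftrightarrow>
     complex_ringed_space C \<and> lrs_morphism C P1 \<pi> \<Psi> \<and>
     (\<forall>U. p1_open U \<longrightarrow>
        \<alpha> U \<in> alg_hom (sec \<A> U) (sec C (preimage C \<pi> U)) \<and>
        (\<forall>g \<in> carrier (sec P1 U). \<alpha> U (\<eta> U g) = \<Psi> U g)) \<and>
     (\<forall>U V. p1_open U \<and> p1_open V \<and> V \<subseteq> U \<longrightarrow> (\<forall>s \<in> carrier (sec \<A> U).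
        \<alpha> V (res \<A> U V s) = res C (preimage C \<pi> U) (preimage C \<pi> V) (\<alpha> U s))) \<and>
     (\<forall>U. p1_open U \<and> U \<noteq> UNIV \<longrightarrow> (\<exists>\<phi> \<Phi>.
        rs_iso (open_subspace C (preimage C \<pi> U)) (affine_scheme (sec \<A> U)) \<phi> \<Phi> \<and>
        (\<forall>s \<in> carrier (sec \<A> U).
           \<Phi> (prime_spectrum (sec \<A> U)) (global_fraction (sec \<A> U) s) = \<alpha> U s)))"


section \<open>The dual group\<close>

quotient_type qmodz = rat / "\<lambda>x y. x - y \<in> \<int>"
  morphisms rep_qmodz qmodz_of
proof (rule equivpI)
  show "reflp (\<lambda>x y :: rat. x - y \<in> \<int>)" by (simp add: reflp_def)
  show "symp (\<lambda>x y :: rat. x - y \<in> \<int>)"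
    by (metis (no_types, lifting) Ints_minus minus_diff_eq sympI)
  show "transp (\<lambda>x y :: rat. x - y \<in> \<int>)"
  proof (rule transpI)
    fix x y z :: rat assume "x - y \<in> \<int>" "y - z \<in> \<int>"
    then have "(x - y) + (y - z) \<in> \<int>" by (rule Ints_add)
    then show "x - z \<in> \<int>" by simp
  qed
qed

instantiation qmodz :: ab_group_add
begin

lift_definition zero_qmodz :: qmodz is 0 .

lift_definition plus_qmodz :: "qmodz \<Rightarrow> qmodz \<Rightarrow> qmodz" is "(+)"
  by (metis (no_types, lifting) Ints_add add_diff_add)

lift_definition uminus_qmodz :: "qmodz \<Rightarrow> qmodz" is uminus
  by (metis (no_types, lifting) Ints_minus minus_diff_minus)

lift_definition minus_qmodz :: "qmodz \<Rightarrow> qmodz \<Rightarrow> qmodz" is "(-)"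
proof -
  fix a b c d :: rat assume "a - b \<in> \<int>" "c - d \<in> \<int>"
  then have "(a - b) - (c - d) \<in> \<int>" by (rule Ints_diff)
  then show "(a - c) - (b - d) \<in> \<int>" by (simp add: algebra_simps)
qed

instance
  by standard (transfer, simp add: algebra_simps)+

end

text \<open>$A^* = \mathrm{Hom}(A, \mathbb Q/\mathbb Z)$.\<close>

typedef (overloaded) 'a dual =
  "{\<chi> :: 'a::ab_group_add \<Rightarrow> qmodz. \<forall>x y. \<chi> (x + y) = \<chi> x + \<chi> y}"
  morphisms dual_apply Abs_dual
  by (rule exI[of _ "\<lambda>_. 0"]) simp

setup_lifting type_definition_dual

instantiation dual :: (ab_group_add) ab_group_add
begin

lift_definition zero_dual :: "'a dual" is "\<lambda>_. 0" by simp

lift_definition plus_dual :: "'a dual \<Rightarrow> 'a dual \<Rightarrow> 'a dual" is "\<lambda>\<chi> \<psi> x. \<chi> x + \<psi> x"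
  by (simp add: algebra_simps)

lift_definition uminus_dual :: "'a dual \<Rightarrow> 'a dual" is "\<lambda>\<chi> x. - \<chi> x"
  by (simp add: algebra_simps)

lift_definition minus_dual :: "'a dual \<Rightarrow> 'a dual \<Rightarrow> 'a dual" is "\<lambda>\<chi> \<psi> x. \<chi> x - \<psi> x"
  by (simp add: algebra_simps)

instance
  by standard (transfer, simp add: fun_eq_iff algebra_simps)+

end

lemma sum_qmodz_of: "(\<Sum>y\<in>S. qmodz_of (r y)) = qmodz_of (\<Sum>y\<in>S. r y)" if "finite S"
  using that by induction (simp_all add: zero_qmodz_def plus_qmodz.abs_eq)

lemma dual_value:
  fixes \<chi> :: "'a::{ab_group_add, finite} dual"
  shows "dual_apply \<chi> x \<in> (\<lambda>k. qmodz_of (of_nat k / of_nat CARD('a))) ` {..<CARD('a)}"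
proof -
  let ?n = "CARD('a)"
  have "\<exists>r. q = qmodz_of r" for q by (induction q rule: qmodz.abs_induct) blast
  then obtain r where r: "dual_apply \<chi> x = qmodz_of r" by blast
  have add: "dual_apply \<chi> (x + y) = dual_apply \<chi> x + dual_apply \<chi> y" for y
    using dual_apply[of \<chi>] by simp
  have "(\<Sum>y\<in>UNIV. dual_apply \<chi> y) = (\<Sum>y\<in>UNIV. dual_apply \<chi> (x + y))"
    by (rule sum.reindex_bij_witness[of _ "\<lambda>y. x + y" "\<lambda>y. y - x"]) auto
  also have "\<dots> = (\<Sum>y\<in>(UNIV :: 'a set). dual_apply \<chi> x) + (\<Sum>y\<in>UNIV. dual_apply \<chi> y)"
    by (simp only: add sum.distrib)
  finally have "(\<Sum>y\<in>(UNIV :: 'a set). dual_apply \<chi> x) = 0" by simp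
  then have "qmodz_of (of_nat ?n * r) = qmodz_of 0"
    by (simp add: r sum_qmodz_of zero_qmodz_def)
  then have "of_nat ?n * r \<in> \<int>" by (simp add: qmodz.abs_eq_iff)
  then obtain m where m: "of_nat ?n * r = of_int m" by (auto elim: Ints_cases)
  have n: "?n > 0" by simp
  let ?k = "nat (m mod int ?n)"
  have k: "of_nat ?k = (of_int (m mod int ?n) :: rat)" using n by simp
  have "m = m div int ?n * int ?n + m mod int ?n" by simp
  then have "(of_int m :: rat) = of_int (m div int ?n) * of_nat ?n + of_nat ?k"
    unfolding k by (metis of_int_add of_int_mult of_int_of_nat_eq)
  with m have "of_nat ?n * (r - of_nat ?k / of_nat ?n) = of_nat ?n * of_int (m div int ?n)"
    using n by (simp add: right_diff_distrib mult.commute)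
  then have "r - of_nat ?k / of_nat ?n = of_int (m div int ?n)"
    using n by (simp only: mult_cancel_left of_nat_eq_0_iff) simp
  then have "dual_apply \<chi> x = qmodz_of (of_nat ?k / of_nat ?n)"
    by (simp add: r qmodz.abs_eq_iff)
  moreover have "m mod int ?n < int ?n" by (rule pos_mod_bound) (use n in simp)
  then have "?k < ?n" using n by linarith
  ultimately show ?thesis by blast
qed

instance dual :: ("{ab_group_add, finite}") finite
proof
  let ?T = "(\<lambda>k. qmodz_of (of_nat k / of_nat CARD('a))) ` {..<CARD('a)}"
  have "range (dual_apply :: 'a dual \<Rightarrow> _) \<subseteq> (\<Pi>\<^sub>E x\<in>UNIV. ?T)"
    using dual_value by (auto simp: PiE_def)
  then have "finite (range (dual_apply :: 'a dual \<Rightarrow> _))"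
    by (rule finite_subset) (simp add: finite_PiE)
  then show "finite (UNIV :: 'a dual set)"
    by (rule finite_imageD) (simp add: inj_def dual_apply_inject)
qed


section \<open>The covering defined by a divisor with coefficients in a finite abelian group\<close>

text \<open>Since the group of divisors is free on the closed points, an element of
  $A \otimes \mathrm{Div}$ is a divisor with coefficients in \<open>A\<close>, and similarly for
  $\mathbb Q/\mathbb Z$; the tensor products with $\mathrm{Div}^0$ are the kernels of the degree.\<close>

definition char_divisor :: "'a::ab_group_add divisor \<Rightarrow> 'a dual \<Rightarrow> qmodz divisor" where
  "char_divisor E a = Poly_Mapping.map (dual_apply a) E"

definition is_lift :: "rat divisor \<Rightarrow> qmodz divisor \<Rightarrow> bool" where
  "is_lift D E \<longleftrightarrow> div_degree D = 0 \<and> Poly_Mapping.map qmodz_of D = E"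

text \<open>Associativity is the cocycle condition. Symmetry is what makes the algebra commutative, as
  is needed for its spectrum; it does not follow from the cocycle condition, because the functions
  are only determined up to constants (twisted group algebras need not be commutative).\<close>

definition admissible_functions ::
  "('a::ab_group_add dual \<Rightarrow> rat divisor) \<Rightarrow> ('a dual \<Rightarrow> 'a dual \<Rightarrow> ratfun) \<Rightarrow> bool" where
  "admissible_functions Et f \<longleftrightarrow>
     (\<forall>a b. f a b \<noteq> 0 \<and>
        Et a + Et b + Poly_Mapping.map of_int (principal_divisor (f a b)) = Et (a + b)) \<and>
     (\<forall>a b c. f a b * f (a + b) c = f a (b + c) * f b c) \<and>
     (\<forall>a b. f a b = f b a)"

text \<open>Sections of $\bigoplus_a \mathcal O(\widetilde E_a)$ are families of rational functions indexed
  by the finite group \<^typ>\<open>'a dual\<close>. By the cocycle condition $f_{0,b} = f_{0,0}$, so the unit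
  element is $f_{0,0}$ placed in degree 0.\<close>

definition cover_unit ::
  "('a::ab_group_add dual \<Rightarrow> 'a dual \<Rightarrow> ratfun) \<Rightarrow> 'a dual \<Rightarrow> ratfun" where
  "cover_unit f = (\<lambda>a. if a = 0 then f 0 0 else 0)"

definition cover_algebra ::
  "('a::{ab_group_add, finite} dual \<Rightarrow> rat divisor) \<Rightarrow> ('a dual \<Rightarrow> 'a dual \<Rightarrow> ratfun) \<Rightarrow>
   (p1_point, 'a dual \<Rightarrow> ratfun) ringed_space" where
  "cover_algebra Et f =
    \<lparr>spc = spc P1,
     sec = (\<lambda>U. \<lparr>carrier = {s. \<forall>a. s a \<in> O_sections_rat (Et a) U},
        mult = (\<lambda>s t c. \<Sum>(a, b) | a + b = c. s a * t b * inverse (f a b)),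
        one = (if U = {} then (\<lambda>_. 0) else cover_unit f),
        zero = (\<lambda>_. 0),
        add = (\<lambda>s t a. s a + t a),
        module.smult = (\<lambda>c s a. const_fun c * s a)\<rparr>),
     res = (\<lambda>U V s. if V = {} then (\<lambda>_. 0) else s)\<rparr>"

definition cover_structure_map ::
  "('a::ab_group_add dual \<Rightarrow> 'a dual \<Rightarrow> ratfun) \<Rightarrow> p1_point set \<Rightarrow> ratfun \<Rightarrow> 'a dual \<Rightarrow> ratfun" where
  "cover_structure_map f U g = (\<lambda>a. g * cover_unit f a)"

end

(* Near a closed point P the curve C is Spec R, where R is free over the coordinate ring O of a small
   open set, with a basis element w_a in each degree a. Let t be a uniformizer at P. Then w_a w_b is a
   unit times t^eps w_{a+b}, where eps is 1 or 0 according to whether the fractional parts fr(a), fr(b)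
   of the coefficients at P add up to at least 1. A maximal ideal m of R is the kernel of a character
   chi : R -> complex numbers (Nullstellensatz, via integrality over O). Let B be the degrees b with
   fr(b) = 0 if m lies over P, and all degrees otherwise. Modulo the ideal Q of sections vanishing at
   the point in all degrees of B, the algebra R becomes a twisted group algebra of B, and
   s = (sum of chi(w_b)^-1 w_b over b in B) is a multiple of the idempotent belonging to chi, so s
   is not in m and s m is contained in Q. The ideal Q is generated by a nonzerodivisor q: the local
   coordinate if B is everything, and else w_a for the least positive fr(a). So the local ring at m
   is a discrete valuation ring, and a prime ideal strictly below m localizes to a field. *)

theory Submission
  imports Defs
begin

section \<open>Noetherian rings\<close>

text \<open>The obstacle is that \<open>R\<close> need not be a domain: for the zero divisor, C
  consists of #A disjoint copies of the line. So there is no function field to argue in, a prime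
  below m need not be zero, and q has to be a nonzerodivisor rather than just nonzero. The element s
  isolates the branch of C through m without decomposing \<open>R\<close>. For a in B,
  multiplication by chi(w_a)^-1 w_a permutes the terms of s modulo Q, so w_a s = chi(w_a) s there;
  for a outside B, the product w_a s lives only in degrees outside B, where membership in Q imposes
  no condition. Together these give x s = chi(x) s modulo Q for all x. This requires chi(w_a) to be
  nonzero exactly for a in B: inside B because w_a w_{-a} is w_0 times a function not vanishing at
  the point, outside B because fr would otherwise be doubled beyond its maximum. In the ramified
  case, the least positive fr(a) is chosen because adding a then produces a carry exactly when the
  sum of degrees lands in B, so multiplication by w_a maps \<open>R\<close> onto Q.\<close>

lemma (in noetherian_ring) exists_maximal_in_family:
  assumes "\<F> \<noteq> {}" and "\<And>I. I \<in> \<F> \<Longrightarrow> ideal I R"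
  obtains M where "M \<in> \<F>" and "\<And>I. I \<in> \<F> \<Longrightarrow> M \<subseteq> I \<Longrightarrow> I = M"
proof -
  have "\<exists>M\<in>\<F>. \<forall>X\<in>\<F>. M \<subseteq> X \<longrightarrow> X = M"
  proof (rule subset_Zorn_nonempty[OF assms(1)])
    fix \<C> assume C: "\<C> \<noteq> {}" "subset.chain \<F> \<C>"
    have "subset.chain {I. ideal I R} \<C>"
      using C(2) assms(2) unfolding pred_on.chain_def by auto
    then have "\<Union>\<C> \<in> \<C>" using ideal_chain_is_trivial C(1) by blast
    then show "\<Union>\<C> \<in> \<F>" using C(2) unfolding pred_on.chain_def by auto
  qed
  then show thesis using that by blast
qed

lemma (in noetherian_ring) exists_maximalideal:
  assumes "ideal I R" and "I \<noteq> carrier R"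
  obtains M where "maximalideal M R" and "I \<subseteq> M"
proof -
  let ?F = "{J. ideal J R \<and> I \<subseteq> J \<and> J \<noteq> carrier R}"
  obtain M where M: "M \<in> ?F" and max: "\<And>J. J \<in> ?F \<Longrightarrow> M \<subseteq> J \<Longrightarrow> J = M"
    by (rule exists_maximal_in_family[of ?F]) (use assms in auto)
  have "maximalideal M R"
  proof (rule maximalidealI)
    fix J assume "ideal J R" "M \<subseteq> J" "J \<subseteq> carrier R"
    then show "J = M \<or> J = carrier R" using M max[of J] by auto
  qed (use M in auto)
  then show thesis using M that by blast
qed

section \<open>Regular local rings of dimension at most one\<close>

text \<open>The maximal ideal is a parameter, and locality is expressed by invertibility outside it,
  which is what a localization provides directly.\<close>

locale local_cring = cring R for R (structure) +
  fixes M
  assumes ideal_M: "ideal M R"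
    and one_notin: "\<one> \<notin> M"
    and units: "x \<in> carrier R \<Longrightarrow> x \<notin> M \<Longrightarrow> x \<in> Units R"
begin

lemma proper_ideal_subset:
  assumes "ideal I R" "I \<noteq> carrier R"
  shows "I \<subseteq> M"
proof
  interpret I: ideal I R by fact
  fix x assume x: "x \<in> I"
  show "x \<in> M"
  proof (rule ccontr)
    assume "x \<notin> M"
    then have "x \<in> Units R" using x units I.a_subset by blast
    then have "inv x \<otimes> x = \<one>" "inv x \<in> carrier R" by auto
    then have "\<one> \<in> I" using I.I_l_closed[OF x] by metis
    then show False using I.one_imp_carrier assms(2) by simp
  qed
qed

lemma maximalideal_iff: "maximalideal I R \<longleftrightarrow> I = M"
proof
  interpret M: ideal M R by (rule ideal_M)
  have neq: "M \<noteq> carrier R" using one_notin by blast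
  show "I = M" if "maximalideal I R"
  proof -
    interpret I: maximalideal I R by fact
    show ?thesis
      using I.I_maximal[OF ideal_M proper_ideal_subset M.a_subset] I.I_notcarr I.is_ideal neq by metis
  qed
  show "maximalideal I R" if "I = M"
    unfolding that by (rule maximalidealI) (use ideal_M neq proper_ideal_subset in auto)
qed

text \<open>Such a ring is a field: zero is the only prime ideal, the dimension is 0, and the empty
  set has to generate \<open>M\<close>.\<close>

lemma regular_if_trivial_maximal:
  assumes "noetherian_ring R" and "M = {\<zero>}"
  shows "regular_local_ring R"
proof -
  have prime: "I = {\<zero>}" if "primeideal I R" for I
  proof -
    interpret I: primeideal I R by fact
    have "I \<subseteq> {\<zero>}"
      using proper_ideal_subset[OF I.is_ideal] I.I_notcarr assms(2) by auto
    then show ?thesis using I.zero_closed by auto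
  qed
  have "primeideal {\<zero>} R"
    using maximalideal_iff[of "{\<zero>}"] assms(2) maximalideal_prime by simp
  then have "prime_chain R 0" unfolding prime_chain_def by (intro exI[of _ "\<lambda>_. {\<zero>}"]) simp
  moreover have "\<not> prime_chain R n" if "n > 0" for n
  proof
    assume "prime_chain R n"
    then obtain P where P: "\<forall>i\<le>n. primeideal (P i) R" "\<forall>i<n. P i \<subset> P (Suc i)"
      unfolding prime_chain_def by blast
    have "primeideal (P 0) R" "primeideal (P 1) R" "P 0 \<subset> P 1" using P that by auto
    then show False using prime[of "P 0"] prime[of "P 1"] by simp
  qed
  ultimately have "has_krull_dim R 0" unfolding has_krull_dim_def by blast
  moreover have "M = Idl {}"
    using genideal_zero genideal_minimal[OF zeroideal, of "{}"] additive_subgroup.zero_closed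
      ideal.axioms(1)[OF genideal_ideal[of "{}"]] assms(2) by fastforce
  ultimately show ?thesis unfolding regular_local_ring_def
    using cring_axioms assms(1) maximalideal_iff
    by (intro conjI exI[of _ M] exI[of _ 0] exI[of _ "{}"]) auto
qed

text \<open>If a nonzero element were not a unit times a power of the generator \<open>q\<close>, choose such an
  element \<open>x\<close> with maximal principal ideal; writing \<open>x = q y\<close>, maximality gives \<open>y = r x\<close>, so
  \<open>(1 - r q) y = 0\<close>.\<close>

lemma unit_times_power:
  assumes "noetherian_ring R" and q: "q \<in> carrier R" "M = {q \<otimes> y |y. y \<in> carrier R}"
    and x: "x \<in> carrier R" "x \<noteq> \<zero>"
  shows "\<exists>v\<in>Units R. \<exists>i. x = v \<otimes> q [^] (i::nat)"
proof (rule ccontr)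
  interpret noetherian_ring R by fact
  interpret M: ideal M R by (rule ideal_M)
  let ?good = "\<lambda>x. \<exists>v\<in>Units R. \<exists>i. x = v \<otimes> q [^] (i::nat)"
  let ?F = "{PIdl x |x. x \<in> carrier R \<and> x \<noteq> \<zero> \<and> \<not> ?good x}"
  assume "\<not> ?good x"
  then have "?F \<noteq> {}" using x by blast
  then obtain I where I: "I \<in> ?F" and max: "\<And>J. J \<in> ?F \<Longrightarrow> I \<subseteq> J \<Longrightarrow> J = I"
    by (rule exists_maximal_in_family[of ?F]) (auto simp: cgenideal_ideal)
  obtain x where x: "I = PIdl x" "x \<in> carrier R" "x \<noteq> \<zero>" "\<not> ?good x" using I by blast
  have "x \<in> M"
  proof (rule ccontr)
    assume "x \<notin> M"
    then have "x \<in> Units R" using units x by blast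
    moreover have "x = x \<otimes> q [^] (0::nat)" using x by simp
    ultimately show False using x(4) by blast
  qed
  then obtain y where y: "y \<in> carrier R" "x = q \<otimes> y" using q by blast
  have y0: "y \<noteq> \<zero>" using y(2) x(3) q(1) by auto
  have "\<not> ?good y"
  proof
    assume "?good y"
    then obtain v i where v: "v \<in> Units R" "y = v \<otimes> q [^] (i::nat)" by blast
    then have "v \<in> carrier R" by blast
    then have "x = v \<otimes> q [^] Suc i" using y v(2) q(1) by (simp add: m_ac)
    then show False using x(4) v by blast
  qed
  then have "PIdl y \<in> ?F" using y y0 by blast
  moreover have "I \<subseteq> PIdl y"
    unfolding x(1) using y q(1) by (intro cgenideal_minimal cgenideal_ideal) (auto simp: cgenideal_def)
  ultimately have "PIdl y = I" by (rule max)
  then have "y \<in> PIdl x" using cgenideal_self[OF y(1)] x(1) by simp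
  then obtain r where r: "r \<in> carrier R" "y = r \<otimes> x" unfolding cgenideal_def by blast
  have "(\<one> \<ominus> q \<otimes> r) \<otimes> y = y \<ominus> r \<otimes> (q \<otimes> y)"
    using q(1) r(1) y(1) m_lcomm[of r q y] m_assoc[of q r y] by (simp add: minus_eq l_distr l_minus)
  also have "\<dots> = \<zero>" using r(2) y q(1) by (metis r_neg minus_eq)
  finally have eq: "(\<one> \<ominus> q \<otimes> r) \<otimes> y = \<zero>" .
  have "\<one> \<ominus> q \<otimes> r \<notin> M"
  proof
    assume "\<one> \<ominus> q \<otimes> r \<in> M"
    moreover have "q \<otimes> r \<in> M" using q(2) r(1) by blast
    ultimately have "(\<one> \<ominus> q \<otimes> r) \<oplus> q \<otimes> r \<in> M" by (rule M.a_closed)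
    moreover have "(\<one> \<ominus> q \<otimes> r) \<oplus> q \<otimes> r = \<one>" using q(1) r(1) by (simp add: minus_eq a_assoc l_neg)
    ultimately show False using one_notin by simp
  qed
  then have u: "\<one> \<ominus> q \<otimes> r \<in> Units R" using units q(1) r(1) by simp
  have "y = (inv (\<one> \<ominus> q \<otimes> r) \<otimes> (\<one> \<ominus> q \<otimes> r)) \<otimes> y" using u y by simp
  also have "\<dots> = inv (\<one> \<ominus> q \<otimes> r) \<otimes> ((\<one> \<ominus> q \<otimes> r) \<otimes> y)"
    using u y by (intro m_assoc) auto
  also have "\<dots> = \<zero>" using u by (simp only: eq) simp
  finally show False using y0 by simp
qed

text \<open>By \<open>unit_times_power\<close> a nonzero ideal contains a power of \<open>q\<close>,
  so a nonzero prime contains \<open>q\<close> itself. Products of units times powers keep that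
  form, and \<open>nonnil\<close> then makes the zero ideal prime. It excludes rings like
  C[q]/(q^2), whose maximal ideal is principal and nonzero although the dimension is 0.\<close>

lemma regular_if_principal_maximal:
  assumes noeth: "noetherian_ring R" and q: "q \<in> carrier R" "M = {q \<otimes> y |y. y \<in> carrier R}"
    and nonnil: "\<And>i::nat. q [^] i \<noteq> \<zero>"
  shows "regular_local_ring R"
proof -
  note decomp = unit_times_power[OF noeth q]
  interpret M: ideal M R by (rule ideal_M)
  have neq: "M \<noteq> carrier R" using one_notin by blast
  have M_eq: "M = PIdl q" unfolding q(2) cgenideal_def using q(1) m_comm by auto
  have qM: "q \<in> M" unfolding M_eq using q(1) cgenideal_self by blast
  have q0: "q \<noteq> \<zero>" using nonnil[of 1] q(1) by auto
  have power_mem: "\<exists>i. x = \<zero> \<or> q [^] (i::nat) \<in> P"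
    if P: "ideal P R" and x: "x \<in> P" for P x
  proof (cases "x = \<zero>")
    case False
    interpret P: ideal P R by fact
    obtain v i where v: "v \<in> Units R" "x = v \<otimes> q [^] (i::nat)"
      using decomp[OF _ False] x P.a_subset by blast
    have "inv v \<otimes> x = inv v \<otimes> v \<otimes> q [^] i"
      unfolding v(2) using v(1) q(1) by (intro m_assoc[symmetric]) auto
    then have "inv v \<otimes> x = q [^] i" using v(1) q(1) by simp
    moreover have "inv v \<otimes> x \<in> P" using x v(1) P.I_l_closed by simp
    ultimately show ?thesis by auto
  qed auto
  have prime: "I = {\<zero>} \<or> I = M" if "primeideal I R" for I
  proof -
    interpret I: primeideal I R by fact
    have "\<one> \<notin> I" using I.one_imp_carrier I.I_notcarr by blast
    show ?thesis
    proof (cases "q \<in> I")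
      case True
      then have "M \<subseteq> I" unfolding M_eq by (rule cgenideal_minimal[OF I.is_ideal])
      then show ?thesis using proper_ideal_subset[OF I.is_ideal] I.I_notcarr by auto
    next
      case False
      have "q [^] i \<notin> I" for i :: nat
      proof (induct i)
        case 0
        then show ?case using \<open>\<one> \<notin> I\<close> by simp
      next
        case (Suc i)
        then show ?case using I.I_prime[of "q [^] i" q] False q(1) by auto
      qed
      then have "I \<subseteq> {\<zero>}" using power_mem[OF I.is_ideal] by blast
      then show ?thesis using I.zero_closed by auto
    qed
  qed
  have zero: "primeideal {\<zero>} R"
  proof (rule primeidealI)
    fix a b assume ab: "a \<in> carrier R" "b \<in> carrier R" "a \<otimes> b \<in> {\<zero>}"
    show "a \<in> {\<zero>} \<or> b \<in> {\<zero>}"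
    proof (rule ccontr)
      assume "\<not> ?thesis"
      then have nz: "a \<noteq> \<zero>" "b \<noteq> \<zero>" by auto
      obtain v i where v: "v \<in> Units R" "a = v \<otimes> q [^] (i::nat)"
        using decomp[OF ab(1) nz(1)] by blast
      obtain w j where w: "w \<in> Units R" "b = w \<otimes> q [^] (j::nat)"
        using decomp[OF ab(2) nz(2)] by blast
      have cl: "v \<in> carrier R" "w \<in> carrier R" "inv v \<in> carrier R" "inv w \<in> carrier R"
        using v(1) w(1) by auto
      have "q [^] i = inv v \<otimes> a" "q [^] j = inv w \<otimes> b"
        unfolding v(2) w(2) using cl q(1) v(1) w(1) by (simp_all flip: m_assoc)
      then have "q [^] (i + j) = (inv v \<otimes> a) \<otimes> (inv w \<otimes> b)"
        using q(1) by (simp flip: nat_pow_mult)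
      also have "\<dots> = (inv v \<otimes> inv w) \<otimes> (a \<otimes> b)"
        using cl ab(1,2) by (simp add: m_ac)
      also have "\<dots> = \<zero>" using ab cl by simp
      finally show False using nonnil by blast
    qed
  next
    have "\<one> \<noteq> \<zero>" using M.zero_closed one_notin by auto
    then show "carrier R \<noteq> {\<zero>}" by blast
  qed (rule zeroideal, rule cring_axioms)
  have "prime_chain R 1"
    unfolding prime_chain_def
  proof (intro exI conjI allI impI)
    let ?P = "\<lambda>i::nat. if i = 0 then {\<zero>} else M"
    show "primeideal (?P i) R" for i
      using zero maximalideal_iff maximalideal_prime by auto
    show "?P i \<subset> ?P (Suc i)" if "i < 1" for i
      using that qM q0 M.zero_closed by auto
  qed
  moreover have "\<not> prime_chain R n" if "n > 1" for n
  proof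
    assume "prime_chain R n"
    then obtain P where P: "\<forall>i\<le>n. primeideal (P i) R" "\<forall>i<n. P i \<subset> P (Suc i)"
      unfolding prime_chain_def by blast
    have "P 0 \<subset> P 1" "P 1 \<subset> P 2" "primeideal (P 0) R" "primeideal (P 1) R" "primeideal (P 2) R"
      using P that by (auto simp: numeral_2_eq_2)
    then show False using prime[of "P 0"] prime[of "P 1"] prime[of "P 2"] M.zero_closed by blast
  qed
  ultimately have "has_krull_dim R 1" unfolding has_krull_dim_def by blast
  moreover have "M = Idl {q}" unfolding M_eq using q(1) by (simp add: cgenideal_eq_genideal)
  ultimately show ?thesis unfolding regular_local_ring_def
    using cring_axioms noeth maximalideal_iff q(1)
    by (intro conjI exI[of _ M] exI[of _ 1] exI[of _ "{q}"]) auto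
qed

end

section \<open>Localization at a prime ideal\<close>

locale prime_localization = primeideal p R for p :: "'k set" and R :: "('c, 'k) module" (structure)
begin

abbreviation D where "D \<equiv> carrier R - p"
abbreviation fr where "fr \<equiv> fraction_at R p"
abbreviation Rp where "Rp \<equiv> localization R p"

lemma one_in_D: "\<one> \<in> D"
  using one_imp_carrier I_notcarr by auto

lemma D_mult: "h \<in> D \<Longrightarrow> k \<in> D \<Longrightarrow> h \<otimes> k \<in> D"
  using I_prime by auto

text \<open>The middle denominator \<open>k\<close> occurs on both sides and need not be cancellable
  in the presence of zero divisors, so it joins \<open>u\<close> and \<open>v\<close> in the
  auxiliary factor.\<close>

lemma fraction_eq_trans:
  assumes "a \<in> carrier R" "b \<in> carrier R" "c \<in> carrier R" "h \<in> D" "k \<in> D" "l \<in> D" "u \<in> D" "v \<in> D"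
    and "u \<otimes> (a \<otimes> k) = u \<otimes> (b \<otimes> h)" "v \<otimes> (b \<otimes> l) = v \<otimes> (c \<otimes> k)"
  shows "\<exists>u\<in>D. u \<otimes> (a \<otimes> l) = u \<otimes> (c \<otimes> h)"
proof
  have cl: "h \<in> carrier R" "k \<in> carrier R" "l \<in> carrier R" "u \<in> carrier R" "v \<in> carrier R"
    using assms by auto
  note cl = cl assms(1-3)
  show "u \<otimes> v \<otimes> k \<in> D" using assms D_mult by auto
  have "u \<otimes> v \<otimes> k \<otimes> (a \<otimes> l) = (v \<otimes> l) \<otimes> (u \<otimes> (a \<otimes> k))"
    using cl by (simp add: m_ac)
  also have "\<dots> = (v \<otimes> l) \<otimes> (u \<otimes> (b \<otimes> h))" using assms(9) by simp
  also have "\<dots> = (u \<otimes> h) \<otimes> (v \<otimes> (b \<otimes> l))"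
    using cl by (simp add: m_ac)
  also have "\<dots> = (u \<otimes> h) \<otimes> (v \<otimes> (c \<otimes> k))" using assms(10) by simp
  also have "\<dots> = u \<otimes> v \<otimes> k \<otimes> (c \<otimes> h)"
    using cl by (simp add: m_ac)
  finally show "u \<otimes> v \<otimes> k \<otimes> (a \<otimes> l) = u \<otimes> v \<otimes> k \<otimes> (c \<otimes> h)" .
qed

lemma mem_fr: "(b, k) \<in> fr a h \<longleftrightarrow>
    b \<in> carrier R \<and> k \<in> D \<and> (\<exists>u\<in>D. u \<otimes> (a \<otimes> k) = u \<otimes> (b \<otimes> h))"
  unfolding fraction_at_def by simp

lemma fr_eq_iff:
  assumes "a \<in> carrier R" "b \<in> carrier R" "h \<in> D" "k \<in> D"
  shows "fr a h = fr b k \<longleftrightarrow> (\<exists>u\<in>D. u \<otimes> (a \<otimes> k) = u \<otimes> (b \<otimes> h))"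
proof
  assume eq: "fr a h = fr b k"
  have "(b, k) \<in> fr b k" unfolding mem_fr using assms one_in_D by auto
  then show "\<exists>u\<in>D. u \<otimes> (a \<otimes> k) = u \<otimes> (b \<otimes> h)" unfolding eq[symmetric] mem_fr by blast
next
  have sub: "fr b k \<subseteq> fr a h"
    if ab: "a \<in> carrier R" "b \<in> carrier R" "h \<in> D" "k \<in> D" "\<exists>u\<in>D. u \<otimes> (a \<otimes> k) = u \<otimes> (b \<otimes> h)"
    for a b h k
  proof
    fix x assume x: "x \<in> fr b k"
    obtain c l where c: "x = (c, l)" by (cases x)
    then show "x \<in> fr a h" using x ab fraction_eq_trans[of a b c h k l] by (auto simp: mem_fr)
  qed
  assume *: "\<exists>u\<in>D. u \<otimes> (a \<otimes> k) = u \<otimes> (b \<otimes> h)"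
  then have "\<exists>u\<in>D. u \<otimes> (b \<otimes> h) = u \<otimes> (a \<otimes> k)" by metis
  then show "fr a h = fr b k" using sub[of a b h k] sub[of b a k h] * assms by blast
qed

lemma fr_eqI:
  assumes "a \<in> carrier R" "b \<in> carrier R" "h \<in> D" "k \<in> D" "a \<otimes> k = b \<otimes> h"
  shows "fr a h = fr b k"
  unfolding fr_eq_iff[OF assms(1-4)] using one_in_D assms(5) by metis

lemma mem_frD:
  assumes "(b, k) \<in> fr a h" "a \<in> carrier R" "h \<in> D"
  shows "b \<in> carrier R" "k \<in> D" "fr b k = fr a h"
  using assms fr_eq_iff[of a b h k] unfolding mem_fr by auto

lemma fr_self: "a \<in> carrier R \<Longrightarrow> h \<in> D \<Longrightarrow> (a, h) \<in> fr a h"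
  unfolding mem_fr using one_in_D by auto

lemma mult_fr_cong:
  assumes "fr a h = fr a' h'" "fr b k = fr b' k'"
    and cl: "a \<in> carrier R" "a' \<in> carrier R" "h \<in> D" "h' \<in> D" "b \<in> carrier R" "b' \<in> carrier R"
      "k \<in> D" "k' \<in> D"
  shows "fr (a \<otimes> b) (h \<otimes> k) = fr (a' \<otimes> b') (h' \<otimes> k')"
proof -
  obtain u where u: "u \<in> D" "u \<otimes> (a \<otimes> h') = u \<otimes> (a' \<otimes> h)"
    using assms fr_eq_iff[of a a' h h'] by blast
  obtain v where v: "v \<in> D" "v \<otimes> (b \<otimes> k') = v \<otimes> (b' \<otimes> k)"
    using assms fr_eq_iff[of b b' k k'] by blast
  have cl': "h \<in> carrier R" "h' \<in> carrier R" "k \<in> carrier R" "k' \<in> carrier R"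
    "u \<in> carrier R" "v \<in> carrier R" using cl u v by auto
  have "u \<otimes> v \<otimes> (a \<otimes> b \<otimes> (h' \<otimes> k')) = (u \<otimes> (a \<otimes> h')) \<otimes> (v \<otimes> (b \<otimes> k'))"
    using cl cl' by (simp add: m_ac)
  also have "\<dots> = (u \<otimes> (a' \<otimes> h)) \<otimes> (v \<otimes> (b' \<otimes> k))" unfolding u(2) v(2) by (rule refl)
  also have "\<dots> = u \<otimes> v \<otimes> (a' \<otimes> b' \<otimes> (h \<otimes> k))"
    using cl cl' by (simp add: m_ac)
  finally show ?thesis
    using D_mult[OF u(1) v(1)] D_mult[OF cl(3,7)] D_mult[OF cl(4,8)] cl
    by (subst fr_eq_iff) auto
qed

lemma add_fr_cong:
  assumes "fr a h = fr a' h'" "fr b k = fr b' k'"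
    and cl: "a \<in> carrier R" "a' \<in> carrier R" "h \<in> D" "h' \<in> D" "b \<in> carrier R" "b' \<in> carrier R"
      "k \<in> D" "k' \<in> D"
  shows "fr (a \<otimes> k \<oplus> b \<otimes> h) (h \<otimes> k) = fr (a' \<otimes> k' \<oplus> b' \<otimes> h') (h' \<otimes> k')"
proof -
  obtain u where u: "u \<in> D" "u \<otimes> (a \<otimes> h') = u \<otimes> (a' \<otimes> h)"
    using assms fr_eq_iff[of a a' h h'] by blast
  obtain v where v: "v \<in> D" "v \<otimes> (b \<otimes> k') = v \<otimes> (b' \<otimes> k)"
    using assms fr_eq_iff[of b b' k k'] by blast
  have cl': "h \<in> carrier R" "h' \<in> carrier R" "k \<in> carrier R" "k' \<in> carrier R"
    "u \<in> carrier R" "v \<in> carrier R" using cl u v by auto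
  have "u \<otimes> v \<otimes> ((a \<otimes> k \<oplus> b \<otimes> h) \<otimes> (h' \<otimes> k')) =
      (v \<otimes> k \<otimes> k') \<otimes> (u \<otimes> (a \<otimes> h')) \<oplus> (u \<otimes> h \<otimes> h') \<otimes> (v \<otimes> (b \<otimes> k'))"
    using cl cl' by (simp add: l_distr r_distr m_ac)
  also have "\<dots> = (v \<otimes> k \<otimes> k') \<otimes> (u \<otimes> (a' \<otimes> h)) \<oplus> (u \<otimes> h \<otimes> h') \<otimes> (v \<otimes> (b' \<otimes> k))"
    unfolding u(2) v(2) by (rule refl)
  also have "\<dots> = u \<otimes> v \<otimes> ((a' \<otimes> k' \<oplus> b' \<otimes> h') \<otimes> (h \<otimes> k))"
    using cl cl' by (simp add: l_distr r_distr m_ac)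
  finally show ?thesis
    using D_mult[OF u(1) v(1)] D_mult[OF cl(3,7)] D_mult[OF cl(4,8)] cl cl'
    by (subst fr_eq_iff) auto
qed

text \<open>The operations of \<open>localization\<close> are unions over all representatives.
  Classes are nonempty, so independence of representatives collapses such a union to any of its
  members.\<close>

lemma Union_fr_const:
  assumes "a \<in> carrier R" "h \<in> D" "b \<in> carrier R" "k \<in> D"
    and "\<And>a' h' b' k'. \<lbrakk>a' \<in> carrier R; h' \<in> D; b' \<in> carrier R; k' \<in> D;
      fr a' h' = fr a h; fr b' k' = fr b k\<rbrakk> \<Longrightarrow> F a' h' b' k' = S"
  shows "(\<Union>(a', h')\<in>fr a h. \<Union>(b', k')\<in>fr b k. F a' h' b' k') = S"
proof -
  have "F a' h' b' k' = S" if "(a', h') \<in> fr a h" "(b', k') \<in> fr b k" for a' h' b' k'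
    using assms mem_frD[OF that(1)] mem_frD[OF that(2)] by auto
  then show ?thesis using fr_self[OF assms(1,2)] fr_self[OF assms(3,4)] by blast
qed

lemma mult_fr:
  assumes "a \<in> carrier R" "h \<in> D" "b \<in> carrier R" "k \<in> D"
  shows "fr a h \<otimes>\<^bsub>Rp\<^esub> fr b k = fr (a \<otimes> b) (h \<otimes> k)"
  unfolding localization_def
  by (simp, rule Union_fr_const) (simp_all only: assms, rule mult_fr_cong, simp_all only: assms)

lemma add_fr:
  assumes "a \<in> carrier R" "h \<in> D" "b \<in> carrier R" "k \<in> D"
  shows "fr a h \<oplus>\<^bsub>Rp\<^esub> fr b k = fr (a \<otimes> k \<oplus> b \<otimes> h) (h \<otimes> k)"
  unfolding localization_def
  by (simp, rule Union_fr_const) (simp_all only: assms, rule add_fr_cong, simp_all only: assms)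

lemma one_Rp: "\<one>\<^bsub>Rp\<^esub> = fr \<one> \<one>" and zero_Rp: "\<zero>\<^bsub>Rp\<^esub> = fr \<zero> \<one>"
  unfolding localization_def by simp_all

lemma carrier_Rp: "carrier Rp = {fr a h |a h. a \<in> carrier R \<and> h \<in> D}"
  unfolding localization_def by simp

lemma fr_closed: "a \<in> carrier R \<Longrightarrow> h \<in> D \<Longrightarrow> fr a h \<in> carrier Rp"
  unfolding carrier_Rp by blast

lemma Rp_cases:
  assumes "X \<in> carrier Rp"
  obtains a h where "a \<in> carrier R" "h \<in> D" "h \<in> carrier R" "X = fr a h"
  using assms unfolding carrier_Rp by blast

lemma cring_Rp: "cring Rp"
proof (rule cringI)
  show "abelian_group Rp"
  proof (rule abelian_groupI)
    fix X Y assume "X \<in> carrier Rp" "Y \<in> carrier Rp"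
    then obtain a h b k where X: "a \<in> carrier R" "h \<in> D" "h \<in> carrier R" "X = fr a h"
      and Y: "b \<in> carrier R" "k \<in> D" "k \<in> carrier R" "Y = fr b k"
      by (metis Rp_cases)
    show "X \<oplus>\<^bsub>Rp\<^esub> Y \<in> carrier Rp"
      unfolding X Y add_fr[OF X(1,2) Y(1,2)] using X Y D_mult by (intro fr_closed) auto
    show "X \<oplus>\<^bsub>Rp\<^esub> Y = Y \<oplus>\<^bsub>Rp\<^esub> X"
      unfolding X Y add_fr[OF X(1,2) Y(1,2)] add_fr[OF Y(1,2) X(1,2)]
      using X Y by (simp add: m_comm a_comm)
    fix Z assume "Z \<in> carrier Rp"
    then obtain c l where Z: "c \<in> carrier R" "l \<in> D" "l \<in> carrier R" "Z = fr c l"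
      by (metis Rp_cases)
    show "X \<oplus>\<^bsub>Rp\<^esub> Y \<oplus>\<^bsub>Rp\<^esub> Z = X \<oplus>\<^bsub>Rp\<^esub> (Y \<oplus>\<^bsub>Rp\<^esub> Z)"
      unfolding X(4) Y(4) Z(4) add_fr[OF X(1,2) Y(1,2)] add_fr[OF Y(1,2) Z(1,2)]
      using X(1-3) Y(1-3) Z(1-3) D_mult[OF X(2) Y(2)] D_mult[OF Y(2) Z(2)]
      by (simp add: add_fr l_distr r_distr m_ac a_ac)
  next
    show "\<zero>\<^bsub>Rp\<^esub> \<in> carrier Rp" unfolding zero_Rp using one_in_D by (intro fr_closed) auto
    fix X assume "X \<in> carrier Rp"
    then obtain a h where X: "a \<in> carrier R" "h \<in> D" "h \<in> carrier R" "X = fr a h"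
      by (metis Rp_cases)
    show "\<zero>\<^bsub>Rp\<^esub> \<oplus>\<^bsub>Rp\<^esub> X = X"
      unfolding X(4) zero_Rp using X(1-3) one_in_D by (simp add: add_fr)
    have "fr (\<ominus> a) h \<oplus>\<^bsub>Rp\<^esub> X = fr (\<ominus> a \<otimes> h \<oplus> a \<otimes> h) (h \<otimes> h)"
      unfolding X(4) using X(1-3) by (simp add: add_fr)
    also have "\<dots> = \<zero>\<^bsub>Rp\<^esub>"
      unfolding zero_Rp using X(1-3) one_in_D D_mult[OF X(2) X(2)]
      by (intro fr_eqI) (auto simp: l_minus l_neg)
    finally show "\<exists>Y\<in>carrier Rp. Y \<oplus>\<^bsub>Rp\<^esub> X = \<zero>\<^bsub>Rp\<^esub>"
      using fr_closed[of "\<ominus> a" h] X by blast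
  qed
  show "comm_monoid Rp"
  proof (rule comm_monoidI)
    fix X Y assume "X \<in> carrier Rp" "Y \<in> carrier Rp"
    then obtain a h b k where X: "a \<in> carrier R" "h \<in> D" "h \<in> carrier R" "X = fr a h"
      and Y: "b \<in> carrier R" "k \<in> D" "k \<in> carrier R" "Y = fr b k"
      by (metis Rp_cases)
    show "X \<otimes>\<^bsub>Rp\<^esub> Y \<in> carrier Rp"
      unfolding X Y mult_fr[OF X(1,2) Y(1,2)] using X Y D_mult by (intro fr_closed) auto
    show "X \<otimes>\<^bsub>Rp\<^esub> Y = Y \<otimes>\<^bsub>Rp\<^esub> X"
      unfolding X Y mult_fr[OF X(1,2) Y(1,2)] mult_fr[OF Y(1,2) X(1,2)]
      using X Y by (simp add: m_comm)
    fix Z assume "Z \<in> carrier Rp"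
    then obtain c l where Z: "c \<in> carrier R" "l \<in> D" "l \<in> carrier R" "Z = fr c l"
      by (metis Rp_cases)
    show "X \<otimes>\<^bsub>Rp\<^esub> Y \<otimes>\<^bsub>Rp\<^esub> Z = X \<otimes>\<^bsub>Rp\<^esub> (Y \<otimes>\<^bsub>Rp\<^esub> Z)"
      unfolding X(4) Y(4) Z(4) mult_fr[OF X(1,2) Y(1,2)] mult_fr[OF Y(1,2) Z(1,2)]
      using X(1-3) Y(1-3) Z(1-3) D_mult[OF X(2) Y(2)] D_mult[OF Y(2) Z(2)]
      by (simp add: mult_fr m_ac)
  next
    show "\<one>\<^bsub>Rp\<^esub> \<in> carrier Rp" unfolding one_Rp using one_in_D by (intro fr_closed) auto
    fix X assume "X \<in> carrier Rp"
    then obtain a h where X: "a \<in> carrier R" "h \<in> D" "h \<in> carrier R" "X = fr a h"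
      by (metis Rp_cases)
    show "\<one>\<^bsub>Rp\<^esub> \<otimes>\<^bsub>Rp\<^esub> X = X"
      unfolding X(4) one_Rp using X(1-3) one_in_D by (simp add: mult_fr)
  qed
  fix X Y Z assume "X \<in> carrier Rp" "Y \<in> carrier Rp" "Z \<in> carrier Rp"
  then obtain a h b k c l where X: "a \<in> carrier R" "h \<in> D" "h \<in> carrier R" "X = fr a h"
    and Y: "b \<in> carrier R" "k \<in> D" "k \<in> carrier R" "Y = fr b k"
    and Z: "c \<in> carrier R" "l \<in> D" "l \<in> carrier R" "Z = fr c l"
    by (metis Rp_cases)
  note D = D_mult[OF X(2) Y(2)] D_mult[OF X(2) Z(2)] D_mult[OF Y(2) Z(2)]
  have "(X \<oplus>\<^bsub>Rp\<^esub> Y) \<otimes>\<^bsub>Rp\<^esub> Z = fr ((a \<otimes> k \<oplus> b \<otimes> h) \<otimes> c) (h \<otimes> k \<otimes> l)"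
    unfolding X(4) Y(4) Z(4) add_fr[OF X(1,2) Y(1,2)]
    using X(1-3) Y(1-3) Z(1-3) D by (intro mult_fr) auto
  also have "\<dots> = fr (a \<otimes> c \<otimes> (k \<otimes> l) \<oplus> b \<otimes> c \<otimes> (h \<otimes> l)) (h \<otimes> l \<otimes> (k \<otimes> l))"
    using X(1-3) Y(1-3) Z(1-3) D_mult[OF D(1) Z(2)] D_mult[OF D(2) D(3)]
    by (intro fr_eqI) (auto simp: l_distr r_distr m_ac)
  also have "\<dots> = X \<otimes>\<^bsub>Rp\<^esub> Z \<oplus>\<^bsub>Rp\<^esub> Y \<otimes>\<^bsub>Rp\<^esub> Z"
    unfolding X(4) Y(4) Z(4) mult_fr[OF X(1,2) Z(1,2)] mult_fr[OF Y(1,2) Z(1,2)]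
    using X(1-3) Y(1-3) Z(1-3) D by (intro add_fr[symmetric]) auto
  finally show "(X \<oplus>\<^bsub>Rp\<^esub> Y) \<otimes>\<^bsub>Rp\<^esub> Z = X \<otimes>\<^bsub>Rp\<^esub> Z \<oplus>\<^bsub>Rp\<^esub> Y \<otimes>\<^bsub>Rp\<^esub> Z" .
qed

sublocale Rp: cring Rp by (rule cring_Rp)

lemma hom_Rp: "ring_hom_ring R Rp (\<lambda>a. fr a \<one>)"
  by (rule ring_hom_ringI2)
    (use one_in_D in \<open>auto intro!: ring_hom_memI fr_closed simp: mult_fr add_fr one_Rp ring_axioms Rp.ring_axioms\<close>)

lemma fr_split:
  assumes "a \<in> carrier R" "h \<in> D"
  shows "fr a h = fr a \<one> \<otimes>\<^bsub>Rp\<^esub> fr \<one> h" and "fr a \<one> = fr a h \<otimes>\<^bsub>Rp\<^esub> fr h \<one>"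
proof -
  have h: "h \<in> carrier R" "\<one> \<in> D" using assms one_in_D by auto
  show "fr a h = fr a \<one> \<otimes>\<^bsub>Rp\<^esub> fr \<one> h" using assms h by (simp add: mult_fr)
  show "fr a \<one> = fr a h \<otimes>\<^bsub>Rp\<^esub> fr h \<one>"
    using assms h by (simp add: mult_fr) (intro fr_eqI, auto)
qed

text \<open>An ideal of \<open>Rp\<close> is generated by the image of its contraction to
  \<open>R\<close>, because \<open>fr a h\<close> and \<open>fr a \<one>\<close> differ by a unit
  (\<open>fr_split\<close>). Generators of the contraction therefore suffice.\<close>

lemma noetherian_Rp:
  assumes "noetherian_ring R"
  shows "noetherian_ring Rp"
proof (rule Rp.noetherian_ringI)
  interpret noetherian_ring R by fact
  interpret hom: ring_hom_ring R Rp "\<lambda>a. fr a \<one>" by (rule hom_Rp)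
  have vimage: "ideal {a \<in> carrier R. fr a \<one> \<in> I} R" if I: "ideal I Rp" for I
  proof -
    interpret I: ideal I Rp by fact
    show ?thesis
    proof (rule idealI)
      show "subgroup {a \<in> carrier R. fr a \<one> \<in> I} (add_monoid R)"
        using I.zero_closed by (intro add.subgroupI) (auto simp: a_inv_def[symmetric])
    qed (auto simp: ring_axioms I.I_l_closed I.I_r_closed)
  qed
  fix I assume I: "ideal I Rp"
  interpret I: ideal I Rp by fact
  obtain A where A: "A \<subseteq> carrier R" "finite A" "{a \<in> carrier R. fr a \<one> \<in> I} = Idl A"
    using finetely_gen[OF vimage[OF I]] by blast
  let ?A = "(\<lambda>a. fr a \<one>) ` A"
  have A': "?A \<subseteq> carrier Rp" using A(1) by auto
  have "I = Idl\<^bsub>Rp\<^esub> ?A"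
  proof
    have "A \<subseteq> {a \<in> carrier R. fr a \<one> \<in> I}" unfolding A(3) by (rule genideal_self[OF A(1)])
    then show "Idl\<^bsub>Rp\<^esub> ?A \<subseteq> I" by (intro Rp.genideal_minimal[OF I]) auto
    interpret J: ideal "Idl\<^bsub>Rp\<^esub> ?A" Rp by (rule Rp.genideal_ideal[OF A'])
    have "Idl A \<subseteq> {a \<in> carrier R. fr a \<one> \<in> Idl\<^bsub>Rp\<^esub> ?A}"
      using Rp.genideal_self[OF A'] A(1) by (intro genideal_minimal vimage J.is_ideal) auto
    then have sub: "fr a \<one> \<in> Idl\<^bsub>Rp\<^esub> ?A" if "a \<in> carrier R" "fr a \<one> \<in> I" for a
      using that A(3) by blast
    show "I \<subseteq> Idl\<^bsub>Rp\<^esub> ?A"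
    proof
      fix X assume X: "X \<in> I"
      then obtain a h where a: "a \<in> carrier R" "h \<in> D" "h \<in> carrier R" "X = fr a h"
        using I.a_subset Rp_cases by blast
      have "fr a \<one> \<in> I"
        using fr_split(2)[OF a(1,2)] I.I_r_closed[OF X] a one_in_D fr_closed by metis
      then show "X \<in> Idl\<^bsub>Rp\<^esub> ?A"
        using fr_split(1)[OF a(1,2)] J.I_r_closed[OF sub[OF a(1)]] a fr_closed by simp
    qed
  qed
  then show "\<exists>A\<subseteq>carrier Rp. finite A \<and> I = Idl\<^bsub>Rp\<^esub> A" using A A' by blast
qed

section \<open>The maximal ideal of the localization, and criteria for regularity\<close>

definition maximal_Rp where "maximal_Rp = {fr a h |a h. a \<in> p \<and> h \<in> D}"

lemma fr_mem_maximal_iff: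
  assumes "a \<in> carrier R" "h \<in> D"
  shows "fr a h \<in> maximal_Rp \<longleftrightarrow> a \<in> p"
proof
  assume "fr a h \<in> maximal_Rp"
  then obtain b k where b: "b \<in> p" "k \<in> D" "fr a h = fr b k" unfolding maximal_Rp_def by blast
  then obtain u where u: "u \<in> D" "u \<otimes> (a \<otimes> k) = u \<otimes> (b \<otimes> h)"
    using fr_eq_iff[of a b h k] assms Icarr by auto
  have "u \<otimes> (b \<otimes> h) \<in> p" using u b assms I_l_closed I_r_closed by simp
  then show "a \<in> p" using u b assms I_prime[of u "a \<otimes> k"] I_prime[of a k] by auto
qed (use assms in \<open>auto simp: maximal_Rp_def\<close>)

lemma local_Rp: "local_cring Rp maximal_Rp"
proof (intro local_cring.intro cring_Rp local_cring_axioms.intro)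
  show "ideal maximal_Rp Rp"
  proof (rule idealI)
    show "subgroup maximal_Rp (add_monoid Rp)"
    proof (rule Rp.add.subgroupI)
      show "maximal_Rp \<subseteq> carrier Rp" unfolding maximal_Rp_def carrier_Rp using Icarr by blast
      show "maximal_Rp \<noteq> {}" 
        using additive_subgroup.zero_closed[OF is_additive_subgroup] one_in_D
        unfolding maximal_Rp_def by blast
      fix X assume "X \<in> maximal_Rp"
      then obtain a h where X: "a \<in> p" "h \<in> D" "X = fr a h" unfolding maximal_Rp_def by blast
      have h: "h \<in> carrier R" "a \<in> carrier R" using X Icarr by auto
      have "fr (\<ominus> a) h \<oplus>\<^bsub>Rp\<^esub> X = \<zero>\<^bsub>Rp\<^esub>"
        unfolding X zero_Rp using X(1,2) h one_in_D D_mult[OF X(2) X(2)]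
        by (simp add: add_fr) (intro fr_eqI, auto simp: l_minus l_neg)
      then have "\<ominus>\<^bsub>Rp\<^esub> X = fr (\<ominus> a) h"
        unfolding X(3) using h X by (intro Rp.minus_equality fr_closed) auto
      then show "\<ominus>\<^bsub>Rp\<^esub> X \<in> maximal_Rp" using X unfolding maximal_Rp_def by auto
      fix Y assume "Y \<in> maximal_Rp"
      then obtain b k where Y: "b \<in> p" "k \<in> D" "Y = fr b k" unfolding maximal_Rp_def by blast
      have k: "k \<in> carrier R" "b \<in> carrier R" using Y Icarr by auto
      show "X \<oplus>\<^bsub>Rp\<^esub> Y \<in> maximal_Rp"
        unfolding X(3) Y(3) add_fr[OF h(2) X(2) k(2) Y(2)]
        using X Y h k D_mult[OF X(2) Y(2)] I_r_closed by (subst fr_mem_maximal_iff) auto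
    qed
  next
    fix X Y assume X: "X \<in> maximal_Rp" and Y: "Y \<in> carrier Rp"
    obtain a h where a: "a \<in> p" "h \<in> D" "X = fr a h" using X unfolding maximal_Rp_def by blast
    obtain b k where b: "b \<in> carrier R" "k \<in> D" "k \<in> carrier R" "Y = fr b k"
      using Y by (rule Rp_cases)
    show "Y \<otimes>\<^bsub>Rp\<^esub> X \<in> maximal_Rp"
      unfolding a(3) b(4) mult_fr[OF b(1,2) Icarr[OF a(1)] a(2)]
      using a b D_mult[OF b(2) a(2)] I_l_closed Icarr by (subst fr_mem_maximal_iff) auto
    show "X \<otimes>\<^bsub>Rp\<^esub> Y \<in> maximal_Rp"
      unfolding a(3) b(4) mult_fr[OF Icarr[OF a(1)] a(2) b(1,2)]
      using a b D_mult[OF a(2) b(2)] I_r_closed Icarr by (subst fr_mem_maximal_iff) auto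
  qed (rule Rp.ring_axioms)
  show "\<one>\<^bsub>Rp\<^esub> \<notin> maximal_Rp" unfolding one_Rp using one_in_D by (subst fr_mem_maximal_iff) auto
  fix X assume X: "X \<in> carrier Rp" "X \<notin> maximal_Rp"
  then obtain a h where a: "a \<in> carrier R" "h \<in> D" "h \<in> carrier R" "X = fr a h"
    by (metis Rp_cases)
  have aD: "a \<in> D" using X a fr_mem_maximal_iff by auto
  have "fr h a \<otimes>\<^bsub>Rp\<^esub> X = \<one>\<^bsub>Rp\<^esub>"
    unfolding a(4) one_Rp using a(1-3) aD one_in_D D_mult[OF aD a(2)]
    by (simp add: mult_fr) (intro fr_eqI, auto simp: m_comm)
  then show "X \<in> Units Rp"
    using fr_closed[OF a(3) aD] X(1) Rp.m_comm[OF fr_closed[OF a(3) aD] X(1)]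
    unfolding Units_def by auto
qed


text \<open>Only the multiples \<open>s \<otimes> x\<close> are divisible by \<open>q\<close> in
  \<open>R\<close>, but \<open>s\<close> becomes a unit in \<open>Rp\<close>.\<close>

lemma maximal_Rp_principal:
  assumes q: "q \<in> p" and s: "s \<in> D" "\<And>x. x \<in> p \<Longrightarrow> \<exists>y\<in>carrier R. s \<otimes> x = q \<otimes> y"
  shows "maximal_Rp = {fr q \<one> \<otimes>\<^bsub>Rp\<^esub> Y |Y. Y \<in> carrier Rp}"
proof (intro Set.set_eqI iffI)
  fix X assume "X \<in> maximal_Rp"
  then obtain a h where a: "a \<in> p" "h \<in> D" "X = fr a h" unfolding maximal_Rp_def by blast
  then obtain y where y: "y \<in> carrier R" "s \<otimes> a = q \<otimes> y" using s by blast
  have cl: "a \<in> carrier R" "h \<in> carrier R" "s \<in> carrier R" "q \<in> carrier R"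
    using a s q Icarr by auto
  have sh: "s \<otimes> h \<in> D" using D_mult s a by blast
  have "a \<otimes> (\<one> \<otimes> (s \<otimes> h)) = (s \<otimes> a) \<otimes> h" using cl by (simp add: m_ac)
  also have "\<dots> = (q \<otimes> y) \<otimes> h" unfolding y(2) ..
  finally have "X = fr (q \<otimes> y) (\<one> \<otimes> (s \<otimes> h))"
    unfolding a(3) using cl y(1) sh a(2) by (intro fr_eqI) auto
  also have "\<dots> = fr q \<one> \<otimes>\<^bsub>Rp\<^esub> fr y (s \<otimes> h)"
    using cl y(1) sh one_in_D by (intro mult_fr[symmetric])
  finally show "X \<in> {fr q \<one> \<otimes>\<^bsub>Rp\<^esub> Y |Y. Y \<in> carrier Rp}" using fr_closed[OF y(1) sh] by blast
next
  fix X
  interpret L: local_cring Rp maximal_Rp by (rule local_Rp)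
  interpret M: ideal maximal_Rp Rp by (rule L.ideal_M)
  have "fr q \<one> \<in> maximal_Rp" unfolding maximal_Rp_def using q one_in_D by blast
  moreover assume "X \<in> {fr q \<one> \<otimes>\<^bsub>Rp\<^esub> Y |Y. Y \<in> carrier Rp}"
  ultimately show "X \<in> maximal_Rp" using M.I_r_closed by blast
qed

lemma fr_eq_zero_iff:
  assumes "a \<in> carrier R" "h \<in> D"
  shows "fr a h = \<zero>\<^bsub>Rp\<^esub> \<longleftrightarrow> (\<exists>u\<in>D. u \<otimes> a = \<zero>)"
  unfolding zero_Rp using assms one_in_D by (subst fr_eq_iff) auto

lemma fr_power:
  assumes "a \<in> carrier R"
  shows "fr a \<one> [^]\<^bsub>Rp\<^esub> i = fr (a [^] (i::nat)) \<one>"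
proof (induct i)
  case 0
  then show ?case by (simp add: one_Rp)
next
  case (Suc i)
  then show ?case using assms one_in_D by (simp add: mult_fr)
qed

text \<open>A power of \<open>q\<close> that vanished in \<open>Rp\<close> would be killed by some
  \<open>u\<close> in \<open>D\<close>; as \<open>q\<close> is a nonzerodivisor, \<open>u\<close>
  would be zero, which lies in \<open>p\<close>.\<close>

lemma regular_if_uniformizer:
  assumes "noetherian_ring R"
    and q: "q \<in> p" and s: "s \<in> D" "\<And>x. x \<in> p \<Longrightarrow> \<exists>y\<in>carrier R. s \<otimes> x = q \<otimes> y"
    and nzd: "\<And>x. x \<in> carrier R \<Longrightarrow> q \<otimes> x = \<zero> \<Longrightarrow> x = \<zero>"
  shows "regular_local_ring Rp"
proof -
  interpret L: local_cring Rp maximal_Rp by (rule local_Rp)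
  have qc: "q \<in> carrier R" using q Icarr by simp
  have pow: "q [^] i \<otimes> u = \<zero> \<Longrightarrow> u = \<zero>" if "u \<in> carrier R" for u and i :: nat
  proof (induct i)
    case 0
    then show ?case using that by simp
  next
    case (Suc i)
    have "q \<otimes> (q [^] i \<otimes> u) = q [^] Suc i \<otimes> u" using that qc by (simp add: m_ac)
    then have "q [^] i \<otimes> u = \<zero>" using Suc(2) nzd[of "q [^] i \<otimes> u"] that qc by auto
    then show ?case by (rule Suc(1))
  qed
  show ?thesis
  proof (rule L.regular_if_principal_maximal[OF noetherian_Rp])
    show "fr q \<one> \<in> carrier Rp" using qc one_in_D by (rule fr_closed)
    fix i :: nat
    show "fr q \<one> [^]\<^bsub>Rp\<^esub> i \<noteq> \<zero>\<^bsub>Rp\<^esub>"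
    proof
      assume "fr q \<one> [^]\<^bsub>Rp\<^esub> i = \<zero>\<^bsub>Rp\<^esub>"
      then obtain u where "u \<in> D" "u \<otimes> q [^] i = \<zero>"
        unfolding fr_power[OF qc] using fr_eq_zero_iff[of "q [^] i" \<one>] qc one_in_D by auto
      then have "u = \<zero>" using pow[of u i] qc by (simp add: m_comm)
      then show False using \<open>u \<in> D\<close> additive_subgroup.zero_closed[OF is_additive_subgroup] by simp
    qed
  qed (rule assms(1), rule maximal_Rp_principal[OF q s])
qed

text \<open>Elements killed by something outside \<open>p\<close> become zero in the localization,
  which is therefore a field.\<close>

lemma regular_if_annihilated:
  assumes "noetherian_ring R" and "\<And>x. x \<in> p \<Longrightarrow> \<exists>s\<in>D. s \<otimes> x = \<zero>"
  shows "regular_local_ring Rp"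
proof -
  interpret L: local_cring Rp maximal_Rp by (rule local_Rp)
  have "maximal_Rp = {\<zero>\<^bsub>Rp\<^esub>}"
  proof
    show "maximal_Rp \<subseteq> {\<zero>\<^bsub>Rp\<^esub>}"
    proof
      fix X assume "X \<in> maximal_Rp"
      then obtain a h where a: "a \<in> p" "h \<in> D" "X = fr a h" unfolding maximal_Rp_def by blast
      show "X \<in> {\<zero>\<^bsub>Rp\<^esub>}"
        using assms(2)[OF a(1)] fr_eq_zero_iff[OF Icarr[OF a(1)] a(2)] unfolding a(3) by simp
    qed
    show "{\<zero>\<^bsub>Rp\<^esub>} \<subseteq> maximal_Rp"
      using additive_subgroup.zero_closed[OF ideal.axioms(1)[OF L.ideal_M]] by simp
  qed
  then show ?thesis by (rule L.regular_if_trivial_maximal[OF noetherian_Rp[OF assms(1)]])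
qed

text \<open>If \<open>q\<close> lies in \<open>P\<close>, the pair \<open>q\<close>,
  \<open>s\<close> serves for \<open>P\<close> as well. Otherwise let \<open>x\<close> in
  \<open>P\<close> be nonzero in \<open>Rp\<close>. There it is a unit times a power of
  \<open>q\<close>, and clearing denominators writes a multiple of \<open>x\<close> as a product of
  elements outside the prime \<open>P\<close>, a contradiction. So \<open>P\<close> dies in
  \<open>Rp\<close>, that is, its elements are killed by elements of \<open>D\<close>, which are
  also outside \<open>P\<close>.\<close>

lemma regular_below_uniformizer:
  assumes noeth: "noetherian_ring R"
    and q: "q \<in> p" and s: "s \<in> D" "\<And>x. x \<in> p \<Longrightarrow> \<exists>y\<in>carrier R. s \<otimes> x = q \<otimes> y"
    and nzd: "\<And>x. x \<in> carrier R \<Longrightarrow> q \<otimes> x = \<zero> \<Longrightarrow> x = \<zero>"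
    and P: "primeideal P R" "P \<subseteq> p"
  shows "regular_local_ring (localization R P)"
proof -
  interpret P: prime_localization P R using P(1) by (rule prime_localization.intro)
  have qc: "q \<in> carrier R" using q Icarr by simp
  show ?thesis
  proof (cases "q \<in> P")
    case True
    then show ?thesis using s P(2)
      by (intro P.regular_if_uniformizer[OF noeth True _ _ nzd, of s]) auto
  next
    case False
    interpret L: local_cring Rp maximal_Rp by (rule local_Rp)
    have qP: "q [^] i \<notin> P" for i :: nat
    proof (induct i)
      case 0
      then show ?case using P.one_in_D by simp
    next
      case (Suc i)
      then show ?case using P.I_prime[of "q [^] i" q] False qc by auto
    qed
    have "\<exists>u\<in>D. u \<otimes> x = \<zero>" if x: "x \<in> P" for x
    proof (rule ccontr)
      assume not: "\<not> ?thesis"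
      have xc: "x \<in> carrier R" using x P.Icarr by simp
      then have "fr x \<one> \<noteq> \<zero>\<^bsub>Rp\<^esub>" using not fr_eq_zero_iff one_in_D by simp
      then obtain V i where V: "V \<in> Units Rp" "fr x \<one> = V \<otimes>\<^bsub>Rp\<^esub> fr q \<one> [^]\<^bsub>Rp\<^esub> (i::nat)"
        using L.unit_times_power[OF noetherian_Rp[OF noeth] fr_closed[OF qc one_in_D]
            maximal_Rp_principal[OF q s], of "fr x \<one>"] fr_closed[OF xc one_in_D] by blast
      then obtain a h where a: "a \<in> carrier R" "h \<in> D" "h \<in> carrier R" "V = fr a h"
        by (metis Rp.Units_closed Rp_cases)
      have "V \<notin> maximal_Rp"
      proof
        interpret M: ideal maximal_Rp Rp by (rule L.ideal_M)
        assume "V \<in> maximal_Rp"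
        then have "inv\<^bsub>Rp\<^esub> V \<otimes>\<^bsub>Rp\<^esub> V \<in> maximal_Rp" using V by (intro M.I_l_closed) auto
        then show False using V L.one_notin by simp
      qed
      then have aD: "a \<in> D" using a fr_mem_maximal_iff by simp
      have "fr x \<one> = fr (a \<otimes> q [^] i) h"
        using V(2) a(1-3) qc one_in_D unfolding a(4) fr_power[OF qc] by (simp add: mult_fr)
      then obtain u where u: "u \<in> D" "u \<otimes> (x \<otimes> h) = u \<otimes> (a \<otimes> q [^] i \<otimes> \<one>)"
        using fr_eq_iff[of x "a \<otimes> q [^] i" \<one> h] xc a qc one_in_D by auto
      have "u \<otimes> (x \<otimes> h) \<in> P" using u(1) x a by (simp add: P.I_l_closed P.I_r_closed)
      then have "u \<otimes> (a \<otimes> q [^] i) \<in> P" using u a qc by simp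
      moreover have "u \<in> carrier R - P" "a \<in> carrier R - P" "q [^] i \<in> carrier R - P"
        using u(1) aD P(2) qP qc by auto
      ultimately show False using P.D_mult by blast
    qed
    then show ?thesis using P(2) by (intro P.regular_if_annihilated[OF noeth]) blast
  qed
qed

end

text \<open>Regularity is demanded at all primes, while uniformizers are found at maximal ideals;
  each prime is treated inside a maximal ideal containing it.\<close>

lemma regular_ringI:
  fixes R :: "('c, 'k) module" (structure)
  assumes "cring R" and noeth: "noetherian_ring R"
    and max: "\<And>m. maximalideal m R \<Longrightarrow> \<exists>q\<in>m. \<exists>s\<in>carrier R - m.
      (\<forall>x\<in>m. \<exists>y\<in>carrier R. s \<otimes> x = q \<otimes> y) \<and> (\<forall>x\<in>carrier R. q \<otimes> x = \<zero> \<longrightarrow> x = \<zero>)"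
  shows "regular_ring R"
  unfolding regular_ring_def
proof (intro conjI allI impI assms)
  fix p assume p: "primeideal p R"
  interpret noetherian_ring R by fact
  interpret p: primeideal p R by fact
  obtain m where m: "maximalideal m R" "p \<subseteq> m"
    using exists_maximalideal[OF p.is_ideal] p.I_notcarr by metis
  interpret m: prime_localization m R
    using cring.maximalideal_prime[OF assms(1) m(1)] by (rule prime_localization.intro)
  show "regular_local_ring (localization R p)"
    using max[OF m(1)] m.regular_below_uniformizer[OF noeth _ _ _ _ p m(2)] by blast
qed

section \<open>Localized polynomial rings\<close>

text \<open>The embedding \<psi> stays abstract so that both charts of the line are covered: it will
  substitute the coordinate function of the chart. The ring \<open>\<O>\<close> below is C[X] with
  \<open>h\<close> inverted, seen inside the function field.\<close>

locale localized_polynomials =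
  fixes \<psi> :: "complex poly \<Rightarrow> 'k::field" and h :: "complex poly"
  assumes psi_1: "\<psi> 1 = 1" and psi_add: "\<psi> (p + q) = \<psi> p + \<psi> q"
    and psi_mult: "\<psi> (p * q) = \<psi> p * \<psi> q" and psi_inj: "\<psi> p = 0 \<Longrightarrow> p = 0"
    and h_nz: "h \<noteq> 0"
begin

lemma psi_0 [simp]: "\<psi> 0 = 0"
  using psi_add[of 0 0] by (metis add.right_neutral add_left_cancel)

lemma psi_uminus: "\<psi> (- p) = - \<psi> p"
  using psi_add[of p "- p"] by (simp add: eq_neg_iff_add_eq_0 add.commute)

lemma psi_diff: "\<psi> (p - q) = \<psi> p - \<psi> q"
  using psi_add[of p "- q"] psi_uminus[of q] by simp

lemma psi_power: "\<psi> (p ^ n) = \<psi> p ^ n"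
  by (induct n) (simp_all add: psi_1 psi_mult)

lemma psi_eq_iff: "\<psi> p = \<psi> q \<longleftrightarrow> p = q"
  using psi_inj[of "p - q"] by (auto simp: psi_diff)

lemma psi_h: "\<psi> h \<noteq> 0"
  using psi_inj h_nz by blast

definition \<O> where "\<O> = {\<psi> p / \<psi> h ^ n |p n. True}"

lemma O_I: "\<psi> p / \<psi> h ^ n \<in> \<O>"
  unfolding \<O>_def by blast

lemma O_cases:
  assumes "g \<in> \<O>"
  obtains p n where "g = \<psi> p / \<psi> h ^ n"
  using assms unfolding \<O>_def by blast

lemma psi_in_O [intro]: "\<psi> p \<in> \<O>"
  using O_I[of p 0] by simp

lemma zero_in_O [intro]: "0 \<in> \<O>" and one_in_O [intro]: "1 \<in> \<O>"
  using psi_in_O[of 0] psi_in_O[of 1] by (simp_all add: psi_1)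

lemma O_add [intro]:
  assumes "x \<in> \<O>" "y \<in> \<O>" shows "x + y \<in> \<O>"
proof -
  obtain p n q k where xy: "x = \<psi> p / \<psi> h ^ n" "y = \<psi> q / \<psi> h ^ k"
    using assms by (metis O_cases)
  have "x + y = \<psi> (p * h ^ k + q * h ^ n) / \<psi> h ^ (n + k)"
    unfolding xy using psi_h by (simp add: psi_add psi_mult psi_power field_simps power_add)
  then show ?thesis using O_I by simp
qed

lemma O_mult [intro]:
  assumes "x \<in> \<O>" "y \<in> \<O>" shows "x * y \<in> \<O>"
proof -
  obtain p n q k where "x = \<psi> p / \<psi> h ^ n" "y = \<psi> q / \<psi> h ^ k"
    using assms by (metis O_cases)
  then have "x * y = \<psi> (p * q) / \<psi> h ^ (n + k)"
    by (simp add: psi_mult power_add)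
  then show ?thesis using O_I by simp
qed

lemma O_uminus [intro]: "x \<in> \<O> \<Longrightarrow> - x \<in> \<O>"
  using O_mult[OF psi_in_O[of "- 1"], of x] by (simp add: psi_uminus psi_1)

lemma O_diff [intro]: "x \<in> \<O> \<Longrightarrow> y \<in> \<O> \<Longrightarrow> x - y \<in> \<O>"
  using O_add[of x "- y"] O_uminus[of y] by simp

lemma O_sum: "(\<And>a. a \<in> A \<Longrightarrow> g a \<in> \<O>) \<Longrightarrow> sum g A \<in> \<O>"
  by (induct A rule: infinite_finite_induct) auto

text \<open>The value at the point \<open>c\<close>. The choice among presentations of
  \<open>g\<close> is harmless as soon as \<open>h\<close> does not vanish at \<open>c\<close>, see
  \<open>ev_quotient\<close>.\<close>

definition ev where
  "ev c g = (SOME v. \<exists>p n. g = \<psi> p / \<psi> h ^ n \<and> v = poly p c / poly h c ^ n)"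

lemma ev_quotient:
  assumes "poly h c \<noteq> 0"
  shows "ev c (\<psi> p / \<psi> h ^ n) = poly p c / poly h c ^ n"
proof -
  have "v = poly p c / poly h c ^ n"
    if "\<psi> p / \<psi> h ^ n = \<psi> q / \<psi> h ^ k" "v = poly q c / poly h c ^ k" for v q k
  proof -
    have "\<psi> (p * h ^ k) = \<psi> (q * h ^ n)"
      using that(1) psi_h by (simp add: psi_mult psi_power field_simps)
    then have "p * h ^ k = q * h ^ n" by (simp add: psi_eq_iff)
    then have "poly p c * poly h c ^ k = poly q c * poly h c ^ n"
      by (metis poly_mult poly_power)
    then show ?thesis unfolding that(2) using assms by (simp add: field_simps)
  qed
  then show ?thesis unfolding ev_def by (intro some_equality) blast+
qed

lemma ev_psi: "poly h c \<noteq> 0 \<Longrightarrow> ev c (\<psi> p) = poly p c"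
  using ev_quotient[of c p 0] by simp

lemma ev_0 [simp]: "poly h c \<noteq> 0 \<Longrightarrow> ev c 0 = 0" and ev_1 [simp]: "poly h c \<noteq> 0 \<Longrightarrow> ev c 1 = 1"
  using ev_psi[of c 0] ev_psi[of c 1] by (simp_all add: psi_1)

lemma ev_add:
  assumes c: "poly h c \<noteq> 0" and "x \<in> \<O>" "y \<in> \<O>"
  shows "ev c (x + y) = ev c x + ev c y"
proof -
  obtain p n q k where xy: "x = \<psi> p / \<psi> h ^ n" "y = \<psi> q / \<psi> h ^ k"
    using assms by (metis O_cases)
  have "x + y = \<psi> (p * h ^ k + q * h ^ n) / \<psi> h ^ (n + k)"
    unfolding xy using psi_h by (simp add: psi_add psi_mult psi_power field_simps power_add)
  then have exy: "ev c (x + y) = poly (p * h ^ k + q * h ^ n) c / poly h c ^ (n + k)"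
    using c by (simp only: ev_quotient not_False_eq_True)
  have ex: "ev c x = poly p c / poly h c ^ n" and ey: "ev c y = poly q c / poly h c ^ k"
    using c by (simp_all only: xy ev_quotient not_False_eq_True)
  show ?thesis
    unfolding exy ex ey using c by (simp add: add_frac_eq power_add)
qed

lemma ev_mult:
  assumes c: "poly h c \<noteq> 0" and "x \<in> \<O>" "y \<in> \<O>"
  shows "ev c (x * y) = ev c x * ev c y"
proof -
  obtain p n q k where xy: "x = \<psi> p / \<psi> h ^ n" "y = \<psi> q / \<psi> h ^ k"
    using assms by (metis O_cases)
  then have "x * y = \<psi> (p * q) / \<psi> h ^ (n + k)"
    by (simp add: psi_mult power_add)
  then have "ev c (x * y) = poly (p * q) c / poly h c ^ (n + k)"
    using c by (simp only: ev_quotient not_False_eq_True)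
  then show ?thesis
    using xy c by (simp add: ev_quotient power_add)
qed

lemma ev_sum:
  assumes "poly h c \<noteq> 0" "\<And>a. a \<in> A \<Longrightarrow> g a \<in> \<O>"
  shows "ev c (sum g A) = (\<Sum>a\<in>A. ev c (g a))"
  using assms(2)
proof (induct A rule: infinite_finite_induct)
  case (insert a A)
  then have "ev c (g a + sum g A) = ev c (g a) + ev c (sum g A)"
    by (intro ev_add assms(1) O_sum) auto
  then show ?case using insert by simp
qed (simp_all add: assms(1))

lemma ev_eq_0D:
  assumes c: "poly h c \<noteq> 0" and "g \<in> \<O>" "ev c g = 0"
  obtains g' where "g' \<in> \<O>" "g = \<psi> [:- c, 1:] * g'"
proof -
  obtain p n where g: "g = \<psi> p / \<psi> h ^ n" using assms(2) by (rule O_cases)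
  then have "poly p c = 0" using assms by (simp add: ev_quotient)
  then obtain q where "p = [:- c, 1:] * q" unfolding poly_eq_0_iff_dvd by blast
  then have "g = \<psi> [:- c, 1:] * (\<psi> q / \<psi> h ^ n)" using g by (simp only: psi_mult) simp
  then show thesis using O_I that by blast
qed

lemma O_clear_denominator:
  assumes "g \<in> \<O>" "g \<noteq> 0"
  obtains p n where "p \<noteq> 0" "\<psi> p = \<psi> h ^ n * g"
proof -
  obtain p n where "g = \<psi> p / \<psi> h ^ n" using assms(1) by (rule O_cases)
  then have "\<psi> p = \<psi> h ^ n * g" using psi_h by simp
  moreover from this have "p \<noteq> 0" using assms(2) psi_h by auto
  ultimately show thesis using that by blast
qed

text \<open>Since \<open>h\<close> is a unit of \<open>\<O>\<close>, the ideal is determined by the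
  polynomials in it, and division with remainder by one of least degree shows that this one
  generates. Without nonzero polynomials the ideal is zero.\<close>

lemma O_ideal_principal:
  assumes J: "J \<subseteq> \<O>" "0 \<in> J" "\<And>x y. x \<in> J \<Longrightarrow> y \<in> J \<Longrightarrow> x + y \<in> J"
    "\<And>g x. g \<in> \<O> \<Longrightarrow> x \<in> J \<Longrightarrow> g * x \<in> J"
  obtains j where "j \<in> J" "\<And>x. x \<in> J \<Longrightarrow> \<exists>g\<in>\<O>. x = g * j"
proof (cases "\<exists>p. p \<noteq> 0 \<and> \<psi> p \<in> J")
  case True
  let ?P = "\<lambda>p. p \<noteq> 0 \<and> \<psi> p \<in> J"
  obtain p where p: "?P p" and min: "\<And>q. ?P q \<Longrightarrow> degree p \<le> degree q"
    using True ex_has_least_nat[of ?P _ degree] by blast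
  have "\<exists>g\<in>\<O>. x = g * \<psi> p" if x: "x \<in> J" for x
  proof -
    have "x \<in> \<O>" using x J(1) by blast
    then obtain q n where q: "x = \<psi> q / \<psi> h ^ n" by (rule O_cases)
    \<comment> \<open>This exhibits the remainder as an \<open>\<O>\<close>-combination of members
      of \<open>J\<close>, so minimality of the degree of \<open>p\<close> forces it to
      vanish.\<close>
    have mod_eq: "\<psi> (q mod p) = \<psi> h ^ n * x + (- \<psi> (q div p)) * \<psi> p"
      unfolding minus_div_mult_eq_mod[symmetric, of q p]
      using q psi_h by (simp only: psi_diff psi_mult) simp
    have "\<psi> h ^ n \<in> \<O>" using psi_in_O[of "h ^ n"] by (simp add: psi_power)
    then have "\<psi> (q mod p) \<in> J"
      unfolding mod_eq using x p by (intro J(3) J(4) O_uminus psi_in_O) auto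
    then have "q mod p = 0" using min[of "q mod p"] degree_mod_less[of p q] p by fastforce
    then have "q = (q div p) * p" by (metis add.right_neutral div_mult_mod_eq)
    then have "\<psi> q = \<psi> (q div p) * \<psi> p" by (metis psi_mult)
    then have "x = (\<psi> (q div p) / \<psi> h ^ n) * \<psi> p" using q by simp
    then show ?thesis using O_I by blast
  qed
  then show thesis using that p by blast
next
  case False
  have zero: "x = 0" if x: "x \<in> J" for x
  proof (rule ccontr)
    assume "x \<noteq> 0"
    moreover have "x \<in> \<O>" using x J(1) by blast
    ultimately obtain p n where p: "p \<noteq> 0" "\<psi> p = \<psi> h ^ n * x"
      using O_clear_denominator by blast
    have "\<psi> h ^ n \<in> \<O>" using psi_in_O[of "h ^ n"] by (simp add: psi_power)
    then have "\<psi> p \<in> J" unfolding p(2) using x by (rule J(4))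
    then show False using False p(1) by blast
  qed
  have "\<exists>g\<in>\<O>. x = g * 0" if "x \<in> J" for x
    using zero[OF that] by (intro bexI[OF _ zero_in_O]) simp
  then show thesis by (rule that[OF J(2)])
qed

end

section \<open>The algebra of the covering over a small open set\<close>

text \<open>\<open>w a\<close> generates the degree \<open>a\<close> part over the coordinate ring \<open>\<O>\<close>, and \<open>fr a\<close> is the fractional
  part of the coefficient of the divisor in degree \<open>a\<close> at the point \<open>c0\<close>.\<close>

locale graded_cover = localized_polynomials \<psi> h
  for \<psi> :: "complex poly \<Rightarrow> 'k::field" and h :: "complex poly" +
  fixes c0 :: complex and w :: "'g::{ab_group_add, finite} \<Rightarrow> 'k"
    and f :: "'g \<Rightarrow> 'g \<Rightarrow> 'k" and fr :: "'g \<Rightarrow> rat"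
  assumes h_c0: "poly h c0 \<noteq> 0"
    and w_nz: "w a \<noteq> 0" and f_nz: "f a b \<noteq> 0" and f_sym: "f a b = f b a"
    and cocycle: "f a b * f (a + b) c = f a (b + c) * f b c"
    and fr_nonneg: "0 \<le> fr a" and fr_less: "fr a < 1"
    and fr_add: "fr a + fr b - fr (a + b) = (if fr a + fr b \<ge> 1 then 1 else 0)"
    and w_mult: "\<exists>u\<in>\<O>. \<exists>v\<in>\<O>. u * v = 1 \<and>
      w a * w b = u * (if fr a + fr b \<ge> 1 then \<psi> [:- c0, 1:] else 1) * f a b * w (a + b)"
begin

text \<open>The section algebra of the covering over a small open set, with membership expressed by
  coordinates with respect to \<open>w\<close>; \<open>sec_cover_algebra\<close> makes the
  identification.\<close>

definition R :: "(complex, 'g \<Rightarrow> 'k) module" where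
  "R = \<lparr>carrier = {s. \<forall>a. s a / w a \<in> \<O>},
     mult = (\<lambda>s t c. \<Sum>(a, b) | a + b = c. s a * t b * inverse (f a b)),
     one = (\<lambda>a. if a = 0 then f 0 0 else 0),
     zero = (\<lambda>_. 0),
     add = (\<lambda>s t a. s a + t a),
     module.smult = (\<lambda>c s a. \<psi> [:c:] * s a)\<rparr>"

lemma carrier_R: "s \<in> carrier R \<longleftrightarrow> (\<forall>a. s a / w a \<in> \<O>)"
  and zero_R: "\<zero>\<^bsub>R\<^esub> = (\<lambda>_. 0)"
  and one_R: "\<one>\<^bsub>R\<^esub> = (\<lambda>a. if a = 0 then f 0 0 else 0)"
  and add_R: "s \<oplus>\<^bsub>R\<^esub> t = (\<lambda>a. s a + t a)"
  and smult_R: "k \<odot>\<^bsub>R\<^esub> s = (\<lambda>a. \<psi> [:k:] * s a)"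
  by (simp_all add: R_def)

lemma mult_R: "s \<otimes>\<^bsub>R\<^esub> t = (\<lambda>c. \<Sum>a\<in>UNIV. s a * t (c - a) * inverse (f a (c - a)))"
proof
  fix c
  show "(s \<otimes>\<^bsub>R\<^esub> t) c = (\<Sum>a\<in>UNIV. s a * t (c - a) * inverse (f a (c - a)))"
    unfolding R_def
    by simp (rule sum.reindex_bij_witness[of _ "\<lambda>a. (a, c - a)" fst], auto)
qed

text \<open>The structure constants for the basis \<open>W a 1\<close>, see \<open>W_W\<close>; the
  quotient by \<open>f\<close> comes from the twisted product.\<close>

definition \<sigma> where "\<sigma> a b = w a * w b / (f a b * w (a + b))"

lemma sigma_cases:
  obtains u v where "u \<in> \<O>" "v \<in> \<O>" "u * v = 1"
    "\<sigma> a b = u * (if fr a + fr b \<ge> 1 then \<psi> [:- c0, 1:] else 1)"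
proof -
  obtain u v where u: "u \<in> \<O>" "v \<in> \<O>" "u * v = 1"
    "w a * w b = u * (if fr a + fr b \<ge> 1 then \<psi> [:- c0, 1:] else 1) * f a b * w (a + b)"
    using w_mult by blast
  then have "\<sigma> a b = u * (if fr a + fr b \<ge> 1 then \<psi> [:- c0, 1:] else 1)"
    unfolding \<sigma>_def using f_nz[of a b] w_nz[of "a + b"] by (simp only:) simp
  then show thesis using that u by blast
qed

lemma sigma_in_O [intro]: "\<sigma> a b \<in> \<O>"
  by (rule sigma_cases[of a b]) auto

lemma fr_0: "fr 0 = 0"
  using fr_add[of 0 0] fr_less[of 0] by (simp split: if_splits)

lemma f_0_left: "f 0 a = f 0 0"
  using cocycle[of 0 0 a] f_nz[of 0 a] by simp

text \<open>This is the coordinate of the unit element. It is the inverse of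
  \<open>\<sigma> 0 0\<close>, a unit because degree 0 produces no carry.\<close>

lemma f00_in_O: "f 0 0 / w 0 \<in> \<O>"
proof (rule sigma_cases[of 0 0])
  fix u v assume u: "u \<in> \<O>" "v \<in> \<O>" "u * v = 1"
    "\<sigma> 0 0 = u * (if fr 0 + fr 0 \<ge> 1 then \<psi> [:- c0, 1:] else 1)"
  then have "w 0 / f 0 0 = u" using w_nz[of 0] by (simp add: \<sigma>_def fr_0)
  then have "f 0 0 / w 0 = inverse u" by (metis inverse_divide)
  also have "\<dots> = v" using u(3) by (rule inverse_unique)
  finally show ?thesis using u(2) by simp
qed

lemma mult_coord:
  "(s \<otimes>\<^bsub>R\<^esub> t) c / w c = (\<Sum>a\<in>UNIV. (s a / w a) * (t (c - a) / w (c - a)) * \<sigma> a (c - a))"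
  unfolding mult_R sum_divide_distrib
proof (rule sum.cong[OF refl])
  fix a
  show "s a * t (c - a) * inverse (f a (c - a)) / w c = s a / w a * (t (c - a) / w (c - a)) * \<sigma> a (c - a)"
    using w_nz[of a] w_nz[of "c - a"] w_nz[of c] f_nz[of a "c - a"]
    by (simp add: \<sigma>_def field_simps)
qed

lemma mult_closed: "s \<in> carrier R \<Longrightarrow> t \<in> carrier R \<Longrightarrow> s \<otimes>\<^bsub>R\<^esub> t \<in> carrier R"
  unfolding carrier_R mult_coord by (intro allI O_sum O_mult sigma_in_O) auto

lemma mult_R_comm: "s \<otimes>\<^bsub>R\<^esub> t = t \<otimes>\<^bsub>R\<^esub> s"
  unfolding mult_R
proof
  fix c
  show "(\<Sum>a\<in>UNIV. s a * t (c - a) * inverse (f a (c - a))) =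
      (\<Sum>a\<in>UNIV. t a * s (c - a) * inverse (f a (c - a)))"
    by (rule sum.reindex_bij_witness[of _ "\<lambda>a. c - a" "\<lambda>a. c - a"])
      (auto simp: f_sym mult.commute)
qed

lemma mult_R_assoc: "(s \<otimes>\<^bsub>R\<^esub> t) \<otimes>\<^bsub>R\<^esub> u = s \<otimes>\<^bsub>R\<^esub> (t \<otimes>\<^bsub>R\<^esub> u)"
proof
  fix d
  have "((s \<otimes>\<^bsub>R\<^esub> t) \<otimes>\<^bsub>R\<^esub> u) d = (\<Sum>c\<in>UNIV. \<Sum>a\<in>UNIV.
      s a * t (c - a) * inverse (f a (c - a)) * u (d - c) * inverse (f c (d - c)))"
    unfolding mult_R by (simp add: sum_distrib_right)
  also have "\<dots> = (\<Sum>a\<in>UNIV. \<Sum>c\<in>UNIV.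
      s a * t (c - a) * inverse (f a (c - a)) * u (d - c) * inverse (f c (d - c)))"
    by (rule sum.swap)
  also have "\<dots> = (\<Sum>a\<in>UNIV. \<Sum>b\<in>UNIV.
      s a * (t b * u (d - a - b) * inverse (f b (d - a - b))) * inverse (f a (d - a)))"
  proof (rule sum.cong[OF refl])
    fix a
    \<comment> \<open>The cocycle condition for the triple \<open>a\<close>, \<open>b\<close>,
      \<open>d - a - b\<close>, with both sides inverted.\<close>
    have eq: "inverse (f a b) * inverse (f (a + b) (d - a - b)) =
        inverse (f b (d - a - b)) * inverse (f a (d - a))" for b
      using cocycle[of a b "d - a - b"]
      by (simp add: inverse_mult_distrib[symmetric] mult.commute del: inverse_mult_distrib)
    show "(\<Sum>c\<in>UNIV. s a * t (c - a) * inverse (f a (c - a)) * u (d - c) * inverse (f c (d - c))) =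
      (\<Sum>b\<in>UNIV. s a * (t b * u (d - a - b) * inverse (f b (d - a - b))) * inverse (f a (d - a)))"
    proof (rule sum.reindex_bij_witness[of _ "\<lambda>b. a + b" "\<lambda>c. c - a"])
      fix c
      show "s a * (t (c - a) * u (d - a - (c - a)) * inverse (f (c - a) (d - a - (c - a)))) *
          inverse (f a (d - a)) =
        s a * t (c - a) * inverse (f a (c - a)) * u (d - c) * inverse (f c (d - c))"
        using eq[of "c - a"] by simp
    qed auto
  qed
  also have "\<dots> = (s \<otimes>\<^bsub>R\<^esub> (t \<otimes>\<^bsub>R\<^esub> u)) d"
    unfolding mult_R by (simp add: sum_distrib_left sum_distrib_right)
  finally show "((s \<otimes>\<^bsub>R\<^esub> t) \<otimes>\<^bsub>R\<^esub> u) d = (s \<otimes>\<^bsub>R\<^esub> (t \<otimes>\<^bsub>R\<^esub> u)) d" .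
qed

definition W :: "'g \<Rightarrow> 'k \<Rightarrow> 'g \<Rightarrow> 'k" where
  "W a g = (\<lambda>b. if b = a then g * w a else 0)"

lemma W_closed [intro]: "g \<in> \<O> \<Longrightarrow> W a g \<in> carrier R"
  unfolding carrier_R W_def using w_nz by auto

lemma W_mult: "(W a g \<otimes>\<^bsub>R\<^esub> x) c = g * w a * x (c - a) * inverse (f a (c - a))"
proof -
  have "(W a g \<otimes>\<^bsub>R\<^esub> x) c =
      (\<Sum>b\<in>UNIV. if b = a then g * w a * x (c - a) * inverse (f a (c - a)) else 0)"
    unfolding mult_R W_def by (rule sum.cong) auto
  then show ?thesis by simp
qed

text \<open>The structure map from \<open>\<O>\<close> to \<open>R\<close>: the unit element is
  \<open>f 0 0\<close> placed in degree 0, and this is \<open>g\<close> times it.\<close>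

definition scal :: "'k \<Rightarrow> 'g \<Rightarrow> 'k" where
  "scal g = (\<lambda>a. if a = 0 then g * f 0 0 else 0)"

lemma scal_closed [intro, simp]: "g \<in> \<O> \<Longrightarrow> scal g \<in> carrier R"
  unfolding carrier_R scal_def using O_mult[OF _ f00_in_O, of g] by auto

lemma scal_mult: "scal g \<otimes>\<^bsub>R\<^esub> x = (\<lambda>a. g * x a)"
proof
  fix c
  have "(scal g \<otimes>\<^bsub>R\<^esub> x) c = (\<Sum>b\<in>(UNIV :: 'g set). if b = 0 then g * x c else 0)"
    unfolding mult_R scal_def by (rule sum.cong) (auto simp: f_0_left[of c] f_nz)
  then show "(scal g \<otimes>\<^bsub>R\<^esub> x) c = g * x c" by simp
qed

lemma scal_1: "scal 1 = \<one>\<^bsub>R\<^esub>"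
  unfolding scal_def one_R by auto

lemma cring_R: "cring R"
proof (rule cringI)
  show "abelian_group R"
  proof (rule abelian_groupI)
    fix x assume x: "x \<in> carrier R"
    have "(\<lambda>a. - x a) \<in> carrier R"
      unfolding carrier_R
    proof
      fix a
      show "- x a / w a \<in> \<O>" using O_uminus[of "x a / w a"] x carrier_R by simp
    qed
    then show "\<exists>y\<in>carrier R. y \<oplus>\<^bsub>R\<^esub> x = \<zero>\<^bsub>R\<^esub>"
      by (rule bexI[rotated]) (simp add: add_R zero_R)
  qed (auto simp: carrier_R add_R zero_R add_divide_distrib algebra_simps)
  show "comm_monoid R"
  proof (rule comm_monoidI)
    show "\<one>\<^bsub>R\<^esub> \<in> carrier R" using scal_closed[of 1] scal_1 by auto
    show "\<one>\<^bsub>R\<^esub> \<otimes>\<^bsub>R\<^esub> x = x" for x using scal_mult[of 1 x] scal_1 by simp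
  qed (auto simp: mult_closed mult_R_assoc intro: mult_R_comm)
  show "(x \<oplus>\<^bsub>R\<^esub> y) \<otimes>\<^bsub>R\<^esub> z = x \<otimes>\<^bsub>R\<^esub> z \<oplus>\<^bsub>R\<^esub> y \<otimes>\<^bsub>R\<^esub> z" for x y z
    unfolding mult_R add_R by (simp add: sum.distrib algebra_simps)
qed

lemma psi_const_add: "\<psi> [:a + b:] = \<psi> [:a:] + \<psi> [:b:]"
  using psi_add[of "[:a:]" "[:b:]"] by simp

lemma psi_const_mult: "\<psi> [:a * b:] = \<psi> [:a:] * \<psi> [:b:]"
  using psi_mult[of "[:a:]" "[:b:]"] by (simp add: mult.commute)

lemma cring_complex: "cring complex_ring"
proof (rule cringI)
  show "abelian_group complex_ring"
  proof (rule abelian_groupI)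
    fix x assume "x \<in> carrier complex_ring"
    then show "\<exists>y\<in>carrier complex_ring. y \<oplus>\<^bsub>complex_ring\<^esub> x = \<zero>\<^bsub>complex_ring\<^esub>"
      by (intro bexI[of _ "- x"]) (auto simp: complex_ring_def)
  qed (auto simp: complex_ring_def)
  show "comm_monoid complex_ring" by (rule comm_monoidI) (auto simp: complex_ring_def)
qed (simp add: complex_ring_def algebra_simps)

lemma complex_algebra_R: "complex_algebra R"
proof (rule algebraI)
  show "a \<odot>\<^bsub>R\<^esub> x \<in> carrier R" if "x \<in> carrier R" for a x
    using that O_mult[OF psi_in_O] unfolding carrier_R smult_R by (metis times_divide_eq_right)
  show "a \<odot>\<^bsub>R\<^esub> x \<otimes>\<^bsub>R\<^esub> y = a \<odot>\<^bsub>R\<^esub> (x \<otimes>\<^bsub>R\<^esub> y)" for a x y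
    unfolding smult_R mult_R by (simp add: sum_distrib_left mult.assoc)
qed (rule cring_complex, rule cring_R, auto simp: smult_R add_R complex_ring_def psi_const_add
    psi_const_mult algebra_simps psi_1 simp flip: one_pCons)


sublocale R: cring R by (rule cring_R)

lemma scal_add: "scal (a + b) = scal a \<oplus>\<^bsub>R\<^esub> scal b"
  unfolding scal_def add_R by (auto simp: algebra_simps)

lemma scal_times: "scal (a * b) = scal a \<otimes>\<^bsub>R\<^esub> scal b"
  unfolding scal_mult unfolding scal_def by auto

lemma scal_0: "scal 0 = \<zero>\<^bsub>R\<^esub>"
  unfolding scal_def zero_R by auto

lemma scal_psi_closed [simp]: "scal (\<psi> p) \<in> carrier R"
  using psi_in_O by (rule scal_closed)

lemma smult_eq_scal: "c \<odot>\<^bsub>R\<^esub> x = scal (\<psi> [:c:]) \<otimes>\<^bsub>R\<^esub> x"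
  unfolding smult_R scal_mult ..

section \<open>Finite generation of modules over the coordinate ring, and of the algebra\<close>

definition submod where
  "submod N \<longleftrightarrow> N \<subseteq> carrier R \<and> \<zero>\<^bsub>R\<^esub> \<in> N \<and> (\<forall>x\<in>N. \<forall>y\<in>N. x \<oplus>\<^bsub>R\<^esub> y \<in> N) \<and>
    (\<forall>g\<in>\<O>. \<forall>x\<in>N. scal g \<otimes>\<^bsub>R\<^esub> x \<in> N)"

lemma submodD:
  assumes "submod N"
  shows "x \<in> N \<Longrightarrow> x \<in> carrier R" "\<zero>\<^bsub>R\<^esub> \<in> N" "x \<in> N \<Longrightarrow> y \<in> N \<Longrightarrow> (\<lambda>a. x a + y a) \<in> N"
    "g \<in> \<O> \<Longrightarrow> x \<in> N \<Longrightarrow> (\<lambda>a. g * x a) \<in> N"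
  using assms unfolding submod_def add_R scal_mult by auto

text \<open>The degree \<open>a\<close> coordinates of elements of \<open>N\<close> form an ideal of
  \<open>\<O>\<close>, generated by the coordinate of a single \<open>s\<close> in \<open>N\<close>.
  Subtracting a multiple of \<open>s\<close> clears degree \<open>a\<close> and leaves the submodule
  \<open>?N0\<close> with smaller support. Generation is phrased by a universal property, which
  avoids explicit linear combinations.\<close>

lemma submod_fin_gen_supported:
  fixes A :: "'g set"
  assumes "finite A" and "submod N" and "\<And>x a. x \<in> N \<Longrightarrow> a \<notin> A \<Longrightarrow> x a = 0"
  shows "\<exists>S\<subseteq>N. finite S \<and> (\<forall>N'. submod N' \<and> S \<subseteq> N' \<longrightarrow> N \<subseteq> N')"
  using assms
proof (induct A arbitrary: N)
  case empty
  have "x = \<zero>\<^bsub>R\<^esub>" if "x \<in> N" for x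
    using empty(2)[OF that] unfolding zero_R by auto
  then have "N \<subseteq> N'" if "submod N'" for N'
    using submodD(2)[OF that] by (metis subsetI)
  then show ?case by (intro exI[of _ "{}"]) simp
next
  case (insert a A)
  note N = submodD[OF insert(4)]
  let ?N0 = "{x \<in> N. x a = 0}"
  have N0: "submod ?N0"
    unfolding submod_def add_R scal_mult using N by (auto simp: zero_R)
  have "x b = 0" if "x \<in> ?N0" "b \<notin> A" for x b
    using that insert(5)[of x b] by (cases "b = a") auto
  then have "\<exists>S\<subseteq>?N0. finite S \<and> (\<forall>N'. submod N' \<and> S \<subseteq> N' \<longrightarrow> ?N0 \<subseteq> N')"
    by (rule insert(3)[OF N0])
  then obtain S0 where S0: "S0 \<subseteq> ?N0" "finite S0"
      "\<forall>N'. submod N' \<and> S0 \<subseteq> N' \<longrightarrow> ?N0 \<subseteq> N'"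
    by (elim exE conjE)
  let ?J = "(\<lambda>x. x a / w a) ` N"
  obtain j where j: "j \<in> ?J" "\<And>x. x \<in> ?J \<Longrightarrow> \<exists>g\<in>\<O>. x = g * j"
  proof (rule O_ideal_principal[of ?J])
    show "?J \<subseteq> \<O>" using N(1) carrier_R by auto
    show "0 \<in> ?J" using N(2) by (intro image_eqI[of _ _ "\<zero>\<^bsub>R\<^esub>"]) (simp_all add: zero_R)
    fix x y assume "x \<in> ?J" "y \<in> ?J"
    then obtain u v where "u \<in> N" "v \<in> N" "x = u a / w a" "y = v a / w a" by blast
    then show "x + y \<in> ?J"
      using N(3)[of u v] by (intro image_eqI[of _ _ "\<lambda>a. u a + v a"]) (auto simp: add_divide_distrib)
  next
    fix g x assume "g \<in> \<O>" "x \<in> ?J"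
    then obtain u where "u \<in> N" "x = u a / w a" by blast
    then show "g * x \<in> ?J"
      using N(4)[of g u] \<open>g \<in> \<O>\<close> by (intro image_eqI[of _ _ "\<lambda>a. g * u a"]) auto
  qed (rule that)
  obtain s where s: "s \<in> N" "j = s a / w a" using j(1) by blast
  have "N \<subseteq> N'" if N': "submod N'" "insert s S0 \<subseteq> N'" for N'
  proof
    fix x assume x: "x \<in> N"
    then obtain g where g: "g \<in> \<O>" "x a / w a = g * j" using j(2) by blast
    then have xa: "x a = g * s a" using s(2) w_nz by simp
    let ?y = "\<lambda>b. x b + (- g) * s b"
    have "?y \<in> ?N0" using N(3)[OF x N(4)[OF O_uminus[OF g(1)] s(1)]] xa by simp
    moreover have "?N0 \<subseteq> N'" using S0(3) N' by simp
    ultimately have "?y \<in> N'" by (rule rev_subsetD)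
    moreover have "(\<lambda>b. g * s b) \<in> N'" using N'(2) by (intro submodD(4)[OF N'(1) g(1)]) auto
    ultimately have "(\<lambda>b. ?y b + g * s b) \<in> N'" by (rule submodD(3)[OF N'(1)])
    then show "x \<in> N'" by simp
  qed
  then show ?case using S0(1,2) s(1) by (intro exI[of _ "insert s S0"]) auto
qed

lemma submod_fin_gen:
  assumes "submod N"
  obtains S where "S \<subseteq> N" "finite S" "\<And>N'. submod N' \<Longrightarrow> S \<subseteq> N' \<Longrightarrow> N \<subseteq> N'"
proof -
  have "\<exists>S\<subseteq>N. finite S \<and> (\<forall>N'. submod N' \<and> S \<subseteq> N' \<longrightarrow> N \<subseteq> N')"
    by (rule submod_fin_gen_supported[OF finite[of UNIV] assms]) simp
  then show thesis
  proof (elim exE conjE)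
    fix S assume S: "S \<subseteq> N" "finite S" "\<forall>N'. submod N' \<and> S \<subseteq> N' \<longrightarrow> N \<subseteq> N'"
    show thesis by (rule that[OF S(1,2)]) (simp add: S(3))
  qed
qed

lemma ideal_imp_submod:
  assumes "ideal I R" shows "submod I"
proof -
  interpret I: ideal I R by fact
  show ?thesis unfolding submod_def using I.a_subset I.I_l_closed by auto
qed

lemma noetherian_R: "noetherian_ring R"
proof (rule R.noetherian_ringI)
  fix I assume I: "ideal I R"
  obtain S where S: "S \<subseteq> I" "finite S" "\<And>N'. submod N' \<Longrightarrow> S \<subseteq> N' \<Longrightarrow> I \<subseteq> N'"
    using submod_fin_gen[OF ideal_imp_submod[OF I]] by blast
  have Sc: "S \<subseteq> carrier R" using S(1) submodD(1)[OF ideal_imp_submod[OF I]] by blast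
  have "I \<subseteq> Idl\<^bsub>R\<^esub> S"
    using S(3)[OF ideal_imp_submod[OF R.genideal_ideal[OF Sc]]] R.genideal_self[OF Sc] by blast
  moreover have "Idl\<^bsub>R\<^esub> S \<subseteq> I" using R.genideal_minimal[OF I S(1)] .
  ultimately show "\<exists>A\<subseteq>carrier R. finite A \<and> I = Idl\<^bsub>R\<^esub> A" using S(2) Sc by blast
qed

lemma generated_by_W:
  assumes sub: "\<And>x y. x \<in> P \<Longrightarrow> y \<in> P \<Longrightarrow> x \<oplus>\<^bsub>R\<^esub> y \<in> P" "\<zero>\<^bsub>R\<^esub> \<in> P"
    and W: "\<And>a g. g \<in> \<O> \<Longrightarrow> W a g \<in> P" and x: "x \<in> carrier R"
  shows "x \<in> P"
proof -
  have "finite A \<Longrightarrow> (\<lambda>a. if a \<in> A then x a else 0) \<in> P" for A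
  proof (induct A rule: finite_induct)
    case empty
    then show ?case using sub(2) by (simp add: zero_R)
  next
    case (insert a A)
    have "W a (x a / w a) \<in> P" using x carrier_R by (intro W) auto
    then have "W a (x a / w a) \<oplus>\<^bsub>R\<^esub> (\<lambda>a. if a \<in> A then x a else 0) \<in> P"
      using insert sub(1) by blast
    moreover have "W a (x a / w a) \<oplus>\<^bsub>R\<^esub> (\<lambda>a. if a \<in> A then x a else 0) =
        (\<lambda>b. if b \<in> insert a A then x b else 0)"
      unfolding add_R W_def using insert(2) w_nz by auto
    ultimately show ?case by simp
  qed
  from this[of UNIV] show ?thesis by simp
qed

lemma W_eq_scal: "W a g = scal g \<otimes>\<^bsub>R\<^esub> W a 1"
  unfolding scal_mult by (auto simp: W_def)

lemma fin_gen_R: "fin_gen_algebra R"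
  unfolding fin_gen_algebra_def
proof (intro exI conjI)
  \<comment> \<open>The images of X and of the inverse of \<open>h\<close> generate
    \<open>\<O>\<close> over the constants, and the elements \<open>W a 1\<close> generate
    \<open>R\<close> over \<open>\<O>\<close>.\<close>
  let ?S = "insert (scal (\<psi> [:0, 1:])) (insert (scal (1 / \<psi> h)) (range (\<lambda>a. W a 1)))"
  let ?C = "{c \<odot>\<^bsub>R\<^esub> \<one>\<^bsub>R\<^esub> |c. True}"
  let ?G = "generate_ring R (?S \<union> ?C)"
  have h: "1 / \<psi> h \<in> \<O>" using O_I[of 1 1] by (simp add: psi_1)
  show S: "?S \<subseteq> carrier R" using h by auto
  show "finite ?S" by simp
  have const: "c \<odot>\<^bsub>R\<^esub> \<one>\<^bsub>R\<^esub> = scal (\<psi> [:c:])" for c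
    unfolding smult_eq_scal by (rule R.r_one) auto
  have C: "?C \<subseteq> carrier R" unfolding const by auto
  note G = generate_ring.intros[where R = R and H = "?S \<union> ?C"]
  have sub: "?G \<subseteq> carrier R" using S C by (intro R.generate_ring_incl) auto
  have psi: "scal (\<psi> p) \<in> ?G" for p
  proof (induct p)
    case 0
    then show ?case using R.zero_in_generate by (simp add: scal_0)
  next
    case (pCons c p)
    have "c \<odot>\<^bsub>R\<^esub> \<one>\<^bsub>R\<^esub> \<in> ?G" by (intro G(2)) blast
    then have "scal (\<psi> [:c:]) \<in> ?G" unfolding const .
    moreover have "scal (\<psi> [:0, 1:]) \<in> ?G" by (intro G(2)) auto
    moreover have "\<psi> (pCons c p) = \<psi> [:c:] + \<psi> [:0, 1:] * \<psi> p"
      by (simp flip: psi_add psi_mult)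
    ultimately show ?case using pCons(2) by (simp only: scal_add scal_times G(4) G(5))
  qed
  have "scal ((1 / \<psi> h) ^ n) \<in> ?G" for n
  proof (induct n)
    case 0
    then show ?case using G(1) by (simp add: scal_1)
  next
    case (Suc n)
    have "scal (1 / \<psi> h) \<in> ?G" by (intro G(2)) auto
    then show ?case using Suc by (simp only: power_Suc scal_times G)
  qed
  note h_power = this
  have scal: "scal g \<in> ?G" if g: "g \<in> \<O>" for g
  proof -
    obtain p n where "g = \<psi> p / \<psi> h ^ n" using g by (rule O_cases)
    then have "g = \<psi> p * (1 / \<psi> h) ^ n"
      by (simp only: power_one_over times_divide_eq_right mult_1_right)
    then show ?thesis by (simp only: scal_times G(5) psi h_power)
  qed
  have "W a g \<in> ?G" if "g \<in> \<O>" for a g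
  proof -
    have "W a 1 \<in> ?G" by (intro G(2)) auto
    then show ?thesis using scal[OF that] unfolding W_eq_scal[of a g] by (intro G(5))
  qed
  then have "carrier R \<subseteq> ?G"
    using generated_by_W[of ?G] R.zero_in_generate G(4) by blast
  then show "?G = carrier R" using sub by blast
qed

section \<open>Horner evaluation of complex polynomials at elements of the algebra\<close>

definition pe where
  "pe y p = fold_coeffs (\<lambda>c x. scal (\<psi> [:c:]) \<oplus>\<^bsub>R\<^esub> y \<otimes>\<^bsub>R\<^esub> x) p \<zero>\<^bsub>R\<^esub>"

lemma pe_0: "pe y 0 = \<zero>\<^bsub>R\<^esub>"
  unfolding pe_def by simp

lemma pe_pCons:
  assumes "y \<in> carrier R"
  shows "pe y (pCons c p) = scal (\<psi> [:c:]) \<oplus>\<^bsub>R\<^esub> y \<otimes>\<^bsub>R\<^esub> pe y p"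
proof (cases "p = 0 \<and> c = 0")
  case True
  then show ?thesis using assms by (simp add: pe_0 scal_0)
next
  case False
  then show ?thesis unfolding pe_def
    by (cases "c = 0") (simp_all add: fold_coeffs_pCons_coeff_not_0_eq fold_coeffs_pCons_not_0_0_eq)
qed

lemma pe_closed: "y \<in> carrier R \<Longrightarrow> pe y p \<in> carrier R"
  by (induct p) (auto simp: pe_0 pe_pCons)

lemma pe_add:
  assumes y: "y \<in> carrier R"
  shows "pe y (p + q) = pe y p \<oplus>\<^bsub>R\<^esub> pe y q"
proof (induct p q rule: poly_induct2)
  case (pCons a p b q)
  then show ?case
    using y pe_closed[OF y, of p] pe_closed[OF y, of q]
    by (simp add: pe_pCons psi_const_add scal_add R.r_distr R.a_ac)
qed (simp add: pe_0)

lemma pe_smult: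
  assumes y: "y \<in> carrier R"
  shows "pe y (smult c p) = scal (\<psi> [:c:]) \<otimes>\<^bsub>R\<^esub> pe y p"
proof (induct p)
  case (pCons a p)
  then show ?case
    using y pe_closed[OF y, of p]
    by (simp add: pe_pCons psi_const_mult scal_times R.r_distr R.m_ac)
qed (simp add: pe_0)

lemma pe_mult_linear:
  assumes y: "y \<in> carrier R"
  shows "pe y ([:- c, 1:] * p) = (y \<ominus>\<^bsub>R\<^esub> scal (\<psi> [:c:])) \<otimes>\<^bsub>R\<^esub> pe y p"
proof -
  have "scal (\<psi> [:- c:]) \<oplus>\<^bsub>R\<^esub> scal (\<psi> [:c:]) = \<zero>\<^bsub>R\<^esub>"
    by (simp flip: scal_add psi_add add: scal_0)
  then have neg: "scal (\<psi> [:- c:]) = \<ominus>\<^bsub>R\<^esub> scal (\<psi> [:c:])"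
    by (intro R.minus_equality[symmetric]) auto
  have "[:- c, 1:] * p = smult (- c) p + pCons 0 p" by simp
  then show ?thesis
    using y pe_closed[OF y, of p]
    by (simp only: pe_add pe_smult pe_pCons neg)
      (simp add: scal_0 R.minus_eq R.l_distr R.l_minus R.a_comm)
qed

lemma pe_scal_X: "pe (scal (\<psi> [:0, 1:])) p = scal (\<psi> p)"
proof (induct p)
  case (pCons a p)
  have "\<psi> (pCons a p) = \<psi> [:a:] + \<psi> [:0, 1:] * \<psi> p"
    by (simp flip: psi_add psi_mult)
  then show ?case using pCons by (simp add: pe_pCons psi_in_O scal_add scal_times)
qed (simp add: pe_0 scal_0)

text \<open>A complex polynomial splits into linear factors, and the prime ideal must contain one of
  the factors evaluated at \<open>y\<close>: the nonzero constant factor becomes a unit of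
  \<open>R\<close>. Both the point below \<open>m\<close> and the values of the character are
  obtained in this way.\<close>

lemma root_of_pe_mem:
  assumes m: "primeideal m R" and y: "y \<in> carrier R"
  shows "p \<noteq> 0 \<Longrightarrow> pe y p \<in> m \<Longrightarrow> \<exists>c. y \<ominus>\<^bsub>R\<^esub> scal (\<psi> [:c:]) \<in> m"
proof (induct "degree p" arbitrary: p)
  case 0
  interpret m: primeideal m R by fact
  obtain c where c: "p = [:c:]" using 0(1) degree_eq_zeroE by metis
  then have c0: "c \<noteq> 0" using 0(2) by simp
  have "pe y p = scal (\<psi> [:c:])" unfolding c using y by (simp add: pe_pCons pe_0)
  then have "scal (\<psi> [:inverse c:]) \<otimes>\<^bsub>R\<^esub> scal (\<psi> [:c:]) \<in> m"
    using 0(3) by (intro m.I_l_closed) auto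
  then have "\<one>\<^bsub>R\<^esub> \<in> m"
    using c0 by (simp flip: scal_times psi_const_mult add: psi_1 scal_1 one_pCons[symmetric])
  then show ?case using m.I_notcarr m.one_imp_carrier by blast
next
  case (Suc n)
  interpret m: primeideal m R by fact
  have "\<not> constant (poly p)" using Suc(2) by (simp add: constant_degree)
  then obtain c where "poly p c = 0" using fundamental_theorem_of_algebra by blast
  then obtain q where q: "p = [:- c, 1:] * q" unfolding poly_eq_0_iff_dvd by blast
  then have q0: "q \<noteq> 0" using Suc(3) by auto
  then have "degree p = Suc (degree q)" unfolding q by (subst degree_mult_eq) auto
  then have deg: "n = degree q" using Suc(2) by simp
  have "(y \<ominus>\<^bsub>R\<^esub> scal (\<psi> [:c:])) \<otimes>\<^bsub>R\<^esub> pe y q \<in> m"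
    using Suc(4) unfolding q pe_mult_linear[OF y] .
  then have "y \<ominus>\<^bsub>R\<^esub> scal (\<psi> [:c:]) \<in> m \<or> pe y q \<in> m"
    using y pe_closed[OF y] by (intro m.I_prime) auto
  then show ?case using Suc(1)[OF deg q0] by blast
qed

text \<open>The \<open>\<O>\<close>-span of the powers of \<open>y\<close> up to exponent
  \<open>n\<close>, in Horner form so that inductions peel off one factor \<open>y\<close> at a
  time.\<close>

primrec powspan where
  "powspan y 0 = {scal g |g. g \<in> \<O>}"
| "powspan y (Suc n) = {scal g \<oplus>\<^bsub>R\<^esub> y \<otimes>\<^bsub>R\<^esub> z |g z. g \<in> \<O> \<and> z \<in> powspan y n}"

lemma powspan_submod:
  assumes y: "y \<in> carrier R"
  shows "submod (powspan y n)"
proof (induct n)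
  case 0
  show ?case unfolding submod_def powspan.simps
    by (force simp flip: scal_add scal_times scal_0)
next
  case (Suc n)
  note N = Suc[unfolded submod_def]
  show ?case unfolding submod_def
  proof (intro conjI ballI)
    show "powspan y (Suc n) \<subseteq> carrier R" using N y by auto
    have "\<zero>\<^bsub>R\<^esub> = scal 0 \<oplus>\<^bsub>R\<^esub> y \<otimes>\<^bsub>R\<^esub> \<zero>\<^bsub>R\<^esub>" using y by (simp add: scal_0)
    then show "\<zero>\<^bsub>R\<^esub> \<in> powspan y (Suc n)" using N by fastforce
    fix x x' assume "x \<in> powspan y (Suc n)" "x' \<in> powspan y (Suc n)"
    then obtain g z g' z' where x: "x = scal g \<oplus>\<^bsub>R\<^esub> y \<otimes>\<^bsub>R\<^esub> z" "g \<in> \<O>" "z \<in> powspan y n"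
      and x': "x' = scal g' \<oplus>\<^bsub>R\<^esub> y \<otimes>\<^bsub>R\<^esub> z'" "g' \<in> \<O>" "z' \<in> powspan y n"
      by auto
    have cl: "z \<in> carrier R" "z' \<in> carrier R" using x x' N by auto
    have "x \<oplus>\<^bsub>R\<^esub> x' = scal (g + g') \<oplus>\<^bsub>R\<^esub> y \<otimes>\<^bsub>R\<^esub> (z \<oplus>\<^bsub>R\<^esub> z')"
      unfolding x(1) x'(1) scal_add using x(2) x'(2) cl y by (simp add: R.r_distr R.a_ac)
    moreover have "z \<oplus>\<^bsub>R\<^esub> z' \<in> powspan y n" using x x' N by auto
    ultimately show "x \<oplus>\<^bsub>R\<^esub> x' \<in> powspan y (Suc n)" using x x' by auto
  next
    fix k x assume k: "k \<in> \<O>" and "x \<in> powspan y (Suc n)"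
    then obtain g z where x: "x = scal g \<oplus>\<^bsub>R\<^esub> y \<otimes>\<^bsub>R\<^esub> z" "g \<in> \<O>" "z \<in> powspan y n"
      by auto
    have cl: "z \<in> carrier R" using x N by auto
    have "scal k \<otimes>\<^bsub>R\<^esub> x = scal (k * g) \<oplus>\<^bsub>R\<^esub> y \<otimes>\<^bsub>R\<^esub> (scal k \<otimes>\<^bsub>R\<^esub> z)"
      unfolding x(1) scal_times using x(2) cl y k by (simp add: R.r_distr R.m_ac)
    moreover have "scal k \<otimes>\<^bsub>R\<^esub> z \<in> powspan y n" using x k N by auto
    ultimately show "scal k \<otimes>\<^bsub>R\<^esub> x \<in> powspan y (Suc n)" using x k by auto
  qed
qed

lemma powspan_Suc_subset:
  assumes y: "y \<in> carrier R"
  shows "powspan y n \<subseteq> powspan y (Suc n)"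
proof (induct n)
  case 0
  have "scal g = scal g \<oplus>\<^bsub>R\<^esub> y \<otimes>\<^bsub>R\<^esub> scal 0" if "g \<in> \<O>" for g
    using y that by (simp add: scal_0)
  then show ?case by fastforce
next
  case (Suc n)
  then show ?case by fastforce
qed

lemma power_mem_powspan:
  assumes y: "y \<in> carrier R"
  shows "y [^]\<^bsub>R\<^esub> n \<in> powspan y n"
proof (induct n)
  case 0
  have "scal 1 \<in> powspan y 0" by auto
  then show ?case by (simp add: scal_1)
next
  case (Suc n)
  have "y [^]\<^bsub>R\<^esub> Suc n = scal 0 \<oplus>\<^bsub>R\<^esub> y \<otimes>\<^bsub>R\<^esub> y [^]\<^bsub>R\<^esub> n"
    using y by (simp add: scal_0 R.m_comm)
  then show ?case using Suc by auto
qed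

text \<open>The union of the increasing submodules \<open>powspan y n\<close> is finitely generated,
  hence equal to one of them, and that one contains the next power of \<open>y\<close>.\<close>

lemma integral:
  assumes y: "y \<in> carrier R"
  obtains n where "y [^]\<^bsub>R\<^esub> Suc n \<in> powspan y n"
proof -
  let ?N = "\<Union>n. powspan y n"
  have mono: "powspan y i \<subseteq> powspan y j" if "i \<le> j" for i j
    using powspan_Suc_subset[OF y] that by (rule lift_Suc_mono_le)
  have sub: "submod ?N"
    unfolding submod_def
  proof (intro conjI ballI)
    show "?N \<subseteq> carrier R" using powspan_submod[OF y] unfolding submod_def by blast
    show "\<zero>\<^bsub>R\<^esub> \<in> ?N" using powspan_submod[OF y, of 0] unfolding submod_def by blast
    fix x x' assume "x \<in> ?N" "x' \<in> ?N"
    then obtain i j where "x \<in> powspan y i" "x' \<in> powspan y j" by blast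
    then have "x \<in> powspan y (max i j)" "x' \<in> powspan y (max i j)"
      using mono[of i "max i j"] mono[of j "max i j"] by auto
    then show "x \<oplus>\<^bsub>R\<^esub> x' \<in> ?N" using powspan_submod[OF y, of "max i j"] unfolding submod_def by blast
  next
    fix g x assume "g \<in> \<O>" "x \<in> ?N"
    then show "scal g \<otimes>\<^bsub>R\<^esub> x \<in> ?N" using powspan_submod[OF y] unfolding submod_def by blast
  qed
  obtain S where S: "S \<subseteq> ?N" "finite S" "\<And>N'. submod N' \<Longrightarrow> S \<subseteq> N' \<Longrightarrow> ?N \<subseteq> N'"
    using submod_fin_gen[OF sub] by blast
  have "\<exists>n. S \<subseteq> powspan y n"
    using S(2,1)
  proof (induct S)
    case (insert s S)
    then obtain i j where "S \<subseteq> powspan y i" "s \<in> powspan y j" by blast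
    then have "insert s S \<subseteq> powspan y (max i j)"
      using mono[of i "max i j"] mono[of j "max i j"] by auto
    then show ?case by blast
  qed simp
  then obtain n where "S \<subseteq> powspan y n" by blast
  then have "?N \<subseteq> powspan y n" by (rule S(3)[OF powspan_submod[OF y]])
  then show thesis using that[of n] power_mem_powspan[OF y, of "Suc n"] by blast
qed

end

section \<open>Regularity of the algebra\<close>

locale graded_cover_point = graded_cover \<psi> h c0 w f fr
  for \<psi> :: "complex poly \<Rightarrow> 'k::field" and h c0
    and w :: "'g::{ab_group_add, finite} \<Rightarrow> 'k" and f fr +
  fixes m
  assumes max: "maximalideal m R"
begin

section \<open>The residue field at a maximal ideal\<close>

sublocale m: maximalideal m R by (rule max)

abbreviation K where "K \<equiv> R Quot m"

sublocale K: field K by (rule m.quotient_is_field[OF cring_R])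

definition \<pi> where "\<pi> x = m +>\<^bsub>R\<^esub> x"

sublocale pi: ring_hom_ring R K \<pi>
  unfolding \<pi>_def by (rule m.rcos_ring_hom_ring)

lemma prime_m: "primeideal m R"
  by (rule R.maximalideal_prime[OF max])

lemma pi_eq_0_iff: "x \<in> carrier R \<Longrightarrow> \<pi> x = \<zero>\<^bsub>K\<^esub> \<longleftrightarrow> x \<in> m"
  unfolding \<pi>_def FactRing_def
  using m.rcos_const_imp_mem R.a_rcos_zero[OF m.is_ideal] by auto

lemma pi_surj:
  assumes "X \<in> carrier K"
  obtains x where "x \<in> carrier R" "X = \<pi> x"
  using assms unfolding FactRing_def A_RCOSETS_def' \<pi>_def by auto

lemma K_add_eq_0: "a \<in> carrier K \<Longrightarrow> b \<in> carrier K \<Longrightarrow> a \<oplus>\<^bsub>K\<^esub> b = b \<Longrightarrow> a = \<zero>\<^bsub>K\<^esub>"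
  using K.add.r_cancel_one by blast

lemma one_notin_m: "\<one>\<^bsub>R\<^esub> \<notin> m"
  using m.I_notcarr m.one_imp_carrier by blast

lemma scal_unit_notin_m:
  assumes "g \<in> \<O>" "g' \<in> \<O>" "g * g' = 1"
  shows "scal g \<notin> m"
proof
  assume "scal g \<in> m"
  then have "scal g \<otimes>\<^bsub>R\<^esub> scal g' \<in> m" using assms(2) by (intro m.I_r_closed) auto
  then show False using one_notin_m assms(3) by (simp add: scal_1 flip: scal_times)
qed

text \<open>Multiplying by a power of \<open>h\<close> puts the image of a nonzero polynomial in X
  into \<open>m\<close>, hence also the image of one of its linear factors.\<close>

lemma point_if_scal_mem:
  assumes "g \<in> \<O>" "g \<noteq> 0" "scal g \<in> m"
  shows "\<exists>c. scal (\<psi> [:- c, 1:]) \<in> m"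
proof -
  obtain p n where p: "p \<noteq> 0" "\<psi> p = \<psi> h ^ n * g"
    using O_clear_denominator assms by blast
  have "\<psi> h ^ n \<in> \<O>" using psi_in_O[of "h ^ n"] by (simp add: psi_power)
  then have "scal (\<psi> p) \<in> m" unfolding p(2) scal_times using assms by (intro m.I_l_closed) auto
  then have "pe (scal (\<psi> [:0, 1:])) p \<in> m" by (simp add: pe_scal_X)
  then obtain c where c: "scal (\<psi> [:0, 1:]) \<ominus>\<^bsub>R\<^esub> scal (\<psi> [:c:]) \<in> m"
    using root_of_pe_mem[OF prime_m scal_psi_closed p(1)] by blast
  have "scal (\<psi> [:- c, 1:]) \<oplus>\<^bsub>R\<^esub> scal (\<psi> [:c:]) = scal (\<psi> [:0, 1:])"
    by (simp flip: scal_add psi_add)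
  then have "scal (\<psi> [:- c, 1:]) = scal (\<psi> [:0, 1:]) \<ominus>\<^bsub>R\<^esub> scal (\<psi> [:c:])"
    by (metis R.add.inv_solve_right' R.minus_eq scal_psi_closed)
  then show ?thesis using c by metis
qed

text \<open>Otherwise \<open>t = X - c0\<close> has an inverse \<open>y\<close> modulo \<open>m\<close>. Multiplying an integral equation
  for \<open>y\<close> by a power of \<open>t\<close> shows that \<open>m\<close> contains an element \<open>1 - t g\<close> of the coordinate ring,
  which is not zero because \<open>t\<close> vanishes at \<open>c0\<close>.\<close>

lemma exists_point: "\<exists>c. scal (\<psi> [:- c, 1:]) \<in> m"
proof (cases "scal (\<psi> [:- c0, 1:]) \<in> m")
  case False
  define t where "t = \<psi> [:- c0, 1:]"
  define P where "P = \<pi> (scal t)"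
  have t: "t \<in> \<O>" unfolding t_def by auto
  have tk: "t ^ k \<in> \<O>" for k by (induct k) (auto intro: t)
  have Pc: "P \<in> carrier K" unfolding P_def using t by auto
  have "P \<noteq> \<zero>\<^bsub>K\<^esub>" using False pi_eq_0_iff[of "scal t"] t unfolding P_def t_def by simp
  then have "P \<in> Units K" using Pc K.field_Units by simp
  then have "inv\<^bsub>K\<^esub> P \<in> carrier K" "P \<otimes>\<^bsub>K\<^esub> inv\<^bsub>K\<^esub> P = \<one>\<^bsub>K\<^esub>" by auto
  then obtain y where y: "y \<in> carrier R" "P \<otimes>\<^bsub>K\<^esub> \<pi> y = \<one>\<^bsub>K\<^esub>" using pi_surj by metis
  have yc: "\<pi> y \<in> carrier K" using y by simp
  have P_power: "P [^]\<^bsub>K\<^esub> k = \<pi> (scal (t ^ k))" for k :: nat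
  proof (induct k)
    case (Suc k)
    have "scal (t ^ Suc k) = scal (t ^ k) \<otimes>\<^bsub>R\<^esub> scal t"
      by (simp add: mult.commute flip: scal_times)
    then show ?case using Suc t tk by (simp add: P_def)
  qed (simp add: scal_1)
  have one: "P [^]\<^bsub>K\<^esub> k \<otimes>\<^bsub>K\<^esub> \<pi> (y [^]\<^bsub>R\<^esub> k) = \<one>\<^bsub>K\<^esub>" for k :: nat
  proof (induct k)
    case (Suc k)
    have "P [^]\<^bsub>K\<^esub> Suc k \<otimes>\<^bsub>K\<^esub> \<pi> (y [^]\<^bsub>R\<^esub> Suc k) =
        (P [^]\<^bsub>K\<^esub> k \<otimes>\<^bsub>K\<^esub> \<pi> (y [^]\<^bsub>R\<^esub> k)) \<otimes>\<^bsub>K\<^esub> (P \<otimes>\<^bsub>K\<^esub> \<pi> y)"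
      using Pc y(1) by (simp add: K.m_ac)
    then show ?case using Suc y by simp
  qed simp
  \<comment> \<open>The exponent exceeds the highest power of \<open>y\<close> in
    \<open>powspan y n\<close> by one, so after cancelling each \<open>y\<close> against a
    \<open>t\<close> every term keeps at least one factor \<open>t\<close>.\<close>
  have span: "\<exists>g\<in>\<O>. P [^]\<^bsub>K\<^esub> Suc n \<otimes>\<^bsub>K\<^esub> \<pi> z = \<pi> (scal (t * g))" if "z \<in> powspan y n" for z n
    using that
  proof (induct n arbitrary: z)
    case 0
    then obtain g where g: "z = scal g" "g \<in> \<O>" by auto
    then have "P [^]\<^bsub>K\<^esub> Suc 0 \<otimes>\<^bsub>K\<^esub> \<pi> z = \<pi> (scal (t * g))"
      using t by (simp add: scal_times P_def)
    then show ?case using g by blast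
  next
    case (Suc n)
    then obtain g z' where z: "z = scal g \<oplus>\<^bsub>R\<^esub> y \<otimes>\<^bsub>R\<^esub> z'" "g \<in> \<O>" "z' \<in> powspan y n" by auto
    have z'c: "z' \<in> carrier R" using z(3) powspan_submod[OF y(1)] unfolding submod_def by blast
    obtain g' where g': "g' \<in> \<O>" "P [^]\<^bsub>K\<^esub> Suc n \<otimes>\<^bsub>K\<^esub> \<pi> z' = \<pi> (scal (t * g'))"
      using Suc(1)[OF z(3)] by blast
    have "P [^]\<^bsub>K\<^esub> Suc (Suc n) \<otimes>\<^bsub>K\<^esub> \<pi> z =
        P [^]\<^bsub>K\<^esub> Suc (Suc n) \<otimes>\<^bsub>K\<^esub> \<pi> (scal g) \<oplus>\<^bsub>K\<^esub>
        P [^]\<^bsub>K\<^esub> Suc (Suc n) \<otimes>\<^bsub>K\<^esub> (\<pi> y \<otimes>\<^bsub>K\<^esub> \<pi> z')"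
      unfolding z(1) using z(2) z'c y Pc by (simp add: K.r_distr)
    also have "P [^]\<^bsub>K\<^esub> Suc (Suc n) \<otimes>\<^bsub>K\<^esub> (\<pi> y \<otimes>\<^bsub>K\<^esub> \<pi> z') =
        (P \<otimes>\<^bsub>K\<^esub> \<pi> y) \<otimes>\<^bsub>K\<^esub> (P [^]\<^bsub>K\<^esub> Suc n \<otimes>\<^bsub>K\<^esub> \<pi> z')"
      using z'c yc Pc by (simp add: K.m_ac)
    also have "\<dots> = \<pi> (scal (t * g'))" unfolding y(2) g'(2) using t g'(1) by (intro K.l_one pi.hom_closed scal_closed O_mult)
    also have "P [^]\<^bsub>K\<^esub> Suc (Suc n) \<otimes>\<^bsub>K\<^esub> \<pi> (scal g) = \<pi> (scal (t ^ Suc (Suc n) * g))"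
      unfolding P_power scal_times by (intro pi.hom_mult[symmetric] scal_closed tk z(2))
    also have "\<pi> (scal (t ^ Suc (Suc n) * g)) \<oplus>\<^bsub>K\<^esub> \<pi> (scal (t * g')) =
        \<pi> (scal (t ^ Suc (Suc n) * g + t * g'))"
      unfolding scal_add using tk[of "Suc (Suc n)"] t z(2) g'(1) by (intro pi.hom_add[symmetric]) blast+
    also have "t ^ Suc (Suc n) * g + t * g' = t * (t ^ Suc n * g + g')" by (simp add: algebra_simps)
    finally show ?case using tk[of "Suc n"] z(2) g'(1) by blast
  qed
  obtain n where "y [^]\<^bsub>R\<^esub> Suc n \<in> powspan y n" using integral[OF y(1)] .
  from span[OF this] obtain g where g: "g \<in> \<O>" "\<one>\<^bsub>K\<^esub> = \<pi> (scal (t * g))"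
    unfolding one by blast
  have tg: "t * g \<in> \<O>" "1 - t * g \<in> \<O>" using t g(1) by auto
  have "\<pi> (scal (1 - t * g)) \<oplus>\<^bsub>K\<^esub> \<pi> (scal (t * g)) = \<pi> (scal (1 - t * g + t * g))"
    unfolding scal_add using tg by (intro pi.hom_add[symmetric]) auto
  also have "\<dots> = \<pi> (scal (t * g))" using g(2) by (simp add: scal_1)
  finally have "\<pi> (scal (1 - t * g)) = \<zero>\<^bsub>K\<^esub>" using tg by (intro K_add_eq_0) auto
  then have "scal (1 - t * g) \<in> m" using pi_eq_0_iff tg by simp
  moreover have "1 - t * g \<noteq> 0"
  proof
    assume "1 - t * g = 0"
    then have "ev c0 (t * g) = 1" using h_c0 by simp
    moreover have "ev c0 t = 0" unfolding t_def using h_c0 by (simp add: ev_psi)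
    ultimately show False using ev_mult[OF h_c0 t g(1)] by simp
  qed
  ultimately show ?thesis using point_if_scal_mem tg(2) by blast
qed blast

section \<open>The point of the line below the maximal ideal\<close>

definition pt where "pt = (SOME c. scal (\<psi> [:- c, 1:]) \<in> m)"

lemma pt_mem: "scal (\<psi> [:- pt, 1:]) \<in> m"
  unfolding pt_def using exists_point by (rule someI_ex)

text \<open>At a root of \<open>h\<close> the function X - \<open>pt\<close> would divide
  \<open>h\<close> and be a unit of \<open>\<O>\<close>, but its image lies in
  \<open>m\<close>.\<close>

lemma h_pt: "poly h pt \<noteq> 0"
proof
  assume "poly h pt = 0"
  then obtain q where q: "h = [:- pt, 1:] * q" unfolding poly_eq_0_iff_dvd by blast
  have "\<psi> [:- pt, 1:] * \<psi> q = \<psi> h" unfolding q by (rule psi_mult[symmetric])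
  then have "\<psi> [:- pt, 1:] * (\<psi> q / \<psi> h) = 1" using psi_h by (metis times_divide_eq_right divide_self)
  moreover have "\<psi> q / \<psi> h \<in> \<O>" using O_I[of q 1] by simp
  ultimately show False using scal_unit_notin_m[OF psi_in_O] pt_mem by blast
qed

text \<open>The difference of \<open>g\<close> and its value at \<open>pt\<close> is divisible by X
  - \<open>pt\<close>, whose image lies in \<open>m\<close>.\<close>

lemma pi_scal:
  assumes g: "g \<in> \<O>"
  shows "\<pi> (scal g) = \<pi> (scal (\<psi> [:ev pt g:]))"
proof -
  let ?d = "g - \<psi> [:ev pt g:]"
  have d: "?d \<in> \<O>" using g by auto
  have "ev pt g = ev pt (?d + \<psi> [:ev pt g:])" by simp
  also have "\<dots> = ev pt ?d + ev pt g"
    using ev_add[OF h_pt d psi_in_O[of "[:ev pt g:]"]] ev_psi[OF h_pt, of "[:ev pt g:]"] by simp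
  finally have "ev pt ?d = 0" by simp
  then obtain g' where g': "g' \<in> \<O>" "?d = \<psi> [:- pt, 1:] * g'" using ev_eq_0D[OF h_pt d] by metis
  have "scal ?d \<in> m" unfolding g'(2) scal_times using g'(1) pt_mem by (intro m.I_r_closed) auto
  then have "\<pi> (scal ?d) = \<zero>\<^bsub>K\<^esub>" using pi_eq_0_iff d by simp
  moreover have "\<pi> (scal g) = \<pi> (scal ?d) \<oplus>\<^bsub>K\<^esub> \<pi> (scal (\<psi> [:ev pt g:]))"
    using d by (subst pi.hom_add[symmetric]) (auto simp flip: scal_add)
  ultimately show ?thesis by simp
qed

lemma powspan_pe:
  assumes y: "y \<in> carrier R" and "z \<in> powspan y n"
  shows "\<exists>p. degree p \<le> n \<and> \<pi> z = \<pi> (pe y p)"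
  using assms(2)
proof (induct n arbitrary: z)
  case 0
  then obtain g where g: "z = scal g" "g \<in> \<O>" by auto
  have "pe y [:ev pt g:] = scal (\<psi> [:ev pt g:])" using y by (simp add: pe_pCons pe_0)
  then show ?case using g pi_scal by (intro exI[of _ "[:ev pt g:]"]) simp
next
  case (Suc n)
  then obtain g z' where z: "z = scal g \<oplus>\<^bsub>R\<^esub> y \<otimes>\<^bsub>R\<^esub> z'" "g \<in> \<O>" "z' \<in> powspan y n" by auto
  have z'c: "z' \<in> carrier R" using z(3) powspan_submod[OF y(1)] unfolding submod_def by blast
  obtain p where p: "degree p \<le> n" "\<pi> z' = \<pi> (pe y p)" using Suc(1)[OF z(3)] by blast
  have "\<pi> z = \<pi> (scal g) \<oplus>\<^bsub>K\<^esub> \<pi> y \<otimes>\<^bsub>K\<^esub> \<pi> z'" unfolding z(1) using y z(2) z'c by simp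
  also have "\<dots> = \<pi> (pe y (pCons (ev pt g) p))"
    unfolding pi_scal[OF z(2)] p(2) pe_pCons[OF y] using y pe_closed[OF y] by simp
  finally show ?case using p(1) degree_pCons_le[of "ev pt g" p] by (meson Suc_le_mono le_trans)
qed

text \<open>Modulo \<open>m\<close> the functions in \<open>\<O>\<close> are constants, so an
  integral equation for \<open>y\<close> becomes a polynomial equation over C. The bound on the
  degree of \<open>p\<close> keeps the leading term of \<open>?q - p\<close>, and
  \<open>root_of_pe_mem\<close> supplies the value.\<close>

lemma exists_value:
  assumes y: "y \<in> carrier R"
  shows "\<exists>c. \<pi> y = \<pi> (scal (\<psi> [:c:]))"
proof -
  obtain n where "y [^]\<^bsub>R\<^esub> Suc n \<in> powspan y n" using integral[OF y] .
  from powspan_pe[OF y this] obtain p where p: "degree p \<le> n" "\<pi> (y [^]\<^bsub>R\<^esub> Suc n) = \<pi> (pe y p)"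
    by blast
  let ?q = "monom 1 (Suc n) :: complex poly"
  have "pe y [:1:] = scal (\<psi> [:1:]) \<oplus>\<^bsub>R\<^esub> y \<otimes>\<^bsub>R\<^esub> pe y 0" by (rule pe_pCons[OF y])
  also have "\<dots> = \<one>\<^bsub>R\<^esub>" unfolding pe_0 one_pCons[symmetric] psi_1 scal_1 using y by simp
  finally have q: "pe y (monom 1 k) = y [^]\<^bsub>R\<^esub> k" for k
    by (induct k) (use y in \<open>simp_all add: monom_0 monom_Suc pe_pCons scal_0 R.m_comm flip: one_pCons\<close>)
  have "\<pi> (pe y (?q - p)) \<oplus>\<^bsub>K\<^esub> \<pi> (pe y p) = \<pi> (pe y ?q)"
    using pe_add[OF y, of "?q - p" p] pe_closed[OF y] by (simp flip: pi.hom_add)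
  then have "\<pi> (pe y (?q - p)) = \<zero>\<^bsub>K\<^esub>"
    using p(2) pe_closed[OF y] unfolding q by (intro K_add_eq_0[of _ "\<pi> (pe y p)"]) auto
  then have "pe y (?q - p) \<in> m" using pi_eq_0_iff pe_closed[OF y] by simp
  moreover have "coeff (?q - p) (Suc n) = 1" using p(1) by (simp add: coeff_eq_0)
  then have "?q - p \<noteq> 0" by (metis coeff_0 zero_neq_one)
  ultimately obtain c where c: "y \<ominus>\<^bsub>R\<^esub> scal (\<psi> [:c:]) \<in> m"
    using root_of_pe_mem[OF prime_m y] by blast
  have "\<pi> y = \<pi> ((y \<ominus>\<^bsub>R\<^esub> scal (\<psi> [:c:])) \<oplus>\<^bsub>R\<^esub> scal (\<psi> [:c:]))"
    using y by (simp add: R.minus_eq R.a_assoc R.l_neg)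
  also have "\<dots> = \<pi> (y \<ominus>\<^bsub>R\<^esub> scal (\<psi> [:c:])) \<oplus>\<^bsub>K\<^esub> \<pi> (scal (\<psi> [:c:]))"
    using y by (intro pi.hom_add) auto
  also have "\<pi> (y \<ominus>\<^bsub>R\<^esub> scal (\<psi> [:c:])) = \<zero>\<^bsub>K\<^esub>" using c pi_eq_0_iff y by simp
  finally show ?thesis by auto
qed

section \<open>The character with kernel \<open>m\<close>\<close>

definition \<chi> where "\<chi> y = (SOME c. \<pi> y = \<pi> (scal (\<psi> [:c:])))"

lemma pi_chi: "y \<in> carrier R \<Longrightarrow> \<pi> y = \<pi> (scal (\<psi> [:\<chi> y:]))"
  unfolding \<chi>_def by (rule someI_ex[OF exists_value])

lemma pi_const_inj:
  assumes "\<pi> (scal (\<psi> [:a:])) = \<pi> (scal (\<psi> [:b:]))"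
  shows "a = b"
proof (rule ccontr)
  assume "a \<noteq> b"
  have "\<psi> [:a - b:] * \<psi> [:inverse (a - b):] = \<psi> [:(a - b) * inverse (a - b):]"
    by (rule psi_const_mult[symmetric])
  then have "\<psi> [:a - b:] * \<psi> [:inverse (a - b):] = 1"
    using \<open>a \<noteq> b\<close> by (simp add: psi_1 flip: one_pCons)
  then have "scal (\<psi> [:a - b:]) \<notin> m" by (intro scal_unit_notin_m) auto
  moreover have "\<pi> (scal (\<psi> [:a - b:])) \<oplus>\<^bsub>K\<^esub> \<pi> (scal (\<psi> [:b:])) = \<pi> (scal (\<psi> [:a:]))"
    by (subst pi.hom_add[symmetric]) (auto simp flip: scal_add psi_const_add)
  then have "\<pi> (scal (\<psi> [:a - b:])) = \<zero>\<^bsub>K\<^esub>"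
    using assms by (intro K_add_eq_0[of _ "\<pi> (scal (\<psi> [:b:]))"]) auto
  ultimately show False using pi_eq_0_iff by simp
qed

lemma chi_eqI: "y \<in> carrier R \<Longrightarrow> \<pi> y = \<pi> (scal (\<psi> [:c:])) \<Longrightarrow> \<chi> y = c"
  using pi_chi pi_const_inj by metis

lemma chi_scal: "g \<in> \<O> \<Longrightarrow> \<chi> (scal g) = ev pt g"
  by (intro chi_eqI pi_scal) auto

lemma chi_add:
  assumes "x \<in> carrier R" "y \<in> carrier R"
  shows "\<chi> (x \<oplus>\<^bsub>R\<^esub> y) = \<chi> x + \<chi> y"
  using assms pi_chi[OF assms(1)] pi_chi[OF assms(2)]
  by (intro chi_eqI) (simp_all add: psi_const_add scal_add)

lemma chi_mult:
  assumes "x \<in> carrier R" "y \<in> carrier R"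
  shows "\<chi> (x \<otimes>\<^bsub>R\<^esub> y) = \<chi> x * \<chi> y"
  using assms pi_chi[OF assms(1)] pi_chi[OF assms(2)]
  by (intro chi_eqI) (simp_all add: psi_const_mult scal_times)

lemma chi_zero: "\<chi> \<zero>\<^bsub>R\<^esub> = 0"
  using chi_scal[of 0] h_pt by (auto simp: scal_0)

lemma chi_eq_0_iff:
  assumes "x \<in> carrier R"
  shows "\<chi> x = 0 \<longleftrightarrow> x \<in> m"
proof -
  have "\<chi> x = 0 \<longleftrightarrow> \<pi> x = \<pi> (scal (\<psi> [:0:]))"
    using pi_chi[OF assms] chi_eqI[OF assms] by metis
  also have "\<dots> \<longleftrightarrow> x \<in> m" using pi_eq_0_iff[OF assms] by (simp add: scal_0)
  finally show ?thesis .
qed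


section \<open>Values of the character on the homogeneous generators\<close>

definition lam where "lam a = \<chi> (W a 1)"
text \<open>The implication merges the two positions of the point. In both cases this is a subgroup
  (\<open>zero_in_B\<close>, \<open>B_diff\<close>), and it is the set of degrees where
  \<open>lam\<close> does not vanish (\<open>lam_nz\<close>, \<open>lam_eq_0\<close>).\<close>

definition B where "B = {b. pt = c0 \<longrightarrow> fr b = 0}"

lemma W_one_closed [simp]: "W a 1 \<in> carrier R"
  by auto

lemma W_W: "W a 1 \<otimes>\<^bsub>R\<^esub> W b 1 = scal (\<sigma> a b) \<otimes>\<^bsub>R\<^esub> W (a + b) 1"
proof
  fix c
  show "(W a 1 \<otimes>\<^bsub>R\<^esub> W b 1) c = (scal (\<sigma> a b) \<otimes>\<^bsub>R\<^esub> W (a + b) 1) c"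
  proof (cases "c = a + b")
    case True
    then show ?thesis unfolding W_mult scal_mult
      using w_nz[of "a + b"] by (simp add: W_def \<sigma>_def divide_inverse)
  next
    case False
    then have "c - a \<noteq> b" by (auto simp: algebra_simps)
    then show ?thesis unfolding W_mult scal_mult using False by (simp add: W_def)
  qed
qed

lemma lam_mult: "lam a * lam b = ev pt (\<sigma> a b) * lam (a + b)"
proof -
  have "lam a * lam b = \<chi> (W a 1 \<otimes>\<^bsub>R\<^esub> W b 1)" unfolding lam_def by (rule chi_mult[symmetric]) auto
  also have "\<dots> = \<chi> (scal (\<sigma> a b)) * lam (a + b)"
    unfolding W_W lam_def by (rule chi_mult) auto
  finally show ?thesis using chi_scal by auto
qed

lemma lam_0: "lam 0 \<noteq> 0"
proof -
  have "scal (f 0 0 / w 0) \<otimes>\<^bsub>R\<^esub> W 0 1 = \<one>\<^bsub>R\<^esub>"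
    unfolding scal_mult by (auto simp: W_def w_nz one_R)
  then have "\<chi> (scal (f 0 0 / w 0)) * lam 0 = \<chi> (scal 1)"
    unfolding lam_def scal_1 using f00_in_O by (subst chi_mult[symmetric]) auto
  then show ?thesis using chi_scal[OF one_in_O] h_pt by auto
qed

text \<open>Away from \<open>c0\<close> even a carry is harmless, because its factor X -
  \<open>c0\<close> does not vanish at \<open>pt\<close>.\<close>

lemma ev_sigma_nz:
  assumes "pt = c0 \<longrightarrow> fr a + fr b < 1"
  shows "ev pt (\<sigma> a b) \<noteq> 0"
proof (rule sigma_cases[of a b])
  fix u v assume u: "u \<in> \<O>" "v \<in> \<O>" "u * v = 1"
    "\<sigma> a b = u * (if fr a + fr b \<ge> 1 then \<psi> [:- c0, 1:] else 1)"
  have "ev pt u * ev pt v = 1" using ev_mult[OF h_pt u(1,2)] u(3) h_pt by simp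
  then have "ev pt u \<noteq> 0" by auto
  moreover have "ev pt (if fr a + fr b \<ge> 1 then \<psi> [:- c0, 1:] else 1) \<noteq> 0"
    using assms h_pt by (auto simp: ev_psi)
  ultimately show ?thesis unfolding u(4) using u(1) h_pt by (subst ev_mult) auto
qed

lemma ev_sigma_0:
  assumes "pt = c0" "fr a + fr b \<ge> 1"
  shows "ev pt (\<sigma> a b) = 0"
proof (rule sigma_cases[of a b])
  fix u v assume u: "u \<in> \<O>" "v \<in> \<O>" "u * v = 1"
    "\<sigma> a b = u * (if fr a + fr b \<ge> 1 then \<psi> [:- c0, 1:] else 1)"
  have "ev pt (\<psi> [:- c0, 1:]) = 0" using assms(1) ev_psi[OF h_pt] by simp
  then show ?thesis unfolding u(4) using assms(2) u(1) h_pt by (simp add: ev_mult psi_in_O)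
qed

lemma fr_uminus: "fr b = 0 \<Longrightarrow> fr (- b) = 0"
  using fr_add[of b "- b"] fr_0 fr_less[of "- b"] by simp

lemma fr_zero_diff: "fr b = 0 \<Longrightarrow> fr a = 0 \<longleftrightarrow> fr (b - a) = 0"
  using fr_add[of a "b - a"] fr_less[of a] fr_less[of "b - a"] by (auto split: if_splits)

lemma B_diff: "b \<in> B \<Longrightarrow> b - a \<in> B \<longleftrightarrow> a \<in> B"
  unfolding B_def using fr_zero_diff by auto

lemma zero_in_B: "0 \<in> B"
  unfolding B_def using fr_0 by simp

text \<open>The opposite degrees \<open>b\<close> and \<open>- b\<close> produce no zero of \<sigma>
  at \<open>pt\<close>, so \<open>lam b * lam (- b)\<close> is a nonzero multiple of
  \<open>lam 0\<close>.\<close>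

lemma lam_nz:
  assumes "b \<in> B" shows "lam b \<noteq> 0"
proof -
  have "ev pt (\<sigma> b (- b)) \<noteq> 0"
    using assms fr_uminus[of b] unfolding B_def by (intro ev_sigma_nz) auto
  then show ?thesis using lam_mult[of b "- b"] lam_0 by auto
qed

text \<open>The degrees whose generator is not killed by \<open>\<chi>\<close> are closed under doubling, and \<open>fr\<close> is
  additive on them, so it cannot have a positive maximum.\<close>

lemma lam_eq_0:
  assumes "a \<notin> B" shows "lam a = 0"
proof (rule ccontr)
  assume a: "lam a \<noteq> 0"
  have pt: "pt = c0" "fr a \<noteq> 0" using assms unfolding B_def by auto
  let ?S = "{a. lam a \<noteq> 0}"
  have "Max (fr ` ?S) \<in> fr ` ?S" using a by (intro Max_in) auto
  then obtain b where b: "lam b \<noteq> 0" "fr b = Max (fr ` ?S)" by auto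
  have max: "fr c \<le> fr b" if "lam c \<noteq> 0" for c
    unfolding b(2) using that by (intro Max_ge) auto
  have nz: "ev pt (\<sigma> b b) \<noteq> 0" "lam (b + b) \<noteq> 0" using lam_mult[of b b] b(1) by auto
  then have "fr b + fr b < 1" using ev_sigma_0[OF pt(1), of b b] by force
  then have "fr (b + b) = fr b + fr b" using fr_add[of b b] by simp
  then have "fr b \<le> 0" using max[OF nz(2)] by simp
  then show False using max[OF a] pt(2) fr_nonneg[of a] by simp
qed

lemma W_chi: "g \<in> \<O> \<Longrightarrow> \<chi> (W a g) = ev pt g * lam a"
  unfolding W_eq_scal[of a g] lam_def by (simp add: chi_mult chi_scal)

lemma chi_sum:
  assumes "x \<in> carrier R"
  shows "\<chi> x = (\<Sum>a\<in>UNIV. ev pt (x a / w a) * lam a)"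
proof -
  let ?P = "{x \<in> carrier R. \<chi> x = (\<Sum>a\<in>UNIV. ev pt (x a / w a) * lam a)}"
  have "x \<in> ?P"
  proof (rule generated_by_W)
    show "\<zero>\<^bsub>R\<^esub> \<in> ?P" using chi_zero h_pt by (simp add: zero_R[symmetric]) (simp add: zero_R)
    fix x y assume "x \<in> ?P" "y \<in> ?P"
    then show "x \<oplus>\<^bsub>R\<^esub> y \<in> ?P"
      using carrier_R[of x] carrier_R[of y]
      by (simp add: chi_add, simp add: add_R add_divide_distrib ev_add h_pt algebra_simps sum.distrib)
  next
    fix a g assume g: "g \<in> \<O>"
    have "(\<Sum>b\<in>UNIV. ev pt (W a g b / w b) * lam b) = (\<Sum>b\<in>UNIV. if b = a then ev pt g * lam a else 0)"
      by (rule sum.cong) (auto simp: W_def w_nz h_pt)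
    then show "W a g \<in> ?P" using g W_chi by auto
  qed (rule assms)
  then show ?thesis by simp
qed

section \<open>The element isolating the point \<open>m\<close> in its fibre\<close>

definition s where "s = (\<lambda>b. if b \<in> B then \<psi> [:inverse (lam b):] * w b else 0)"

lemma s_coord: "s b / w b = (if b \<in> B then \<psi> [:inverse (lam b):] else 0)"
  unfolding s_def using w_nz by simp

lemma s_closed: "s \<in> carrier R"
  unfolding carrier_R s_coord by auto

text \<open>Each term of \<open>s\<close> has value 1, so \<open>\<chi> s\<close> counts the
  elements of \<open>B\<close>, and a positive count is nonzero in characteristic 0.\<close>

lemma s_notin: "s \<notin> m"
proof -
  have "\<chi> s = (\<Sum>b\<in>UNIV. if b \<in> B then 1 else 0)"
    unfolding chi_sum[OF s_closed] s_coord
    by (rule sum.cong) (auto simp: ev_psi h_pt lam_nz)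
  also have "\<dots> = of_nat (card B)" by (simp add: sum.If_cases)
  also have "\<dots> \<noteq> 0" using zero_in_B by (auto simp: card_eq_0_iff)
  finally show ?thesis using chi_eq_0_iff[OF s_closed] by simp
qed

text \<open>The value in question is \<open>\<chi> x / lam b\<close>. Indeed \<open>lam_mult\<close>
  turns the structure constant divided by \<open>lam (b - a)\<close> into
  \<open>lam a / lam b\<close> when \<open>a\<close> is in \<open>B\<close>. For other
  \<open>a\<close> both sides are 0: \<open>s\<close> has no component in degree
  \<open>b - a\<close>, and \<open>lam a\<close> vanishes.\<close>

lemma mult_s_vanishes:
  assumes x: "x \<in> m" and b: "b \<in> B"
  shows "ev pt ((x \<otimes>\<^bsub>R\<^esub> s) b / w b) = 0"
proof -
  have xc: "x \<in> carrier R" using x m.Icarr by simp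
  have xO: "x a / w a \<in> \<O>" and sO: "s a / w a \<in> \<O>" for a
    using xc s_closed carrier_R by auto
  have "ev pt ((x \<otimes>\<^bsub>R\<^esub> s) b / w b) =
      (\<Sum>a\<in>UNIV. ev pt ((x a / w a) * (s (b - a) / w (b - a)) * \<sigma> a (b - a)))"
    unfolding mult_coord using xO sO by (intro ev_sum h_pt O_mult) auto
  also have "\<dots> = (\<Sum>a\<in>UNIV. ev pt (x a / w a) * lam a / lam b)"
  proof (rule sum.cong[OF refl])
    fix a
    have "ev pt ((x a / w a) * (s (b - a) / w (b - a)) * \<sigma> a (b - a)) =
        ev pt (x a / w a) * ev pt (s (b - a) / w (b - a)) * ev pt (\<sigma> a (b - a))"
      using ev_mult[OF h_pt O_mult[OF xO sO] sigma_in_O] ev_mult[OF h_pt xO sO] by simp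
    also have "\<dots> = ev pt (x a / w a) * lam a / lam b"
    proof (cases "a \<in> B")
      case True
      then have ba: "b - a \<in> B" using B_diff[OF b] by simp
      then have ev_s: "ev pt (s (b - a) / w (b - a)) = inverse (lam (b - a))"
        unfolding s_coord by (simp add: ev_psi h_pt)
      have "ev pt (\<sigma> a (b - a)) = lam a * lam (b - a) / lam b"
        using lam_mult[of a "b - a"] lam_nz[OF b] by simp
      then show ?thesis unfolding ev_s using lam_nz[OF ba] by simp
    next
      case False
      then have "ev pt (s (b - a) / w (b - a)) = 0"
        unfolding s_coord using B_diff[OF b] h_pt by simp
      then show ?thesis using lam_eq_0[OF False] by simp
    qed
    finally show "ev pt ((x a / w a) * (s (b - a) / w (b - a)) * \<sigma> a (b - a)) =
      ev pt (x a / w a) * lam a / lam b" .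
  qed
  also have "\<dots> = \<chi> x / lam b" unfolding chi_sum[OF xc] by (simp add: sum_divide_distrib)
  also have "\<dots> = 0" using chi_eq_0_iff[OF xc] x by simp
  finally show ?thesis .
qed

text \<open>Multiplication by a nonzero homogeneous element shifts degrees and scales each component
  by a nonzero function.\<close>

lemma mult_eq_0:
  assumes "g * w a \<noteq> 0" and "W a g \<otimes>\<^bsub>R\<^esub> x = \<zero>\<^bsub>R\<^esub>"
  shows "x = \<zero>\<^bsub>R\<^esub>"
proof
  fix c
  have "g * w a * x c * inverse (f a c) = 0"
    using fun_cong[OF assms(2), of "a + c"] unfolding W_mult zero_R by simp
  then show "x c = \<zero>\<^bsub>R\<^esub> c" using assms(1) f_nz by (simp add: zero_R)
qed

text \<open>A uniformizer at the point \<open>m\<close>: the coordinate \<open>X - pt\<close> if the covering is unramified there,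
  and otherwise the generator in a degree where \<open>fr\<close> takes its least positive value.\<close>

lemma exists_uniformizer:
  "\<exists>q\<in>m. (\<forall>x\<in>carrier R. q \<otimes>\<^bsub>R\<^esub> x = \<zero>\<^bsub>R\<^esub> \<longrightarrow> x = \<zero>\<^bsub>R\<^esub>) \<and>
    (\<forall>y\<in>carrier R. (\<forall>b\<in>B. ev pt (y b / w b) = 0) \<longrightarrow> (\<exists>x\<in>carrier R. y = q \<otimes>\<^bsub>R\<^esub> x))"
proof (cases "B = UNIV")
  case True
  let ?t = "\<psi> [:- pt, 1:]"
  have t0: "?t \<noteq> 0" using psi_inj[of "[:- pt, 1:]"] by auto
  have "x = \<zero>\<^bsub>R\<^esub>" if "scal ?t \<otimes>\<^bsub>R\<^esub> x = \<zero>\<^bsub>R\<^esub>" for x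
    using that t0 unfolding scal_mult zero_R by (auto simp: fun_eq_iff)
  moreover have "\<exists>x\<in>carrier R. y = scal ?t \<otimes>\<^bsub>R\<^esub> x"
    if y: "y \<in> carrier R" "\<forall>b\<in>B. ev pt (y b / w b) = 0" for y
  proof -
    have "\<exists>g. g \<in> \<O> \<and> y b / w b = ?t * g" for b
      using ev_eq_0D[OF h_pt, of "y b / w b"] y True carrier_R by (metis UNIV_I)
    then obtain g where g: "\<And>b. g b \<in> \<O>" "\<And>b. y b / w b = ?t * g b" by metis
    have "(\<lambda>b. g b * w b) \<in> carrier R" using g(1) w_nz unfolding carrier_R by simp
    moreover have "y b = ?t * (g b * w b)" for b
      using g(2)[of b] w_nz[of b] by (simp add: field_simps)
    then have "y = scal ?t \<otimes>\<^bsub>R\<^esub> (\<lambda>b. g b * w b)" unfolding scal_mult by auto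
    ultimately show ?thesis by blast
  qed
  ultimately show ?thesis using pt_mem by blast
next
  case False
  then have pt: "pt = c0" unfolding B_def by auto
  have fr_B: "a \<in> B \<longleftrightarrow> fr a = 0" for a unfolding B_def using pt by simp
  have "Min (fr ` (- B)) \<in> fr ` (- B)" using False by (intro Min_in) auto
  then obtain a0 where a0: "a0 \<notin> B" "fr a0 = Min (fr ` (- B))" by auto
  have min: "fr a0 \<le> fr a" if "a \<notin> B" for a
    unfolding a0(2) using that by (intro Min_le) auto
  have pos: "fr a0 > 0" using a0(1) fr_nonneg[of a0] fr_B[of a0] by simp
  \<comment> \<open>A carry that left \<open>fr (a0 + c)\<close> positive would give
    \<open>fr a0 + fr c - 1 < fr a0\<close>, against minimality of \<open>fr a0\<close>; without a
    carry, \<open>fr (a0 + c)\<close> is at least \<open>fr a0 > 0\<close>.\<close>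
  have carry: "fr a0 + fr c \<ge> 1 \<longleftrightarrow> a0 + c \<in> B" for c
    using fr_add[of a0 c] pos fr_nonneg[of c] fr_less[of c] min[of "a0 + c"] fr_B[of "a0 + c"]
    by (auto split: if_splits)
  have "W a0 1 \<in> m" using lam_eq_0[OF a0(1)] chi_eq_0_iff[of "W a0 1"] unfolding lam_def by simp
  moreover have "x = \<zero>\<^bsub>R\<^esub>" if "W a0 1 \<otimes>\<^bsub>R\<^esub> x = \<zero>\<^bsub>R\<^esub>" for x
    using mult_eq_0[OF _ that] w_nz by simp
  moreover have "\<exists>x\<in>carrier R. y = W a0 1 \<otimes>\<^bsub>R\<^esub> x"
    if y: "y \<in> carrier R" "\<forall>b\<in>B. ev pt (y b / w b) = 0" for y
  proof
    \<comment> \<open>The only candidate, by \<open>W_mult\<close>. Its coordinate in degree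
      \<open>c\<close> is that of \<open>y\<close> in degree \<open>a0 + c\<close> divided by
      \<open>\<sigma> a0 c\<close>, and whenever this structure constant has its zero at
      \<open>pt\<close>, \<open>y\<close> vanishes there too by \<open>carry\<close>.\<close>
    let ?x = "\<lambda>c. y (a0 + c) * f a0 c / w a0"
    show "y = W a0 1 \<otimes>\<^bsub>R\<^esub> ?x"
      by (rule ext) (simp add: W_mult w_nz f_nz)
    show "?x \<in> carrier R"
      unfolding carrier_R
    proof
      fix c
      have yO: "y (a0 + c) / w (a0 + c) \<in> \<O>" using y(1) carrier_R by simp
      show "?x c / w c \<in> \<O>"
      proof (rule sigma_cases[of a0 c])
        fix u v assume u: "u \<in> \<O>" "v \<in> \<O>" "u * v = 1"
          "\<sigma> a0 c = u * (if fr a0 + fr c \<ge> 1 then \<psi> [:- c0, 1:] else 1)"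
        let ?e = "if fr a0 + fr c \<ge> 1 then \<psi> [:- c0, 1:] else 1"
        have e0: "?e \<noteq> 0" using psi_inj[of "[:- c0, 1:]"] by auto
        obtain g where g: "g \<in> \<O>" "y (a0 + c) / w (a0 + c) = ?e * g"
        proof (cases "fr a0 + fr c \<ge> 1")
          case True
          then have "ev pt (y (a0 + c) / w (a0 + c)) = 0" using carry y(2) by simp
          then show thesis using ev_eq_0D[OF h_pt yO] that True pt by auto
        next
          case False
          then show thesis using that[OF yO] by simp
        qed
        have "?x c / w c = (y (a0 + c) / w (a0 + c)) / \<sigma> a0 c"
          unfolding \<sigma>_def using w_nz f_nz by (simp add: field_simps)
        also have "\<dots> = g / u" unfolding g(2) u(4) using e0 by simp
        also have "\<dots> = g * v" using inverse_unique[OF u(3)] by (simp add: divide_inverse)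
        finally show ?thesis using g(1) u(2) by auto
      qed
    qed
  qed
  ultimately show ?thesis by blast
qed

end

lemma (in graded_cover) regular_R: "regular_ring R"
proof (rule regular_ringI[OF cring_R noetherian_R])
  fix m assume "maximalideal m R"
  then interpret graded_cover_point \<psi> h c0 w f fr m
    by (intro graded_cover_point.intro graded_cover_axioms graded_cover_point_axioms.intro)
  obtain q where q: "q \<in> m" "\<forall>x\<in>carrier R. q \<otimes>\<^bsub>R\<^esub> x = \<zero>\<^bsub>R\<^esub> \<longrightarrow> x = \<zero>\<^bsub>R\<^esub>"
    "\<forall>y\<in>carrier R. (\<forall>b\<in>B. ev pt (y b / w b) = 0) \<longrightarrow> (\<exists>x\<in>carrier R. y = q \<otimes>\<^bsub>R\<^esub> x)"
    using exists_uniformizer by blast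
  have "\<exists>y\<in>carrier R. s \<otimes>\<^bsub>R\<^esub> x = q \<otimes>\<^bsub>R\<^esub> y" if x: "x \<in> m" for x
    using q(3) mult_s_vanishes[OF x] mult_closed[OF s_closed m.Icarr[OF x]]
    unfolding mult_R_comm[of s x] by blast
  then show "\<exists>q\<in>m. \<exists>s\<in>carrier R - m.
      (\<forall>x\<in>m. \<exists>y\<in>carrier R. s \<otimes>\<^bsub>R\<^esub> x = q \<otimes>\<^bsub>R\<^esub> y) \<and>
      (\<forall>x\<in>carrier R. q \<otimes>\<^bsub>R\<^esub> x = \<zero>\<^bsub>R\<^esub> \<longrightarrow> x = \<zero>\<^bsub>R\<^esub>)"
    using q(1,2) s_closed s_notin by blast
qed

section \<open>Orders of rational functions\<close>

lemma Fract_nonzero_cases: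
  fixes g :: "'a::idom fract"
  assumes "g \<noteq> 0"
  obtains a b where "g = Fract a b" "a \<noteq> 0" "b \<noteq> 0"
  by (cases g) (use assms that in \<open>auto simp: Zero_fract_def eq_fract\<close>)

text \<open>\<open>ord_at\<close> reads the reduced fraction; cross multiplication and additivity of
  order and degree extend the formula to any presentation.\<close>

lemma ord_at_Fract:
  assumes "a \<noteq> 0" "b \<noteq> 0"
  shows "ord_at (Pt z) (Fract a b) = int (order z a) - int (order z b)"
    and "ord_at Infinity (Fract a b) = int (degree b) - int (degree a)"
proof -
  define n d where "n = fst (quot_of_fract (Fract a b))" and "d = snd (quot_of_fract (Fract a b))"
  have d0: "d \<noteq> 0" unfolding d_def by simp
  have "Fract n d = Fract a b" unfolding n_def d_def by (rule Fract_quot_of_fract)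
  then have eq: "n * b = a * d" using assms d0 by (simp add: eq_fract)
  then have n0: "n \<noteq> 0" using assms d0 by auto
  have "order z n + order z b = order z a + order z d"
    using eq n0 d0 assms by (metis mult_eq_0_iff order_mult)
  then show "ord_at (Pt z) (Fract a b) = int (order z a) - int (order z b)"
    by (simp flip: n_def d_def)
  have "degree n + degree b = degree a + degree d"
    using eq n0 d0 assms by (metis degree_mult_eq)
  then show "ord_at Infinity (Fract a b) = int (degree b) - int (degree a)"
    by (simp flip: n_def d_def)
qed

lemma ord_at_mult:
  assumes "g \<noteq> 0" "k \<noteq> 0"
  shows "ord_at P (g * k) = ord_at P g + ord_at P k"
proof -
  obtain a b where g: "g = Fract a b" "a \<noteq> 0" "b \<noteq> 0" using Fract_nonzero_cases assms by blast
  obtain c d where k: "k = Fract c d" "c \<noteq> 0" "d \<noteq> 0" using Fract_nonzero_cases assms by blast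
  have gk: "g * k = Fract (a * c) (b * d)" "a * c \<noteq> 0" "b * d \<noteq> 0" using g k by auto
  show ?thesis
  proof (cases P)
    case (Pt z)
    show ?thesis unfolding Pt gk(1) ord_at_Fract[OF gk(2,3)]
      using gk(2,3) by (simp add: g(1) k(1) ord_at_Fract[OF g(2,3)] ord_at_Fract[OF k(2,3)]
          order_mult del: ord_at.simps)
  next
    case Infinity
    show ?thesis unfolding Infinity gk(1) ord_at_Fract[OF gk(2,3)]
      using g k by (simp add: ord_at_Fract degree_mult_eq del: ord_at.simps)
  qed
qed

lemma ord_at_one: "ord_at P 1 = 0"
  by (cases P) simp_all

lemma ord_at_inverse:
  assumes "g \<noteq> 0"
  shows "ord_at P (inverse g) = - ord_at P g"
  using ord_at_mult[of g "inverse g" P] assms by (simp add: ord_at_one)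

lemma ord_at_divide:
  assumes "g \<noteq> 0" "k \<noteq> 0"
  shows "ord_at P (g / k) = ord_at P g - ord_at P k"
  unfolding divide_inverse using assms by (simp add: ord_at_mult ord_at_inverse)

lemma ord_at_power:
  assumes "g \<noteq> 0"
  shows "ord_at P (g ^ n) = int n * ord_at P g"
  by (induct n) (use assms in \<open>simp_all add: ord_at_one ord_at_mult algebra_simps\<close>)

lemma ord_at_power_int:
  assumes "g \<noteq> 0"
  shows "ord_at P (g powi n) = n * ord_at P g"
  using assms
  by (cases "n \<ge> 0") (auto simp: power_int_def ord_at_power ord_at_inverse simp flip: power_inverse)

lemma const_fun_simps:
  "const_fun 0 = 0" "const_fun 1 = 1" "const_fun (a + b) = const_fun a + const_fun b"
  "const_fun (a * b) = const_fun a * const_fun b"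
  by (simp_all add: const_fun_def Zero_fract_def One_fract_def one_pCons mult.commute)

lemma const_fun_eq_0: "const_fun c = 0 \<longleftrightarrow> c = 0"
  by (simp add: const_fun_def Zero_fract_def eq_fract)

lemma ord_at_const: "c \<noteq> 0 \<Longrightarrow> ord_at P (const_fun c) = 0"
  unfolding const_fun_def by (cases P) (simp_all add: ord_at_Fract order_0I del: ord_at.simps)

section \<open>Affine charts of the projective line\<close>

text \<open>The homomorphism sending X to \<open>u\<close> and fixing the constants; it will serve
  as \<psi>.\<close>

definition subst_fun :: "ratfun \<Rightarrow> complex poly \<Rightarrow> ratfun" where
  "subst_fun u p = poly (map_poly const_fun p) u"

lemma subst_fun_0: "subst_fun u 0 = 0"
  by (simp add: subst_fun_def)

lemma subst_fun_pCons: "subst_fun u (pCons c p) = const_fun c + u * subst_fun u p"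
  by (simp add: subst_fun_def map_poly_pCons const_fun_simps)

lemma subst_fun_const: "subst_fun u [:c:] = const_fun c"
  by (simp add: subst_fun_pCons subst_fun_0)

lemma subst_fun_1: "subst_fun u 1 = 1"
  using subst_fun_const[of u 1] by (simp add: const_fun_simps flip: one_pCons)

lemma subst_fun_add: "subst_fun u (p + q) = subst_fun u p + subst_fun u q"
  by (induct p q rule: poly_induct2)
    (simp_all add: subst_fun_0 subst_fun_pCons const_fun_simps algebra_simps)

lemma subst_fun_smult: "subst_fun u (smult c p) = const_fun c * subst_fun u p"
  by (induct p) (simp_all add: subst_fun_0 subst_fun_pCons const_fun_simps algebra_simps)

lemma subst_fun_mult: "subst_fun u (p * q) = subst_fun u p * subst_fun u q"
  by (induct p)
    (simp_all add: subst_fun_0 subst_fun_pCons subst_fun_add subst_fun_smult const_fun_simps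
      algebra_simps)

text \<open>With this rule, nonvanishing and orders of a polynomial in \<open>u\<close> have to be
  checked only for constants and for \<open>u - const_fun r\<close>.\<close>

lemma complex_poly_linear_induct [consumes 1, case_names const linear]:
  fixes p :: "complex poly"
  assumes "p \<noteq> 0" and "\<And>c. c \<noteq> 0 \<Longrightarrow> P [:c:]"
    and "\<And>r q. q \<noteq> 0 \<Longrightarrow> P q \<Longrightarrow> P ([:- r, 1:] * q)"
  shows "P p"
  using assms(1)
proof (induct "degree p" arbitrary: p)
  case 0
  then obtain c where "p = [:c:]" by (metis degree_eq_zeroE)
  then show ?case using 0 assms(2) by simp
next
  case (Suc n)
  have "\<not> constant (poly p)" using Suc(2) by (simp add: constant_degree)
  then obtain r where "poly p r = 0" using fundamental_theorem_of_algebra by blast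
  then obtain q where q: "p = [:- r, 1:] * q" unfolding poly_eq_0_iff_dvd by blast
  then have q0: "q \<noteq> 0" using Suc(3) by auto
  then have "degree p = Suc (degree q)" unfolding q by (subst degree_mult_eq) auto
  then have "P q" using Suc(1)[of q] Suc(2) q0 by simp
  then show ?case unfolding q by (rule assms(3)[OF q0])
qed

text \<open>The complement of \<open>N\<close> with coordinate function \<open>u\<close>; the point \<open>Q\<close> has coordinate \<open>\<kappa> Q\<close>.\<close>

locale chart =
  fixes u :: ratfun and \<kappa> :: "closed_point \<Rightarrow> complex" and N :: closed_point
  assumes linear_nz: "u - const_fun r \<noteq> 0"
    and ord_linear: "Q \<noteq> N \<Longrightarrow> ord_at Q (u - const_fun r) = (if \<kappa> Q = r then 1 else 0)"
    and quotient: "\<exists>p q. q \<noteq> 0 \<and> g = subst_fun u p / subst_fun u q"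
    and kappa_inj: "Q \<noteq> N \<Longrightarrow> Q' \<noteq> N \<Longrightarrow> \<kappa> Q = \<kappa> Q' \<Longrightarrow> Q = Q'"
    and kappa_surj: "\<exists>Q. Q \<noteq> N \<and> \<kappa> Q = z"
begin

lemma subst_linear: "subst_fun u [:- r, 1:] = u - const_fun r"
proof -
  have "const_fun (- r) + const_fun r = 0" by (simp flip: const_fun_simps(3) add: const_fun_simps)
  then have "const_fun (- r) = - const_fun r" by (simp add: eq_neg_iff_add_eq_0)
  then show ?thesis by (simp add: subst_fun_pCons subst_fun_0 const_fun_simps)
qed

lemma subst_nz: "p \<noteq> 0 \<Longrightarrow> subst_fun u p \<noteq> 0"
proof (induct p rule: complex_poly_linear_induct)
  case (linear r q)
  then show ?case by (simp only: subst_fun_mult subst_linear mult_eq_0_iff linear_nz simp_thms)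
qed (simp_all add: subst_fun_const const_fun_eq_0)

lemma ord_subst:
  assumes "Q \<noteq> N" and "p \<noteq> 0"
  shows "ord_at Q (subst_fun u p) = int (order (\<kappa> Q) p)"
  using assms(2)
proof (induct p rule: complex_poly_linear_induct)
  case (linear r q)
  have "order (\<kappa> Q) ([:- r, 1:] * q) = order (\<kappa> Q) [:- r, 1:] + order (\<kappa> Q) q"
    using linear(1) by (intro order_mult no_zero_divisors) simp_all
  also have "order (\<kappa> Q) [:- r, 1:] = (if \<kappa> Q = r then 1 else 0)"
    using order_power_n_n[of r 1] by (auto intro!: order_0I)
  finally show ?case
    unfolding subst_fun_mult subst_linear
    using linear subst_nz[OF linear(1)] linear_nz ord_linear[OF assms(1)]
    by (simp add: ord_at_mult)
qed (simp_all add: subst_fun_const ord_at_const order_0I)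

end

text \<open>The set \<open>Z\<close> is what is removed from the line. It contains \<open>N\<close>,
  so that the rest lies in the chart and is a proper open set.\<close>

locale chart_open = chart +
  fixes Z :: "closed_point set" and P :: closed_point
  assumes finite_Z: "finite Z" and N_in: "N \<in> Z" and P_notin: "P \<notin> Z"
begin

text \<open>Inverting this polynomial removes the points of \<open>Z\<close> from the chart; the
  point \<open>N\<close> is already missing there.\<close>

definition h where "h = (\<Prod>Q\<in>Z - {N}. [:- \<kappa> Q, 1:])"

lemma poly_h: "poly h x = 0 \<longleftrightarrow> (\<exists>Q\<in>Z - {N}. \<kappa> Q = x)"
  unfolding h_def poly_prod using finite_Z by (auto simp: prod_zero_iff)

lemma poly_h_nz: "Q \<notin> Z \<Longrightarrow> poly h (\<kappa> Q) \<noteq> 0"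
  unfolding poly_h using kappa_inj N_in by (metis DiffE singletonI)

lemma h_nonzero: "h \<noteq> 0"
  using poly_h_nz[OF P_notin] by auto

sublocale localized_polynomials "subst_fun u" h
  using subst_fun_1 subst_fun_add subst_fun_mult subst_nz h_nonzero
  by unfold_locales blast+

definition U where "U = - Closed ` Z"

lemma U_open: "p1_open U"
  unfolding p1_open_def U_def using finite_Z by auto

lemma U_neq: "U \<noteq> {}" "U \<noteq> UNIV"
  unfolding U_def using N_in by auto

text \<open>For the converse, write \<open>g\<close> as a quotient of coprime polynomials in
  \<open>u\<close>. A root of the denominator \<open>q\<close> is a pole of \<open>g\<close>, hence
  comes from \<open>Z\<close> and is a root of \<open>h\<close>, so \<open>q\<close> divides a power
  of \<open>h\<close>.\<close>

lemma O_iff: "g \<in> \<O> \<longleftrightarrow> g = 0 \<or> (\<forall>Q. Q \<notin> Z \<longrightarrow> ord_at Q g \<ge> 0)"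
proof
  assume g: "g \<in> \<O>"
  have "ord_at Q g \<ge> 0" if "g \<noteq> 0" and Q: "Q \<notin> Z" for Q
  proof -
    have QN: "Q \<noteq> N" using Q N_in by blast
    obtain p n where pn: "g = subst_fun u p / subst_fun u h ^ n" using g by (rule O_cases)
    then have p0: "p \<noteq> 0" using \<open>g \<noteq> 0\<close> by auto
    have "ord_at Q g = int (order (\<kappa> Q) p) - int n * int (order (\<kappa> Q) h)"
      unfolding pn using p0 h_nonzero QN
      by (simp add: ord_at_divide ord_at_power subst_nz ord_subst)
    then show ?thesis using order_0I[OF poly_h_nz[OF Q]] by simp
  qed
  then show "g = 0 \<or> (\<forall>Q. Q \<notin> Z \<longrightarrow> ord_at Q g \<ge> 0)" by blast
next
  assume "g = 0 \<or> (\<forall>Q. Q \<notin> Z \<longrightarrow> ord_at Q g \<ge> 0)"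
  then consider "g = 0" | "g \<noteq> 0" "\<forall>Q. Q \<notin> Z \<longrightarrow> ord_at Q g \<ge> 0" by blast
  then show "g \<in> \<O>"
  proof cases
    case 2
    obtain p' q' where pq': "q' \<noteq> 0" "g = subst_fun u p' / subst_fun u q'" using quotient by blast
    have "gcd p' q' \<noteq> 0" using pq' by simp
    then obtain p q where pq: "p' = p * gcd p' q'" "q' = q * gcd p' q'" "coprime p q"
      using gcd_coprime_exists by blast
    have q0: "q \<noteq> 0" using pq pq'(1) by auto
    have p0: "p \<noteq> 0" using pq pq'(2) 2(1) by (auto simp: subst_fun_0)
    have g: "g = subst_fun u p / subst_fun u q"
      unfolding pq'(2) using subst_nz[OF \<open>gcd p' q' \<noteq> 0\<close>]
      by (subst pq(1), subst pq(2)) (simp add: subst_fun_mult)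
    have "poly h x = 0" if x: "poly q x = 0" for x
    proof (rule ccontr)
      assume hx: "poly h x \<noteq> 0"
      obtain Q where Q: "Q \<noteq> N" "\<kappa> Q = x" using kappa_surj by blast
      have "Q \<notin> Z" using hx Q unfolding poly_h by blast
      have "poly p x \<noteq> 0"
      proof
        assume "poly p x = 0"
        then have "is_unit [:- x, 1:]"
          using x pq(3) unfolding poly_eq_0_iff_dvd by (rule coprime_common_divisor[rotated])
        then show False by (simp add: is_unit_pCons_iff)
      qed
      then have "ord_at Q g = - int (order x q)"
        unfolding g using p0 q0 Q by (simp add: ord_at_divide subst_nz ord_subst order_0I)
      moreover have "order x q > 0" using x q0 order_root by blast
      ultimately show False using 2(2) \<open>Q \<notin> Z\<close> by fastforce
    qed
    then have "q dvd h ^ degree q"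
      using nullstellensatz_univariate[of q h] q0 by blast
    then obtain r where r: "h ^ degree q = q * r" by (auto elim: dvdE)
    have r0: "r \<noteq> 0" using r h_nonzero by auto
    have "g = subst_fun u (p * r) / subst_fun u (q * r)"
      unfolding g subst_fun_mult using subst_nz[OF r0] by simp
    then have "g = subst_fun u (p * r) / subst_fun u h ^ degree q"
      by (simp add: psi_power flip: r)
    then show ?thesis using O_I by simp
  qed auto
qed

end

text \<open>The value 0 given to \<open>Infinity\<close> is a dummy, since that point is outside the
  chart.\<close>

lemma chart_finite: "chart (Fract [:0, 1:] 1) (\<lambda>Q. case Q of Pt z \<Rightarrow> z | Infinity \<Rightarrow> 0) Infinity"
proof
  let ?u = "Fract [:0, 1:] 1 :: ratfun"
  have lin: "?u - const_fun r = Fract [:- r, 1:] 1" for r by (simp add: const_fun_def)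
  show "?u - const_fun r \<noteq> 0" for r
    unfolding lin by (simp add: Zero_fract_def eq_fract)
  show "ord_at Q (?u - const_fun r) = (if (case Q of Pt z \<Rightarrow> z | Infinity \<Rightarrow> 0) = r then 1 else 0)"
    if "Q \<noteq> Infinity" for Q r
    using that order_power_n_n[of r 1] unfolding lin
    by (cases Q) (auto simp: ord_at_Fract order_0I simp del: ord_at.simps)
  have subst: "subst_fun ?u p = Fract p 1" for p
    by (induct p) (simp_all add: subst_fun_0 subst_fun_pCons Zero_fract_def const_fun_def)
  show "\<exists>p q. q \<noteq> 0 \<and> g = subst_fun ?u p / subst_fun ?u q" for g
    unfolding subst by (cases g) auto
  show "\<exists>Q. Q \<noteq> Infinity \<and> (case Q of Pt z \<Rightarrow> z | Infinity \<Rightarrow> 0) = z" for z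
    by (intro exI[of _ "Pt z"]) simp
qed (auto split: closed_point.splits)

text \<open>The coordinate 1/z, which is 0 at \<open>Infinity\<close>. The point \<open>Pt 0\<close>
  receives the same value through \<open>inverse 0 = 0\<close>, but it is excluded from this
  chart.\<close>

lemma chart_infinity:
  "chart (Fract 1 [:0, 1:]) (\<lambda>Q. case Q of Pt z \<Rightarrow> inverse z | Infinity \<Rightarrow> 0) (Pt 0)"
proof
  let ?u = "Fract 1 [:0, 1:] :: ratfun" and ?k = "\<lambda>Q. case Q of Pt z \<Rightarrow> inverse z | Infinity \<Rightarrow> 0"
  have lin: "?u - const_fun r = Fract [:1, - r:] [:0, 1:]" for r
    by (simp add: const_fun_def one_pCons)
  show nz: "?u - const_fun r \<noteq> 0" for r
    unfolding lin by (simp add: Zero_fract_def eq_fract)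
  show "ord_at Q (?u - const_fun r) = (if ?k Q = r then 1 else 0)" if "Q \<noteq> Pt 0" for Q r
  proof (cases Q)
    case (Pt z)
    have z: "z \<noteq> 0" using that Pt by simp
    have "order z [:1, - r:] = (if inverse z = r then 1 else 0)"
    proof (cases "inverse z = r")
      case True
      then have eq: "[:1, - r:] = smult (- r) [:- z, 1:]" and r: "r \<noteq> 0" using z by auto
      have "order z [:1, - r:] = order z [:- z, 1:]"
        unfolding eq by (rule order_smult) (use r in simp)
      then show ?thesis using True order_power_n_n[of z 1] by simp
    next
      case False
      then have "poly [:1, - r:] z \<noteq> 0" using z by (auto simp: field_simps)
      then show ?thesis using False by (simp add: order_0I)
    qed
    then show ?thesis using z unfolding lin Pt
      by (subst ord_at_Fract) (auto simp: order_0I)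
  qed (auto simp: lin ord_at_Fract simp del: ord_at.simps)
  have X: "subst_fun ?u [:0, 1:] = ?u" by (simp add: subst_fun_pCons subst_fun_0 const_fun_simps)
  have u0: "?u \<noteq> 0" by (simp add: Zero_fract_def eq_fract)
  have pow: "subst_fun ?u ([:0, 1:] ^ n) = ?u ^ n" for n
    by (induct n) (simp_all only: power_0 power_Suc subst_fun_1 subst_fun_mult X)
  \<comment> \<open>A polynomial in z = 1/u is a polynomial in u divided by a power of u.\<close>
  have num: "\<exists>p n. Fract a 1 = subst_fun ?u p / ?u ^ n" for a
  proof (induct a)
    case 0
    show ?case by (intro exI[of _ 0]) (simp add: subst_fun_0 Zero_fract_def)
  next
    case (pCons c a)
    then obtain p n where p: "Fract a 1 = subst_fun ?u p / ?u ^ n" by blast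
    have "Fract (pCons c a) 1 = const_fun c + Fract a 1 / ?u"
      by (simp add: const_fun_def divide_inverse)
    also have "\<dots> = (const_fun c * ?u ^ Suc n + subst_fun ?u p) / ?u ^ Suc n"
      unfolding p using u0 by (simp add: field_simps)
    also have "const_fun c * ?u ^ Suc n = subst_fun ?u ([:c:] * [:0, 1:] ^ Suc n)"
      unfolding subst_fun_mult pow subst_fun_const ..
    finally show ?case unfolding subst_fun_add[symmetric] by blast
  qed
  show "\<exists>p q. q \<noteq> 0 \<and> g = subst_fun ?u p / subst_fun ?u q" for g
  proof (cases g)
    case (Fract a b)
    obtain p n where p: "Fract a 1 = subst_fun ?u p / ?u ^ n" using num by blast
    obtain q k where q: "Fract b 1 = subst_fun ?u q / ?u ^ k" using num by blast
    have "Fract b 1 \<noteq> 0" using Fract(2) by (simp add: Zero_fract_def eq_fract)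
    then have q0: "q \<noteq> 0" using q by (auto simp: subst_fun_0)
    have "g = Fract a 1 / Fract b 1" using Fract by simp
    also have "\<dots> = subst_fun ?u (p * [:0, 1:] ^ k) / subst_fun ?u (q * [:0, 1:] ^ n)"
      unfolding p q subst_fun_mult pow by (simp add: field_simps)
    finally show ?thesis using q0 by (intro exI conjI) auto
  qed
  show "\<exists>Q. Q \<noteq> Pt 0 \<and> ?k Q = z" for z
    by (cases "z = 0") (auto intro: exI[of _ Infinity] exI[of _ "Pt (inverse z)"])
qed (auto split: closed_point.splits)

section \<open>The covering over a chart\<close>

text \<open>The open set is so small that all the divisors have coefficient 0 away from
  \<open>P\<close>. Hence the functions \<open>f a b\<close> have neither zeros nor poles there
  (\<open>ord_f\<close>), and only one fractional part matters in each degree.\<close>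

locale cover_chart = chart_open u \<kappa> N Z P for u \<kappa> N Z P +
  fixes Et :: "'a::{ab_group_add, finite} dual \<Rightarrow> rat divisor"
    and f :: "'a dual \<Rightarrow> 'a dual \<Rightarrow> ratfun"
  assumes adm: "admissible_functions Et f"
    and supp: "Q \<notin> Z \<Longrightarrow> Q \<noteq> P \<Longrightarrow> Poly_Mapping.lookup (Et a) Q = 0"
begin

abbreviation c0 where "c0 \<equiv> \<kappa> P"
abbreviation t where "t \<equiv> subst_fun u [:- c0, 1:]"

definition fl where "fl a = \<lfloor>Poly_Mapping.lookup (Et a) P\<rfloor>"
text \<open>The function \<open>t\<close> has a simple zero at \<open>P\<close> and no other zero or
  pole on the open set, so this power generates the sections in degree \<open>a\<close>, see
  \<open>sections_iff\<close>.\<close>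

definition w where "w a = t powi (- fl a)"
definition fr where "fr a = frac (Poly_Mapping.lookup (Et a) P)"

lemma P_neq: "P \<noteq> N"
  using N_in P_notin by blast

lemma t_nz: "t \<noteq> 0"
  by (rule subst_nz) simp

lemma w_nonzero: "w a \<noteq> 0"
  unfolding w_def using t_nz by simp

lemma ord_t: "Q \<notin> Z \<Longrightarrow> ord_at Q t = (if Q = P then 1 else 0)"
  unfolding subst_linear
  using ord_linear[of Q c0] kappa_inj[of Q P] P_neq N_in by (cases "Q = N") auto

lemma ord_w: "Q \<notin> Z \<Longrightarrow> ord_at Q (w a) = (if Q = P then - fl a else 0)"
  unfolding w_def ord_at_power_int[OF t_nz] using ord_t[of Q] by simp

lemma f_nonzero: "f a b \<noteq> 0" and f_symm: "f a b = f b a"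
  and f_cocycle: "f a b * f (a + b) c = f a (b + c) * f b c"
  using adm unfolding admissible_functions_def by blast+

lemma lookup_Et: "Poly_Mapping.lookup (Et a) Q + Poly_Mapping.lookup (Et b) Q + of_int (ord_at Q (f a b)) = Poly_Mapping.lookup (Et (a + b)) Q"
proof -
  have "Et a + Et b + Poly_Mapping.map of_int (principal_divisor (f a b)) = Et (a + b)"
    using adm unfolding admissible_functions_def by blast
  moreover have "Poly_Mapping.lookup (Poly_Mapping.map of_int (principal_divisor (f a b))) Q =
      (of_int (ord_at Q (f a b)) :: rat)"
    using f_nonzero[of a b] by (simp add: Poly_Mapping.map.rep_eq principal_divisor.rep_eq when_def)
  ultimately show ?thesis by (metis lookup_add)
qed

lemma ord_f_P: "of_int (ord_at P (f a b) + fl a + fl b - fl (a + b)) = fr (a + b) - fr a - fr b"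
  using lookup_Et[of a P b] unfolding fr_def fl_def frac_def by simp

lemma ord_f: "Q \<notin> Z \<Longrightarrow> Q \<noteq> P \<Longrightarrow> ord_at Q (f a b) = 0"
  using lookup_Et[of a Q b] by (simp add: supp)

text \<open>By \<open>ord_f_P\<close> the left side is an integer equal to
  \<open>fr (a + b) - fr a - fr b\<close>. It lies strictly between -2 and 0 if
  \<open>fr a + fr b \<ge> 1\<close>, and strictly between -1 and 1 otherwise.\<close>

lemma carry:
  "ord_at P (f a b) + fl a + fl b - fl (a + b) = (if fr a + fr b \<ge> 1 then - 1 else 0)"
proof -
  define k where "k = ord_at P (f a b) + fl a + fl b - fl (a + b)"
  have k: "of_int k = fr (a + b) - fr a - fr b" unfolding k_def by (rule ord_f_P)
  have bounds: "0 \<le> fr a" "fr a < 1" "0 \<le> fr b" "fr b < 1" "0 \<le> fr (a + b)" "fr (a + b) < 1"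
    unfolding fr_def by (simp_all add: frac_lt_1)
  have "k = (if fr a + fr b \<ge> 1 then - 1 else 0)"
  proof (cases "fr a + fr b \<ge> 1")
    case True
    then have "of_int (- 2) < (of_int k :: rat)" "of_int k < (of_int 0 :: rat)"
      using k bounds by simp_all
    then show ?thesis using True unfolding of_int_less_iff by simp
  next
    case False
    then have "of_int (- 1) < (of_int k :: rat)" "of_int k < (of_int 1 :: rat)"
      using k bounds by simp_all
    then show ?thesis using False unfolding of_int_less_iff by simp
  qed
  then show ?thesis unfolding k_def .
qed

sublocale graded_cover "subst_fun u" h c0 w f fr
proof
  show "poly h c0 \<noteq> 0" by (rule poly_h_nz[OF P_notin])
  fix a b c
  show "w a \<noteq> 0" by (rule w_nonzero)
  show "f a b \<noteq> 0" by (rule f_nonzero)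
  show "f a b = f b a" by (rule f_symm)
  show "f a b * f (a + b) c = f a (b + c) * f b c" by (rule f_cocycle)
  show "0 \<le> fr a" "fr a < 1" unfolding fr_def by (simp_all add: frac_lt_1)
  show "fr a + fr b - fr (a + b) = (if fr a + fr b \<ge> 1 then 1 else 0)"
  proof (cases "fr a + fr b \<ge> 1")
    case True
    then have "fr (a + b) - fr a - fr b = of_int (- 1)"
      using ord_f_P[of a b] carry[of a b] by (simp only: if_True)
    then show ?thesis using True by simp
  next
    case False
    then have "fr (a + b) - fr a - fr b = of_int 0"
      using ord_f_P[of a b] carry[of a b] by (simp only: if_False)
    then show ?thesis using False by simp
  qed
  let ?e = "if fr a + fr b \<ge> 1 then t else 1"
  \<comment> \<open>The unit required by \<open>w_mult\<close>. Its order is 0 at every point of the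
    open set, so by \<open>O_iff\<close> it and its inverse are regular there.\<close>
  let ?v = "w a * w b / (?e * f a b * w (a + b))"
  have e0: "?e \<noteq> 0" using t_nz by simp
  have v0: "?v \<noteq> 0" using e0 w_nonzero f_nonzero by simp
  have ord: "ord_at Q ?v = 0" if Q: "Q \<notin> Z" for Q
  proof -
    have "ord_at Q ?v = ord_at Q (w a) + ord_at Q (w b) - ord_at Q ?e - ord_at Q (f a b) -
        ord_at Q (w (a + b))"
      using e0 w_nonzero f_nonzero by (simp only: ord_at_divide ord_at_mult mult_eq_0_iff simp_thms)
    also have "ord_at Q ?e = (if Q = P \<and> fr a + fr b \<ge> 1 then 1 else 0)"
      using ord_t[OF Q] by (cases "Q = P") (simp_all add: ord_at_one)
    finally show ?thesis
      unfolding ord_w[OF Q] using carry[of a b] ord_f[OF Q] by (auto split: if_splits)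
  qed
  have "?v \<in> \<O>" "inverse ?v \<in> \<O>"
    unfolding O_iff using ord ord_at_inverse[OF v0] by auto
  moreover have "?v * inverse ?v = 1" using v0 by (rule right_inverse)
  moreover have "w a * w b = ?v * ?e * f a b * w (a + b)"
    using e0 w_nonzero f_nonzero by simp
  ultimately show "\<exists>u\<in>\<O>. \<exists>v\<in>\<O>. u * v = 1 \<and> w a * w b = u * ?e * f a b * w (a + b)" by blast
qed

lemma sections_iff: "g \<in> O_sections_rat (Et a) U \<longleftrightarrow> g / w a \<in> \<O>"
proof (cases "g = 0")
  case False
  have "Poly_Mapping.lookup (Poly_Mapping.map floor (Et a)) Q = \<lfloor>Poly_Mapping.lookup (Et a) Q\<rfloor>" for Q
    by (simp add: Poly_Mapping.map.rep_eq when_def)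
  then have "g \<in> O_sections_rat (Et a) U \<longleftrightarrow>
      (\<forall>Q. Q \<notin> Z \<longrightarrow> ord_at Q g + \<lfloor>Poly_Mapping.lookup (Et a) Q\<rfloor> \<ge> 0)"
    unfolding O_sections_rat_def O_sections_def using U_neq(1) False by (auto simp: U_def)
  also have "\<dots> \<longleftrightarrow> (\<forall>Q. Q \<notin> Z \<longrightarrow> ord_at Q (g / w a) \<ge> 0)"
    by (intro iff_allI imp_cong refl)
      (auto simp: ord_at_divide[OF False w_nonzero] ord_w fl_def supp)
  finally show ?thesis unfolding O_iff using False w_nonzero by simp
qed (auto simp: O_sections_rat_def O_sections_def U_neq zero_in_O)

lemma sec_cover_algebra: "sec (cover_algebra Et f) U = R"
  unfolding cover_algebra_def R_def cover_unit_def
  using U_neq(1) by (simp add: sections_iff subst_fun_const)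

end

text \<open>A relative spectrum is described only over proper open sets, so besides unwanted support
  a point \<open>N\<close> other than the given one is removed, which also decides between the two
  charts.\<close>

lemma smooth_coordinate_algebra:
  fixes Et :: "'a::{ab_group_add, finite} dual \<Rightarrow> rat divisor"
  assumes "admissible_functions Et f"
  obtains U where "p1_open U" "U \<noteq> UNIV" "x \<in> U" "complex_algebra (sec (cover_algebra Et f) U)"
    "fin_gen_algebra (sec (cover_algebra Et f) U)" "regular_ring (sec (cover_algebra Et f) U)"
proof -
  \<comment> \<open>The generic point lies in every nonempty open set, so any closed point can stand
    in for it.\<close>
  define P where "P = (case x of Closed P \<Rightarrow> P | Generic \<Rightarrow> Pt 0)"
  define N where "N = (if P = Infinity then Pt 0 else Infinity)"
  \<comment> \<open>This is a finite set because the dual of the finite group is finite.\<close>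
  define Z where "Z = insert N ((\<Union>a. Poly_Mapping.keys (Et a)) - {P})"
  have "\<exists>u \<kappa>. chart u \<kappa> N"
    unfolding N_def using chart_finite chart_infinity by auto
  then obtain u \<kappa> where "chart u \<kappa> N" by blast
  then interpret chart u \<kappa> N .
  interpret cover_chart u \<kappa> N Z P Et f
    by unfold_locales (auto simp: Z_def N_def assms in_keys_iff)
  have "x \<in> U" unfolding U_def using P_notin by (cases x) (auto simp: P_def)
  then show thesis
    using that[of U] U_open U_neq(2) complex_algebra_R fin_gen_R regular_R
    unfolding sec_cover_algebra by blast
qed

theorem theorem3p2:
  fixes E :: "'a::{ab_group_add, finite} divisor"
    and Et :: "'a dual \<Rightarrow> rat divisor"
    and f :: "'a dual \<Rightarrow> 'a dual \<Rightarrow> ratfun"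
    and C :: "('p, 's) ringed_space"
    and \<pi> :: "'p \<Rightarrow> p1_point"
    and \<Psi> :: "p1_point set \<Rightarrow> ratfun \<Rightarrow> 's"
    and \<alpha> :: "p1_point set \<Rightarrow> ('a dual \<Rightarrow> ratfun) \<Rightarrow> 's"
  assumes "div_degree E = 0"
    and "\<And>a. is_lift (Et a) (char_divisor E a)"
    and "admissible_functions Et f"
    and "relative_spectrum (cover_algebra Et f) (cover_structure_map f) C \<pi> \<Psi> \<alpha>"
  shows "smooth_over_complex TYPE('a dual \<Rightarrow> ratfun) C"
  unfolding smooth_over_complex_def
proof (intro conjI ballI)
  note spec = assms(4)[unfolded relative_spectrum_def]
  show "complex_ringed_space C" using spec by blast
  have cont: "continuous_map (spc C) (topology p1_open) \<pi>"
    using spec unfolding lrs_morphism_def P1_def by simp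
  fix x assume x: "x \<in> topspace (spc C)"
  obtain U where U: "p1_open U" "U \<noteq> UNIV" "\<pi> x \<in> U"
    and R: "complex_algebra (sec (cover_algebra Et f) U)"
      "fin_gen_algebra (sec (cover_algebra Et f) U)" "regular_ring (sec (cover_algebra Et f) U)"
    using smooth_coordinate_algebra[OF assms(3)] by metis
  have "openin (topology p1_open) U" using U(1) istopology_p1_open by (simp add: topology_inverse')
  then have "openin (spc C) (preimage C \<pi> U)"
    unfolding preimage_def by (rule openin_continuous_map_preimage[OF cont])
  moreover have "x \<in> preimage C \<pi> U" unfolding preimage_def using x U(3) by simp
  moreover obtain \<phi> \<Phi> where
    "rs_iso (open_subspace C (preimage C \<pi> U)) (affine_scheme (sec (cover_algebra Et f) U)) \<phi> \<Phi>"
    \<comment> \<open>This selects the last clause of \<open>relative_spectrum\<close>, the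
      identification over proper open sets.\<close>
    using spec[THEN conjunct2, THEN conjunct2, THEN conjunct2, THEN conjunct2, rule_format,
        OF conjI[OF U(1,2)]]
    by (elim exE conjE)
  ultimately show "\<exists>W (R :: (complex, 'a dual \<Rightarrow> ratfun) module) \<phi> \<Phi>.
      openin (spc C) W \<and> x \<in> W \<and> complex_algebra R \<and> fin_gen_algebra R \<and> regular_ring R \<and>
      rs_iso (open_subspace C W) (affine_scheme R) \<phi> \<Phi>"
    using R by (intro exI conjI)
qed

end
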